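(* Let $p,q$ be distinct primes, let $a\in\mathbb F_p^\times$, and let $C$ be the superelliptic curve $y^q=x^p-x+a$ over $\mathbb F_p$ with Jacobian $J$. Let $k=\operatorname{ord}_q p$ be the least positive integer $k$ such that $q\mid p^k-1$. Then $J$ has no $q$-torsion over $\mathbb F_p$ (that is, $J(\mathbb F_p)$ contains no nonzero element killed by $q$) if and only if $p\nmid k$.
   Context: The superelliptic curve $y^q=F(x)$ means the smooth projective model of the affine curve given by this equation. Here $F(x)=x^p-x+a$ is separable, and $C$ has exactly one point at infinity. *)

theory Defs
  imports
    "HOL-Algebra.Algebraic_Closure_Type"
    "HOL-Algebra.Free_Abelian_Groups"
    "HOL-Computational_Algebra.Computational_Algebra"
    "HOL-Number_Theory.Pocklington"
    "HOL-Library.FuncSet"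
    "HOL-Library.Cardinality"
begin

text \<open>
  A smooth projective curve over a field k is treated through its function field K / k: its closed
  points are the places of K / k. All function fields live inside a fixed algebraic closure of
  the rational function field k(x).
\<close>

type_synonym 'k ambient = "'k poly fract alg_closure"

definition const :: "'k::field \<Rightarrow> 'k ambient" where
  "const c = to_ac (to_fract [:c:])"

definition var_x :: "'k::field ambient" where
  "var_x = to_ac (to_fract [:0, 1:])"

definition is_subfield :: "'b::field set \<Rightarrow> bool" where
  "is_subfield L \<longleftrightarrow> 0 \<in> L \<and> 1 \<in> L \<and>
     (\<forall>u\<in>L. \<forall>v\<in>L. u + v \<in> L \<and> u - v \<in> L \<and> u * v \<in> L) \<and> (\<forall>u\<in>L. inverse u \<in> L)"

definition curve_field :: "'k::field ambient \<Rightarrow> 'k ambient set"  (* the field k(x, y) *)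
  where "curve_field y = is_subfield hull (range const \<union> {var_x, y})"

text \<open>
  A place is represented by its valuation ring, a proper subring R of K containing the constants
  such that each z in K satisfies z \<in> R or 1/z \<in> R.
\<close>

definition places :: "'k::field ambient set \<Rightarrow> 'k ambient set set" where
  "places K = {R. R \<subseteq> K \<and> R \<noteq> K \<and> range const \<subseteq> R \<and>
     (\<forall>u\<in>R. \<forall>v\<in>R. u + v \<in> R \<and> u - v \<in> R \<and> u * v \<in> R) \<and>
     (\<forall>z\<in>K. z \<in> R \<or> inverse z \<in> R)}"

definition max_ideal :: "'b::field set \<Rightarrow> 'b set" where
  "max_ideal R = {z \<in> R. z = 0 \<or> inverse z \<notin> R}"

text \<open>The normalised discrete valuation of a nonzero f: f = t^n u, with t a uniformiser, u a unit.\<close>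

definition place_val :: "'b::field set \<Rightarrow> 'b \<Rightarrow> int" where
  "place_val R f = (THE n. \<exists>t u. max_ideal R = (\<lambda>z. t * z) ` R \<and>
     u \<noteq> 0 \<and> u \<in> R \<and> inverse u \<in> R \<and> f = t powi n * u)"

text \<open>
  The degree of a place is the dimension over k of its residue field: the size of a family B in R
  whose residue classes form a basis of R / max_ideal R.
\<close>

definition place_degree :: "'k::field ambient set \<Rightarrow> nat" where
  "place_degree R = (THE d. \<exists>B. B \<subseteq> R \<and> finite B \<and> card B = d \<and>
     (\<forall>z\<in>R. \<exists>!c. c \<in> B \<rightarrow>\<^sub>E UNIV \<and> z - (\<Sum>b\<in>B. const (c b) * b) \<in> max_ideal R))"

definition div_group :: "'k::field ambient set \<Rightarrow> ('k ambient set \<Rightarrow>\<^sub>0 int) monoid" where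
  "div_group K = free_Abelian_group (places K)"

definition div_degree :: "('k::field ambient set \<Rightarrow>\<^sub>0 int) \<Rightarrow> int" where
  "div_degree D = (\<Sum>P\<in>Poly_Mapping.keys D. Poly_Mapping.lookup D P * int (place_degree P))"

definition div_group0 :: "'k::field ambient set \<Rightarrow> ('k ambient set \<Rightarrow>\<^sub>0 int) monoid" where
  "div_group0 K = (div_group K)\<lparr>carrier := {D \<in> carrier (div_group K). div_degree D = 0}\<rparr>"

definition principal_divisors :: "'k::field ambient set \<Rightarrow> ('k ambient set \<Rightarrow>\<^sub>0 int) set" where
  "principal_divisors K = {D \<in> carrier (div_group K).
     \<exists>f\<in>K - {0}. \<forall>P\<in>places K. Poly_Mapping.lookup D P = place_val P f}"

text \<open>
  The group J(k) of k-rational points of the Jacobian of the curve C with function field K, as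
  the group Pic^0(C) of classes of degree-zero divisors defined over k. This is J(k) whenever C
  has a k-rational point; for the superelliptic curves considered here, the unique point at
  infinity is one.
\<close>

definition jacobian_points ::
    "'k::field ambient set \<Rightarrow> ('k ambient set \<Rightarrow>\<^sub>0 int) set monoid" where
  "jacobian_points K = div_group0 K Mod principal_divisors K"

end

theory Submission
  imports Defs "HOL-Algebra.Sylow"
begin

text \<open>
  The group \<open>J\<close> is finite, so by Cauchy's theorem the claim is that \<open>q\<close> divides its order \<open>h\<close> exactly
  when \<open>p\<close> divides \<open>k = ord q p\<close>. The order is read off from the number \<open>a(n)\<close> of effective divisors
  of degree \<open>n\<close> supported away from infinity: for large \<open>n\<close> every class contains equally many of them,
  and this number is a power of \<open>p\<close>, so \<open>q\<close> divides \<open>h\<close> if and only if it divides \<open>a(n)\<close>.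

  The numbers \<open>a(n)\<close> are the coefficients of an Euler product over the Frobenius orbits of points \<open>(z, w)\<close>
  with \<open>w^q = z^p - z + a\<close>. Modulo \<open>q\<close>, the factor over an orbit of \<open>z\<close> of size \<open>d\<close> depends only on \<open>d\<close>:
  if \<open>q\<close> divides \<open>p^d - 1\<close>, the fibre consists of \<open>q\<close> orbits of size \<open>d\<close> or of one of size \<open>q d\<close>, and
  \<open>(1 - T^d)^q\<close> is congruent to \<open>1 - T^(q d)\<close>; otherwise it is one orbit of size \<open>d\<close> and
  \<open>(q - 1) gcd(d, k) / k\<close> orbits of size \<open>lcm(d, k)\<close>. The only exception is the orbit of the \<open>p\<close> roots of
  \<open>z^p - z + a\<close>. Hence the product is congruent to
  \<open>(1 - T^lcm(p, k))^((q - 1) gcd(p, k) / k) / ((1 - p T) (1 - T^k)^((q - 1) / k))\<close>,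
  whose coefficients are eventually all zero modulo \<open>q\<close> if \<open>p\<close> divides \<open>k\<close>, and eventually all
  nonzero otherwise.
\<close>

section \<open>Integer power series modulo a prime\<close>

text \<open>The count rests on a degree function on the affine coordinate ring, the pole order at
  infinity, which is additive and takes every value from \<open>p * q\<close> on. Vanishing along an
  effective divisor \<open>D\<close> cuts the number of functions of bounded pole order by exactly
  \<open>p ^ deg D\<close> once the bound is large; the product formula and the size of a divisor
  class are both quotients of such cardinalities. Additivity of the pole order also yields the
  irreducibility of the curve. Divisors are handled through their affine part: the place at infinity
  has degree 1, so degree zero forces its coefficient. This is why only effective divisors away from
  infinity are counted. Euler products stay finite: the coefficient of \<open>T^n\<close> is read
  from the orbits over line orbits of size at most \<open>n\<close>, and identities between products
  are claimed only up to that coefficient. They are proved by comparing logarithmic derivatives,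
  whose coefficients count points over the field with \<open>p^n\<close> elements.\<close>

definition geo :: "int \<Rightarrow> nat \<Rightarrow> int fps" where
  "geo c e = Abs_fps (\<lambda>n. if e dvd n then c ^ (n div e) else 0)"

lemma geo_nth: "fps_nth (geo c e) n = (if e dvd n then c ^ (n div e) else 0)"
  by (simp add: geo_def)

text \<open>So \<open>geo c e\<close> is \<open>1 / (1 - c T^e)\<close>, given by its coefficients
  because integer power series form no field.\<close>

lemma geo_inverse:
  assumes "e > 0"
  shows "(1 - fps_const c * fps_X ^ e) * geo c e = 1"
proof (rule fps_ext)
  fix n
  have "e dvd n - e \<longleftrightarrow> e dvd n" if "n \<ge> e" for n
    using that by (metis dvd_diff_nat dvd_diffD dvd_refl)
  moreover have "c * c ^ ((n - e) div e) = c ^ (n div e)" if "n \<ge> e" "e dvd n"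
    using that assms by (metis le_div_geq power_Suc)
  moreover have "n = 0" if "n < e" "e dvd n" using that by (meson dvd_imp_le not_le gr0I)
  ultimately show "fps_nth ((1 - fps_const c * fps_X ^ e) * geo c e) n = fps_nth 1 n"
    using assms by (auto simp: left_diff_distrib geo_nth fps_X_power_mult_nth mult.assoc)
qed

lemma geo_nth_0: "fps_nth (geo c e) 0 = 1"
  by (simp add: geo_nth)

lemma geo_minus_1:
  assumes "e > 0"
  shows "fps_const c * fps_X ^ e * geo c e = geo c e - 1"
  using geo_inverse[OF assms, of c] by (simp add: algebra_simps)

section \<open>Logarithmic derivatives \<open>T F' / F\<close>, in a form free of division\<close>

definition has_logderiv :: "int fps \<Rightarrow> int fps \<Rightarrow> bool" where
  "has_logderiv F S \<longleftrightarrow> fps_X * fps_deriv F = F * S"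

text \<open>Differentiate \<open>(1 - c T^e) * geo c e = 1\<close> and multiply by
  \<open>T * geo c e\<close>: the first factor cancels against \<open>geo c e\<close>, and on the
  other side \<open>c T^e * geo c e\<close> is \<open>geo c e - 1\<close>.\<close>

lemma has_logderiv_geo:
  assumes "e > 0"
  shows "has_logderiv (geo c e) (of_nat e * (geo c e - 1))"
proof -
  let ?P = "1 - fps_const c * fps_X ^ e :: int fps"
  have "fps_deriv (?P * geo c e) = 0" by (simp add: geo_inverse[OF assms])
  hence "?P * fps_deriv (geo c e) = fps_const c * (of_nat e * fps_X ^ (e - 1)) * geo c e"
    by (simp add: fps_deriv_power algebra_simps fps_of_nat)
  hence "fps_X * geo c e * (?P * fps_deriv (geo c e))
      = fps_X * geo c e * (fps_const c * (of_nat e * fps_X ^ (e - 1)) * geo c e)"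
    by (rule arg_cong)
  hence "fps_X * (geo c e * ?P) * fps_deriv (geo c e)
      = of_nat e * (fps_const c * (fps_X * fps_X ^ (e - 1)) * geo c e) * geo c e"
    by (simp only: mult_ac)
  also have "fps_X * fps_X ^ (e - 1) = (fps_X ^ e :: int fps)"
    using assms by (cases e) auto
  also have "geo c e * ?P = 1" using geo_inverse[OF assms, of c] by (simp only: mult.commute)
  finally show ?thesis
    unfolding has_logderiv_def geo_minus_1[OF assms, of c] by (simp only: mult_ac mult_1_left mult_1_right)
qed

lemma has_logderiv_1: "has_logderiv 1 0"
  by (simp add: has_logderiv_def)

lemma has_logderiv_mult:
  "has_logderiv F S \<Longrightarrow> has_logderiv G T \<Longrightarrow> has_logderiv (F * G) (S + T)"
  by (simp add: has_logderiv_def algebra_simps)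

lemma has_logderiv_power: "has_logderiv F S \<Longrightarrow> has_logderiv (F ^ n) (of_nat n * S)"
proof (induction n)
  case (Suc n)
  thus ?case using has_logderiv_mult[of F S "F ^ n" "of_nat n * S"] by (simp add: algebra_simps)
qed (simp add: has_logderiv_1)

lemma has_logderiv_prod:
  assumes "\<And>i. i \<in> I \<Longrightarrow> has_logderiv (F i) (S i)"
  shows "has_logderiv (\<Prod>i\<in>I. F i) (\<Sum>i\<in>I. S i)"
  using assms by (induction I rule: infinite_finite_induct) (auto intro: has_logderiv_1 has_logderiv_mult)

text \<open>Comparing coefficients of \<open>T F' = F S\<close> gives \<open>n f_n\<close> as a
  combination of earlier coefficients, because \<open>S\<close> has no constant term. The factor
  \<open>n\<close> cancels over the integers, and only the coefficients of \<open>S\<close> up to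
  \<open>n\<close> enter, so agreement up to \<open>N\<close> is enough.\<close>

lemma logderiv_determines:
  assumes F: "has_logderiv F S" and G: "has_logderiv G T" and "fps_nth F 0 = fps_nth G 0"
    and ST: "\<And>n. n \<le> N \<Longrightarrow> fps_nth S n = fps_nth T n" and S0: "fps_nth S 0 = 0"
    and "n \<le> N"
  shows "fps_nth F n = fps_nth G n"
  using \<open>n \<le> N\<close>
proof (induction n rule: less_induct)
  case (less n)
  have rec: "int n * fps_nth F' n = (\<Sum>i<n. fps_nth F' i * fps_nth S' (n - i))"
    if "has_logderiv F' S'" "fps_nth S' 0 = 0" for F' S'
  proof -
    have "fps_nth (fps_X * fps_deriv F') n = int n * fps_nth F' n"
      by (cases n) (auto simp del: fps_deriv_nth simp: fps_deriv_def algebra_simps)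
    moreover have "fps_nth (F' * S') n = (\<Sum>i\<le>n. fps_nth F' i * fps_nth S' (n - i))"
      by (simp add: fps_mult_nth atLeast0AtMost)
    moreover have "\<dots> = (\<Sum>i<n. fps_nth F' i * fps_nth S' (n - i))"
      by (simp add: that(2) lessThan_Suc_atMost[symmetric])
    ultimately show ?thesis using that(1) unfolding has_logderiv_def by metis
  qed
  have T0: "fps_nth T 0 = 0" using ST[of 0] S0 by simp
  show ?case
  proof (cases "n = 0")
    case False
    have "int n * fps_nth F n = int n * fps_nth G n"
      unfolding rec[OF F S0] rec[OF G T0] using less ST by (intro sum.cong) auto
    thus ?thesis using False by simp
  qed (use assms in auto)
qed

section \<open>Congruence of integer power series modulo a prime\<close>

definition fps_cong :: "nat \<Rightarrow> int fps \<Rightarrow> int fps \<Rightarrow> bool" where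
  "fps_cong q F G \<longleftrightarrow> (\<exists>D. F - G = of_nat q * D)"

lemma fps_cong_refl: "fps_cong q F F"
  by (auto simp: fps_cong_def intro: exI[of _ 0])

lemma fps_cong_sym: "fps_cong q F G \<Longrightarrow> fps_cong q G F"
  unfolding fps_cong_def by (metis minus_diff_eq mult_minus_right)

lemma fps_cong_mult:
  assumes "fps_cong q F G" "fps_cong q F' G'" shows "fps_cong q (F * F') (G * G')"
proof -
  obtain D D' where "F = G + of_nat q * D" "F' = G' + of_nat q * D'"
    using assms by (auto simp: fps_cong_def algebra_simps)
  hence "F * F' - G * G' = of_nat q * (D * F' + G * D')" by (simp add: algebra_simps)
  thus ?thesis by (auto simp: fps_cong_def)
qed

lemma fps_cong_prod:
  "(\<And>i. i \<in> I \<Longrightarrow> fps_cong q (F i) (G i)) \<Longrightarrow> fps_cong q (\<Prod>i\<in>I. F i) (\<Prod>i\<in>I. G i)"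
  by (induction I rule: infinite_finite_induct) (auto intro: fps_cong_refl fps_cong_mult)

lemma fps_cong_power: "fps_cong q F G \<Longrightarrow> fps_cong q (F ^ n) (G ^ n)"
  by (induction n) (auto intro: fps_cong_refl fps_cong_mult)

lemma fps_cong_nthD: "fps_cong q F G \<Longrightarrow> int q dvd fps_nth F n - fps_nth G n"
  unfolding fps_cong_def
  by (metis dvd_triv_left fps_mult_left_const_nth fps_of_nat fps_sub_nth of_nat_def)

lemma fps_cong_nthI:
  assumes "\<And>n. int q dvd fps_nth F n - fps_nth G n" shows "fps_cong q F G"
proof -
  obtain f where "fps_nth F n - fps_nth G n = int q * f n" for n
    using assms unfolding dvd_def by metis
  hence "F - G = of_nat q * Abs_fps f"
    by (intro fps_ext) (simp add: fps_of_nat[symmetric])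
  thus ?thesis by (auto simp: fps_cong_def)
qed

text \<open>Expanding \<open>1 = ((1 - T^d) + T^d)^q\<close> avoids the sign of \<open>(- T^d)^q\<close>, which depends on the parity of \<open>q\<close>.\<close>

lemma fps_cong_frobenius:
  assumes "prime q"
  shows "fps_cong q ((1 - fps_X ^ d) ^ q) (1 - fps_X ^ (q * d))"
proof -
  have q: "q > 0" using assms prime_gt_0_nat by blast
  define u :: "int fps" where "u = 1 - fps_X ^ d"
  define v :: "int fps" where "v = fps_X ^ d"
  define f where "f i = of_nat (q choose i) * u ^ i * v ^ (q - i)" for i
  have "1 = (u + v) ^ q" by (simp add: u_def v_def)
  also have "\<dots> = (\<Sum>i\<le>q. f i)" by (simp add: binomial_ring f_def)
  also have "{..q} = insert 0 (insert q {1..<q})" using q by auto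
  also have "(\<Sum>i\<in>\<dots>. f i) = f 0 + (f q + (\<Sum>i\<in>{1..<q}. f i))" using q by (subst sum.insert; simp)+
  finally have 1: "1 = v ^ q + u ^ q + (\<Sum>i\<in>{1..<q}. f i)" by (simp add: f_def add.assoc)
  have "f i = of_nat q * (of_nat ((q choose i) div q) * u ^ i * v ^ (q - i))" if "i \<in> {1..<q}" for i
  proof -
    have "q dvd (q choose i)" using that assms by (intro dvd_choose_prime) auto
    hence "of_nat (q choose i) = (of_nat q * of_nat ((q choose i) div q) :: int fps)"
      by (metis dvd_mult_div_cancel of_nat_mult)
    thus ?thesis by (simp add: f_def mult.assoc)
  qed
  hence "(\<Sum>i\<in>{1..<q}. f i) = of_nat q * (\<Sum>i\<in>{1..<q}. of_nat ((q choose i) div q) * u ^ i * v ^ (q - i))"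
    by (simp add: sum_distrib_left)
  moreover have "v ^ q = fps_X ^ (q * d)" by (simp add: v_def power_mult mult.commute flip: power_mult)
  ultimately have "u ^ q - (1 - fps_X ^ (q * d)) = of_nat q * (- (\<Sum>i\<in>{1..<q}. of_nat ((q choose i) div q) * u ^ i * v ^ (q - i)))"
    using 1 by (simp add: algebra_simps)
  thus ?thesis unfolding fps_cong_def u_def by blast
qed

text \<open>The congruence for \<open>1 - T^d\<close> is multiplied by the inverses of both of its
  sides.\<close>

lemma geo_frobenius:
  assumes "prime q" "d > 0"
  shows "fps_cong q (geo 1 d ^ q) (geo 1 (q * d))"
proof -
  have q: "q * d > 0" using assms prime_gt_0_nat by simp
  have a: "(1 - fps_X ^ d) * geo 1 d = 1" and b: "(1 - fps_X ^ (q * d)) * geo 1 (q * d) = 1"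
    using geo_inverse[of d 1] geo_inverse[OF q, of 1] assms by simp_all
  have "fps_cong q (geo 1 d ^ q * geo 1 (q * d) * (1 - fps_X ^ (q * d))) (geo 1 d ^ q * geo 1 (q * d) * (1 - fps_X ^ d) ^ q)"
    by (intro fps_cong_mult fps_cong_refl fps_cong_sym[OF fps_cong_frobenius] assms)
  moreover have "geo 1 d ^ q * geo 1 (q * d) * (1 - fps_X ^ (q * d)) = geo 1 d ^ q"
    using b by (metis mult.commute mult.assoc mult.right_neutral)
  moreover have "geo 1 d ^ q * geo 1 (q * d) * (1 - fps_X ^ d) ^ q
      = ((1 - fps_X ^ d) * geo 1 d) ^ q * geo 1 (q * d)"
    by (simp only: power_mult_distrib mult_ac)
  ultimately show ?thesis using a by simp
qed

section \<open>Multisets of given total weight and their generating function\<close>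

definition weighted :: "'i set \<Rightarrow> ('i \<Rightarrow> nat) \<Rightarrow> nat \<Rightarrow> ('i \<Rightarrow> nat) set" where
  "weighted I e n = {D. (\<forall>i. i \<notin> I \<longrightarrow> D i = 0) \<and> (\<Sum>i\<in>I. D i * e i) = n}"

lemma weighted_insert:
  assumes "finite I" "j \<notin> I" "e j > 0"
  shows "weighted (insert j I) e n
    = (\<Union>m\<in>{m. m \<le> n \<and> e j dvd m}. (\<lambda>D. D(j := m div e j)) ` weighted I e (n - m))" (is "?L = ?R")
proof (intro equalityI subsetI)
  fix D assume D: "D \<in> ?L"
  let ?m = "D j * e j"
  have s: "?m + (\<Sum>i\<in>I. D i * e i) = n" using D assms by (auto simp: weighted_def)
  have "(\<Sum>i\<in>I. (D(j := 0)) i * e i) = (\<Sum>i\<in>I. D i * e i)"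
    using assms by (intro sum.cong) auto
  hence "D(j := 0) \<in> weighted I e (n - ?m)" using D s by (auto simp: weighted_def)
  moreover have "D = (D(j := 0))(j := ?m div e j)" using assms by (auto simp: fun_eq_iff)
  ultimately have "D \<in> (\<lambda>D. D(j := ?m div e j)) ` weighted I e (n - ?m)" by (intro image_eqI)
  moreover have "?m \<in> {m. m \<le> n \<and> e j dvd m}" using s by simp
  ultimately show "D \<in> ?R" by blast
next
  fix D assume "D \<in> ?R"
  then obtain m D' where *: "m \<le> n" "e j dvd m" "D' \<in> weighted I e (n - m)" "D = D'(j := m div e j)" by auto
  have "(\<Sum>i\<in>I. D i * e i) = (\<Sum>i\<in>I. D' i * e i)" using assms * by (intro sum.cong) auto
  thus "D \<in> ?L" using assms * by (auto simp: weighted_def)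
qed

text \<open>With closed points as indices and degrees as weights, this is the expansion of an Euler
  product into a sum over effective divisors. A new index splits the count by the weight
  \<open>m\<close> that it contributes, which is the Cauchy product.\<close>

lemma weighted_finite_card:
  assumes "finite I" "\<And>i. i \<in> I \<Longrightarrow> e i > 0"
  shows "finite (weighted I e n) \<and> int (card (weighted I e n)) = fps_nth (\<Prod>i\<in>I. geo 1 (e i)) n"
  using assms
proof (induction I arbitrary: n rule: finite_induct)
  case empty
  have "weighted {} e n = (if n = 0 then {\<lambda>_. 0} else {})" by (auto simp: weighted_def)
  thus ?case by simp
next
  case (insert j I)
  let ?S = "{m. m \<le> n \<and> e j dvd m}" and ?A = "\<lambda>m. (\<lambda>D. D(j := m div e j)) ` weighted I e (n - m)"
  have fin: "finite ?S" by simp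
  have inj: "inj_on (\<lambda>D. D(j := c)) (weighted I e m)" for c m
  proof (rule inj_onI)
    fix D D' assume *: "D \<in> weighted I e m" "D' \<in> weighted I e m" "D(j := c) = D'(j := c)"
    show "D = D'"
    proof
      fix i show "D i = D' i" using * insert.hyps(2) by (cases "i = j") (auto simp: weighted_def fun_eq_iff split: if_splits)
    qed
  qed
  have disj: "?A m \<inter> ?A m' = {}" if "m \<in> ?S" "m' \<in> ?S" "m \<noteq> m'" for m m'
  proof -
    have "m div e j \<noteq> m' div e j" using that by (auto simp: dvd_div_eq_iff)
    thus ?thesis by (auto simp: fun_eq_iff) (metis fun_upd_same)
  qed
  have w: "weighted (insert j I) e n = (\<Union>m\<in>?S. ?A m)"
    using insert by (intro weighted_insert) auto
  have IH: "finite (weighted I e m)" "int (card (weighted I e m)) = fps_nth (\<Prod>i\<in>I. geo 1 (e i)) m" for m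
    using insert by auto
  have "card (\<Union>m\<in>?S. ?A m) = (\<Sum>m\<in>?S. card (?A m))"
    using IH disj fin by (intro card_UN_disjoint) auto
  also have "\<dots> = (\<Sum>m\<in>?S. card (weighted I e (n - m)))"
    by (intro sum.cong card_image inj refl)
  finally have "int (card (weighted (insert j I) e n)) = (\<Sum>m\<in>?S. fps_nth (\<Prod>i\<in>I. geo 1 (e i)) (n - m))"
    unfolding w by (simp add: IH)
  \<comment> \<open>The weights that are not multiples of \<open>e j\<close> may be added, since the
    coefficients of \<open>geo 1 (e j)\<close> vanish there.\<close>
  also have "\<dots> = (\<Sum>m=0..n. fps_nth (geo 1 (e j)) m * fps_nth (\<Prod>i\<in>I. geo 1 (e i)) (n - m))"
    by (intro sum.mono_neutral_cong_left) (auto simp: geo_nth)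
  also have "\<dots> = fps_nth (\<Prod>i\<in>insert j I. geo 1 (e i)) n"
    using insert by (simp add: fps_mult_nth)
  finally show ?case using w IH fin by auto
qed

text \<open>The first factors give the zeta function of the affine line over the prime field. The
  second ones come from the line over the extension of degree \<open>k\<close>, where a closed point
  of degree \<open>d\<close> splits into \<open>gcd d k\<close> points whose degree over the prime
  field is \<open>lcm d k\<close>. At \<open>T^n\<close> both logarithmic derivatives equal
  \<open>p^n\<close>, plus \<open>r * p^n\<close> if \<open>k\<close> divides \<open>n\<close>; on
  the left this is the hypothesis \<open>count\<close>.\<close>

lemma euler_product_nth:
  fixes sz :: "'o \<Rightarrow> nat"
  assumes "finite L" "\<And>o'. o' \<in> L \<Longrightarrow> sz o' > 0" "k > 0" "k dvd r"
    and count: "\<And>n. 0 < n \<Longrightarrow> n \<le> N \<Longrightarrow> (\<Sum>o'\<in>{o'\<in>L. sz o' dvd n}. sz o') = p ^ n"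
    and "n \<le> N"
  shows "fps_nth (\<Prod>o'\<in>L. geo 1 (sz o') * geo 1 (lcm (sz o') k) ^ (r * gcd (sz o') k div k)) n
       = fps_nth (geo (int p) 1 * geo (int p ^ k) k ^ (r div k)) n" (is "fps_nth ?F n = fps_nth ?G n")
proof -
  define S where "S = (\<Sum>o'\<in>L. of_nat (sz o') * (geo 1 (sz o') - 1)
    + of_nat (r * gcd (sz o') k div k) * (of_nat (lcm (sz o') k) * (geo 1 (lcm (sz o') k) - 1)))"
  define T where "T = of_nat 1 * (geo (int p) 1 - 1) + of_nat (r div k) * (of_nat k * (geo (int p ^ k) k - 1))"
  have F: "has_logderiv ?F S" unfolding S_def using assms
    by (intro has_logderiv_prod has_logderiv_mult has_logderiv_power has_logderiv_geo) (auto simp: lcm_pos_nat)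
  have G: "has_logderiv ?G T" unfolding T_def using assms
    by (intro has_logderiv_mult has_logderiv_power has_logderiv_geo) auto
  have c: "fps_nth (of_nat m * (H :: int fps)) n = int m * fps_nth H n" for m H n
    by (simp add: fps_of_nat[symmetric])
  have S: "fps_nth S n = (\<Sum>o'\<in>L. (if sz o' dvd n then int (sz o') * (1 + (if k dvd n then int r else 0)) else 0))"
    if "n > 0" for n
  proof -
    \<comment> \<open>The exponent is chosen such that exponent times \<open>lcm\<close> is
      \<open>r\<close> times the size. Since \<open>lcm (sz o') k\<close> divides \<open>n\<close>
      only if both arguments do, the condition \<open>k dvd n\<close> separates from the sum over
      orbits.\<close>
    have "int (r * gcd (sz o') k div k) * int (lcm (sz o') k) = int (r * sz o')" if "o' \<in> L" for o'
    proof -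
      have "k dvd r * gcd (sz o') k" using assms by simp
      hence "r * gcd (sz o') k div k * lcm (sz o') k * k = r * gcd (sz o') k * lcm (sz o') k"
        by (metis dvd_div_mult_self mult.assoc mult.commute)
      also have "\<dots> = r * (sz o' * k)" using prod_gcd_lcm_nat[of "sz o'" k] by (simp add: mult.assoc)
      finally have "r * gcd (sz o') k div k * lcm (sz o') k = r * sz o'" using assms(3) by simp
      thus ?thesis by (metis of_nat_mult)
    qed
    hence e: "int (r * gcd (sz o') k div k) * (int (lcm (sz o') k) * x) = int (r * sz o') * x" if "o' \<in> L" for o' x
      using that by (metis mult.assoc)
    show ?thesis unfolding S_def fps_sum_nth using that
      by (intro sum.cong refl, simp only: c e fps_add_nth) (auto simp: c geo_nth algebra_simps lcm_least_iff)
  qed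
  have S': "fps_nth S n = int (p ^ n) * (1 + (if k dvd n then int r else 0))" if "0 < n" "n \<le> N" for n
  proof -
    have "fps_nth S n = (\<Sum>o'\<in>{o'\<in>L. sz o' dvd n}. int (sz o') * (1 + (if k dvd n then int r else 0)))"
      using S[OF that(1)] assms(1) by (simp add: sum.If_cases Int_def)
    also have "\<dots> = int (\<Sum>o'\<in>{o'\<in>L. sz o' dvd n}. sz o') * (1 + (if k dvd n then int r else 0))"
      by (simp add: sum_distrib_right)
    finally show ?thesis using count[OF that] by simp
  qed
  have S0: "fps_nth S 0 = 0" by (simp add: S_def fps_sum_nth c geo_nth)
  have T: "fps_nth T n = (if n = 0 then 0 else int (p ^ n) * (1 + (if k dvd n then int r else 0)))" for n
  proof -
    have e: "int (r div k) * (int k * x) = int r * x" for x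
      unfolding mult.assoc[symmetric] of_nat_mult[symmetric] using assms(4) by simp
    show ?thesis unfolding T_def using assms(3)
      by (simp only: c e fps_add_nth) (auto simp: geo_nth algebra_simps simp flip: power_mult)
  qed
  have F0: "fps_nth ?F 0 = 1"
    by (induction L rule: infinite_finite_induct) (simp_all add: fps_nth_power_0 geo_nth_0)
  have G0: "fps_nth ?G 0 = 1" by (simp add: fps_nth_power_0 geo_nth_0)
  show ?thesis
  proof (rule logderiv_determines[OF F G _ _ S0 \<open>n \<le> N\<close>])
    show "fps_nth S m = fps_nth T m" if "m \<le> N" for m using S' S0 T that by (cases "m = 0") auto
  qed (simp only: F0 G0)
qed

section \<open>Coefficients that are eventually \<open>C * p^n\<close> modulo
  \<open>q\<close>\<close>

definition eventually_geometric :: "nat \<Rightarrow> nat \<Rightarrow> int \<Rightarrow> int fps \<Rightarrow> bool" where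
  "eventually_geometric q p C F \<longleftrightarrow> (\<exists>n0. \<forall>n\<ge>n0. int q dvd fps_nth F n - C * int p ^ n)"

text \<open>The shift replaces \<open>p^n\<close> by \<open>p^(n - k i)\<close>, which is the same
  residue because \<open>p^k\<close> is 1 modulo \<open>q\<close>. Hence multiplication by a
  polynomial in \<open>T^k\<close> multiplies \<open>C\<close> by the value of that polynomial at
  1.\<close>

lemma eventually_geometric_shift:
  assumes "eventually_geometric q p C F" "[p ^ k = 1] (mod q)"
  shows "eventually_geometric q p C (fps_X ^ (k * i) * F)"
proof -
  obtain n0 where n0: "\<And>n. n \<ge> n0 \<Longrightarrow> int q dvd fps_nth F n - C * int p ^ n"
    using assms by (auto simp: eventually_geometric_def)
  have "int q dvd fps_nth (fps_X ^ (k * i) * F) n - C * int p ^ n" if n: "n \<ge> n0 + k * i" for n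
  proof -
    have "[(int p ^ k) ^ i = 1 ^ i] (mod int q)"
      using assms(2) by (intro cong_pow) (metis cong_int_iff of_nat_1 of_nat_power)
    hence "[int p ^ (n - k * i) * int p ^ (k * i) = int p ^ (n - k * i) * 1] (mod int q)"
      by (intro cong_mult cong_refl) (simp add: power_mult)
    hence "[C * int p ^ n = C * int p ^ (n - k * i)] (mod int q)"
      using n by (intro cong_mult cong_refl) (simp flip: power_add)
    hence "int q dvd C * int p ^ (n - k * i) - C * int p ^ n" by (metis cong_iff_dvd_diff cong_sym)
    moreover have "int q dvd fps_nth F (n - k * i) - C * int p ^ (n - k * i)" using n0 n by simp
    ultimately have "int q dvd (fps_nth F (n - k * i) - C * int p ^ (n - k * i)) + (C * int p ^ (n - k * i) - C * int p ^ n)"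
      by (rule dvd_add[rotated])
    thus ?thesis using n by (simp add: fps_X_power_mult_nth)
  qed
  thus ?thesis by (auto simp: eventually_geometric_def)
qed

lemma eventually_geometric_add:
  assumes "eventually_geometric q p C F" "eventually_geometric q p D G"
  shows "eventually_geometric q p (C + D) (F + G)"
proof -
  obtain n0 n1 where "\<And>n. n \<ge> n0 \<Longrightarrow> int q dvd fps_nth F n - C * int p ^ n"
    "\<And>n. n \<ge> n1 \<Longrightarrow> int q dvd fps_nth G n - D * int p ^ n"
    using assms by (auto simp: eventually_geometric_def)
  hence "int q dvd (fps_nth F n - C * int p ^ n) + (fps_nth G n - D * int p ^ n)" if "n \<ge> max n0 n1" for n
    using that by (intro dvd_add) auto
  hence "\<forall>n\<ge>max n0 n1. int q dvd fps_nth (F + G) n - (C + D) * int p ^ n" by (simp add: algebra_simps)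
  thus ?thesis unfolding eventually_geometric_def by blast
qed

lemma eventually_geometric_uminus:
  "eventually_geometric q p C F \<Longrightarrow> eventually_geometric q p (- C) (- F)"
  unfolding eventually_geometric_def by (metis (no_types, lifting) dvd_minus_iff fps_neg_nth minus_diff_eq minus_diff_minus mult_minus_left)

lemma eventually_geometric_sum:
  "finite I \<Longrightarrow> (\<And>i. i \<in> I \<Longrightarrow> eventually_geometric q p C (F i)) \<Longrightarrow>
   eventually_geometric q p (of_nat (card I) * C) (\<Sum>i\<in>I. F i)"
proof (induction I rule: finite_induct)
  case (insert i I)
  thus ?case using eventually_geometric_add[of q p C "F i" "of_nat (card I) * C" "sum F I"]
    by (simp add: algebra_simps)
qed (auto simp: eventually_geometric_def)

text \<open>If \<open>p\<close> divides \<open>k\<close>, the numerator is a power of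
  \<open>1 - T^k\<close> with larger exponent than the denominator; a remaining factor
  \<open>1 - T^k\<close> vanishes at \<open>T^k = 1\<close> and kills \<open>C\<close>. Otherwise
  numerator over denominator is a power of \<open>1 + T^k + ... + T^(k (p - 1))\<close>, whose value
  at \<open>T^k = 1\<close> is a power of \<open>p\<close>, prime to \<open>q\<close>.\<close>

lemma zeta_coefficients:
  assumes "prime p" "prime q" "p \<noteq> q"
  defines "k \<equiv> ord q p"
  defines "Z \<equiv> geo (int p) 1 * geo 1 k ^ ((q - 1) div k) * (1 - fps_X ^ lcm p k) ^ ((q - 1) * gcd p k div k)"
  shows "\<exists>n0. \<forall>n\<ge>n0. int q dvd fps_nth Z n \<longleftrightarrow> p dvd k"
proof -
  have cop: "coprime q p" using assms by (metis primes_coprime)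
  have k0: "k > 0" using cop by (simp add: k_def ord_eq_0 coprime_commute)
  have pk: "[p ^ k = 1] (mod q)" unfolding k_def by (rule ord)
  have kq: "k dvd q - 1" unfolding k_def using order_divides_totient[OF cop] totient_prime[OF assms(2)] by simp
  have q1: "q - 1 > 0" using assms prime_gt_1_nat by simp
  have g: "geo 1 k * (1 - fps_X ^ k) = 1" using geo_inverse[OF k0, of 1] by (simp add: mult.commute)
  define m where "m = (q - 1) div k"
  have m: "m > 0" unfolding m_def using kq k0 q1 by (simp add: div_greater_zero_iff dvd_imp_le)
  have base: "eventually_geometric q p 1 (geo (int p) 1)"
    by (auto simp: eventually_geometric_def geo_nth)
  show ?thesis
  proof (cases "p dvd k")
    case True
    have "lcm p k = k" "gcd p k = p" using True by (auto simp: lcm_proj2_if_dvd_nat gcd_proj1_if_dvd_nat)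
    moreover have "(q - 1) * p div k = m * p" unfolding m_def using kq by (metis div_mult_swap mult.commute)
    \<comment> \<open>Of the \<open>m * p\<close> factors in the numerator, \<open>m\<close> cancel
      the denominator; the other \<open>m * (p - 1)\<close> remain, and there is at least one
      because \<open>p > 1\<close>.\<close>
    moreover have "m * p = m + m * (p - 1)" using prime_gt_0_nat[OF assms(1)] by (cases p) auto
    ultimately have "Z = geo (int p) 1 * (geo 1 k ^ m * (1 - fps_X ^ k) ^ m) * (1 - fps_X ^ k) ^ (m * (p - 1))"
      unfolding Z_def m_def[symmetric] by (simp only: power_add mult_ac)
    hence Z: "Z = geo (int p) 1 * (1 - fps_X ^ k) ^ (m * (p - 1))"
      using g by (simp flip: power_mult_distrib)
    have "m * (p - 1) > 0" using m prime_gt_1_nat[OF assms(1)] by simp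
    have step: "eventually_geometric q p 0 (F * (1 - fps_X ^ k))" if "eventually_geometric q p C F" for C F
      using eventually_geometric_add[OF that eventually_geometric_uminus[OF eventually_geometric_shift[OF that pk, of 1]]]
      by (simp add: algebra_simps)
    have "eventually_geometric q p 0 (geo (int p) 1 * (1 - fps_X ^ k) ^ Suc n)" for n
    proof (induction n)
      case 0 thus ?case using step[OF base] by simp
    next
      case (Suc n) thus ?case using step[OF Suc] by (simp add: mult_ac)
    qed
    from this[of "m * (p - 1) - 1"] have "eventually_geometric q p 0 Z"
      using \<open>m * (p - 1) > 0\<close> by (simp only: Z Suc_diff_1)
    thus ?thesis using True by (auto simp: eventually_geometric_def)
  next
    case False
    have cpk: "coprime p k" using False assms(1) by (simp add: prime_imp_coprime)
    hence lg: "lcm p k = k * p" "gcd p k = 1" by (auto simp: lcm_coprime mult.commute)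
    define w :: "int fps" where "w = (\<Sum>i<p. fps_X ^ (k * i))"
    have gw: "geo 1 k * (1 - fps_X ^ (k * p)) = w"
    proof -
      have "1 - (fps_X ^ k) ^ p = (1 - fps_X ^ k :: int fps) * (\<Sum>i<p. (fps_X ^ k) ^ i)"
        by (rule one_diff_power_eq)
      hence "1 - fps_X ^ (k * p) = (1 - fps_X ^ k) * w" by (simp add: w_def power_mult)
      thus ?thesis using g by (metis mult.assoc mult_1)
    qed
    have Z: "Z = geo (int p) 1 * w ^ m"
      unfolding Z_def lg mult_1_right m_def[symmetric] gw[symmetric] power_mult_distrib by (simp only: mult_ac)
    have "eventually_geometric q p (int p ^ n) (geo (int p) 1 * w ^ n)" for n
    proof (induction n)
      case 0 thus ?case using base by simp
    next
      case (Suc n)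
      have "eventually_geometric q p (of_nat (card {..<p}) * int p ^ n) (\<Sum>i<p. fps_X ^ (k * i) * (geo (int p) 1 * w ^ n))"
        by (intro eventually_geometric_sum eventually_geometric_shift[OF Suc pk]) simp
      moreover have "(\<Sum>i<p. fps_X ^ (k * i) * (geo (int p) 1 * w ^ n)) = w * (geo (int p) 1 * w ^ n)"
        by (simp add: w_def sum_distrib_right)
      ultimately show ?case by (simp add: mult_ac)
    qed
    then obtain n0 where n0: "\<And>n. n \<ge> n0 \<Longrightarrow> int q dvd fps_nth Z n - int p ^ m * int p ^ n"
      by (auto simp: Z eventually_geometric_def)
    have "\<not> int q dvd int p ^ m * int p ^ n" for n
    proof
      assume "int q dvd int p ^ m * int p ^ n"
      hence "int q dvd int (p ^ (m + n))" by (simp add: power_add)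
      hence "q dvd p ^ (m + n)" by (simp only: int_dvd_int_iff)
      hence "q dvd p" using assms prime_dvd_power by blast
      thus False using assms by (metis primes_dvd_imp_eq)
    qed
    hence "\<not> int q dvd fps_nth Z n" if "n \<ge> n0" for n
      using n0[OF that] dvd_diff[of "int q" "fps_nth Z n" "fps_nth Z n - int p ^ m * int p ^ n"] by auto
    thus ?thesis using False by auto
  qed
qed

section \<open>Periodic maps and the closure of a prime field\<close>

text \<open>Instances are the Frobenius map on the algebraic closure and its action on pairs of
  coordinates; the orbits are the closed points, and their sizes the degrees.\<close>

locale periodic_map =
  fixes f :: "'x \<Rightarrow> 'x"
  assumes periodic: "\<exists>n>0. (f ^^ n) x = x"
begin

definition per :: "'x \<Rightarrow> nat" where "per x = (LEAST n. n > 0 \<and> (f ^^ n) x = x)"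

definition orb :: "'x \<Rightarrow> 'x set" where "orb x = range (\<lambda>n. (f ^^ n) x)"

lemma per_pos: "per x > 0" and funpow_per: "(f ^^ per x) x = x"
proof -
  have "per x > 0 \<and> (f ^^ per x) x = x"
    unfolding per_def by (rule LeastI_ex) (use periodic in blast)
  thus "per x > 0" "(f ^^ per x) x = x" by auto
qed

lemma funpow_per_mult: "(f ^^ (per x * m)) x = x"
  by (induction m) (auto simp: funpow_add funpow_per)

lemma funpow_mod_per: "(f ^^ n) x = (f ^^ (n mod per x)) x"
proof -
  have "n = n mod per x + per x * (n div per x)" by simp
  hence "(f ^^ n) x = (f ^^ (n mod per x)) ((f ^^ (per x * (n div per x))) x)"
    by (metis comp_apply funpow_add)
  thus ?thesis by (simp add: funpow_per_mult)
qed

lemma funpow_eq_iff: "(f ^^ n) x = x \<longleftrightarrow> per x dvd n"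
proof
  assume *: "(f ^^ n) x = x"
  show "per x dvd n"
  proof (rule ccontr)
    assume "\<not> per x dvd n"
    hence "n mod per x > 0" by (simp add: dvd_eq_mod_eq_0)
    moreover have "(f ^^ (n mod per x)) x = x" using * funpow_mod_per by metis
    ultimately have "per x \<le> n mod per x" unfolding per_def[of x] by (intro Least_le) auto
    thus False using per_pos[of x] by (meson leD mod_less_divisor)
  qed
qed (auto simp: funpow_per_mult)

lemma orb_self: "x \<in> orb x"
  unfolding orb_def using rangeI[of "\<lambda>n. (f ^^ n) x" 0] by simp

lemma orb_eqI:
  assumes "y \<in> orb x" shows "orb y = orb x"
proof -
  obtain n where y: "y = (f ^^ n) x" using assms by (auto simp: orb_def)
  \<comment> \<open>Going back from \<open>y\<close> to \<open>x\<close> takes negative steps;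
    adding the multiple \<open>per x * n\<close> of the period makes the exponent a natural
    number.\<close>
  have "(f ^^ m) x = (f ^^ (m + per x * n - n)) y" for m
  proof -
    have "n \<le> m + per x * n" using per_pos[of x] by (simp add: trans_le_add2)
    hence "(f ^^ (m + per x * n - n)) y = (f ^^ (m + per x * n)) x"
      unfolding y by (metis comp_apply funpow_add le_add_diff_inverse2)
    thus ?thesis by (simp add: funpow_add funpow_per_mult)
  qed
  hence "(f ^^ m) x \<in> orb y" for m unfolding orb_def by (metis rangeI)
  moreover have "(f ^^ m) y = (f ^^ (m + n)) x" for m unfolding y by (simp add: funpow_add)
  hence "(f ^^ m) y \<in> orb x" for m unfolding orb_def by (metis rangeI)
  ultimately show ?thesis by (auto simp: orb_def[of x] orb_def[of y])
qed

lemma orb_disjoint: "orb x \<noteq> orb y \<Longrightarrow> orb x \<inter> orb y = {}"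
  using orb_eqI by blast

lemma orb_image: "orb x = (\<lambda>i. (f ^^ i) x) ` {..<per x}"
proof -
  have "(f ^^ n) x \<in> (\<lambda>i. (f ^^ i) x) ` {..<per x}" for n
    using funpow_mod_per[of n x] per_pos[of x] by auto
  thus ?thesis by (auto simp: orb_def)
qed

lemma finite_orb: "finite (orb x)"
  by (simp add: orb_image)

text \<open>Iterating up to the common period \<open>m * n\<close> recovers both arguments, and at
  least one step has been made, after which the two iterations coincide.\<close>

lemma inj_f: "inj f"
proof (rule injI)
  fix x y assume "f x = f y"
  obtain m n where mn: "m > 0" "(f ^^ m) x = x" "n > 0" "(f ^^ n) y = y" using periodic by meson
  have i: "(f ^^ (a * b)) z = z" if "(f ^^ a) z = z" for a b z using that by (induction b) (auto simp: funpow_add)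
  have "(f ^^ (m * n)) x = (f ^^ (m * n)) y"
  proof -
    obtain r where "m * n = Suc r" using mn by (metis gr0_implies_Suc nat_0_less_mult_iff)
    thus ?thesis using \<open>f x = f y\<close> by (simp add: funpow_swap1)
  qed
  thus "x = y" using i mn by (metis mult.commute)
qed

lemma card_orb: "card (orb x) = per x"
proof -
  have "inj_on (\<lambda>i. (f ^^ i) x) {..<per x}"
  proof (rule linorder_inj_onI)
    fix i j assume ij: "i < j" "j \<in> {..<per x}"
    show "(f ^^ i) x \<noteq> (f ^^ j) x"
    proof
      assume "(f ^^ i) x = (f ^^ j) x"
      hence "(f ^^ i) ((f ^^ (j - i)) x) = (f ^^ i) x"
        using ij by (metis comp_apply funpow_add le_add_diff_inverse less_imp_le)
      hence "(f ^^ (j - i)) x = x" using inj_fn[OF inj_f] by (meson injD)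
      hence "per x dvd j - i" by (simp add: funpow_eq_iff)
      thus False using ij by (auto dest: dvd_imp_le)
    qed
  qed auto
  thus ?thesis by (simp add: orb_image card_image)
qed

lemma per_orb: "y \<in> orb x \<Longrightarrow> per y = per x"
  using orb_eqI card_orb by metis

lemma orb_subset:
  assumes "f ` S \<subseteq> S" "x \<in> S" shows "orb x \<subseteq> S"
proof -
  have "(f ^^ n) x \<in> S" for n using assms by (induction n) auto
  thus ?thesis by (auto simp: orb_def)
qed

lemma card_eq_sum_orb:
  assumes "finite S" "f ` S \<subseteq> S"
  shows "card S = (\<Sum>O'\<in>orb ` S. card O')"
proof -
  have "S = \<Union> (orb ` S)" using orb_subset[OF assms(2)] orb_self by blast
  moreover have "card (\<Union> (orb ` S)) = (\<Sum>O'\<in>orb ` S. card O')"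
    by (rule card_Union_disjoint) (auto simp: pairwise_def disjnt_def orb_disjoint finite_orb)
  ultimately show ?thesis by simp
qed

lemma card_orbits_const_per:
  assumes "finite S" "f ` S \<subseteq> S" "\<And>x. x \<in> S \<Longrightarrow> per x = s"
  shows "card (orb ` S) * s = card S"
proof -
  have "(\<Sum>O'\<in>orb ` S. card O') = (\<Sum>O'\<in>orb ` S. s)"
    using assms by (intro sum.cong) (auto simp: card_orb)
  thus ?thesis using card_eq_sum_orb[OF assms(1,2)] by simp
qed

end

section \<open>Separable polynomials and Frobenius on the closure of the prime field\<close>

lemma card_roots_separable:
  fixes P :: "'a :: alg_closed_field poly"
  assumes "P \<noteq> 0" "\<And>x. poly P x = 0 \<Longrightarrow> poly (pderiv P) x \<noteq> 0"
  shows "card {x. poly P x = 0} = Polynomial.degree P"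
  using assms
proof (induction "Polynomial.degree P" arbitrary: P rule: less_induct)
  case (less P)
  show ?case
  proof (cases "Polynomial.degree P = 0")
    case True
    then obtain c where "P = [:c:]" by (elim degree_eq_zeroE)
    thus ?thesis using less.prems by simp
  next
    case False
    then obtain x where x: "poly P x = 0" using alg_closed_imp_poly_has_root by blast
    then obtain Q where P: "P = [:-x, 1:] * Q" using poly_eq_0_iff_dvd by (metis dvdE)
    have Q0: "Q \<noteq> 0" using less.prems P by auto
    have deg: "Polynomial.degree P = Suc (Polynomial.degree Q)" unfolding P using Q0 by (subst degree_mult_eq) auto
    have pd: "poly (pderiv P) z = poly Q z + (z - x) * poly (pderiv Q) z" for z
      unfolding P pderiv_mult by (simp add: pderiv_pCons algebra_simps)
    have Qx: "poly Q x \<noteq> 0" using less.prems(2)[OF x] pd[of x] by simp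
    have "card {x. poly Q x = 0} = Polynomial.degree Q"
    proof (rule less.hyps)
      show "poly (pderiv Q) z \<noteq> 0" if "poly Q z = 0" for z
        using less.prems(2)[of z] pd[of z] that P by auto
    qed (use deg Q0 in auto)
    moreover have "{z. poly P z = 0} = insert x {z. poly Q z = 0}" unfolding P by auto
    moreover have "finite {z. poly Q z = 0}" using Q0 by (rule poly_roots_finite)
    ultimately show ?thesis using Qx deg by simp
  qed
qed

text \<open>The argument \<open>tk\<close> only carries the type of the field.\<close>

locale prime_order_field =
  fixes p :: nat and tk :: "'k :: {field, finite} itself"
  assumes prime_p: "prime p" and card_k: "CARD('k) = p"
begin

lemma p_gt_1: "p > 1" and p_pos: "p > 0"
  using prime_p prime_gt_1_nat prime_gt_0_nat by auto

lemma char_k: "CHAR('k) = p"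
proof -
  have "CHAR('k) dvd p" using CHAR_dvd_CARD[where ?'a = 'k] card_k by simp
  moreover have "CHAR('k) \<noteq> 1" by simp
  ultimately show ?thesis using prime_p by (metis prime_nat_iff)
qed

lemma char_ac: "CHAR('k alg_closure) = p"
  using char_k by simp

lemma of_nat_ac_eq_0_iff: "(of_nat n :: 'k alg_closure) = 0 \<longleftrightarrow> p dvd n"
  using of_nat_eq_0_iff_char_dvd[where ?'a = "'k alg_closure"] char_ac by simp

text \<open>By cardinality the field consists of the images of \<open>0, ..., p - 1\<close>, and for
  these the claim follows by induction from the additivity of the \<open>p\<close>-th power.\<close>

lemma k_power_p: "(c :: 'k) ^ p = c"
proof -
  have "inj_on (of_nat :: nat \<Rightarrow> 'k) {..<p}"
    by (auto simp: inj_on_def of_nat_eq_iff_cong_CHAR char_k cong_def)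
  hence "card ((of_nat :: nat \<Rightarrow> 'k) ` {..<p}) = CARD('k)" by (simp add: card_image card_k)
  hence "(of_nat :: nat \<Rightarrow> 'k) ` {..<p} = UNIV" by (intro card_subset_eq) auto
  then obtain i where c: "c = of_nat i" by blast
  have "(of_nat i :: 'k) ^ p = of_nat i" for i
  proof (induction i)
    case (Suc i)
    have "(1 + of_nat i :: 'k) ^ p = 1 ^ p + of_nat i ^ p"
      using prime_p by (intro freshmans_dream) (auto simp: char_k)
    thus ?case using Suc by simp
  qed (use p_pos in auto)
  thus ?thesis using c by simp
qed

lemma k_power: "(c :: 'k) ^ (p ^ n) = c"
  by (induction n) (auto simp: power_mult k_power_p)

lemma power_add_char: "CHAR('b::comm_ring_1) = p \<Longrightarrow> (u + v :: 'b) ^ (p ^ n) = u ^ (p ^ n) + v ^ (p ^ n)"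
  using prime_p by (intro freshmans_dream') auto

lemma power_diff_char: "CHAR('b::comm_ring_1) = p \<Longrightarrow> (u - v :: 'b) ^ (p ^ n) = u ^ (p ^ n) - v ^ (p ^ n)"
  using power_add_char[of "u - v" v n] by (simp add: algebra_simps)

definition fr :: "'k alg_closure \<Rightarrow> 'k alg_closure" where "fr z = z ^ p"

lemma funpow_fr: "(fr ^^ n) z = z ^ (p ^ n)"
  by (induction n) (auto simp: fr_def mult.commute simp flip: power_mult)

lemma inj_fr: "inj fr"
proof (rule injI)
  fix u v assume "fr u = fr v"
  hence "(u - v) ^ p ^ 1 = 0" using power_diff_char[OF char_ac, of u v 1] by (simp add: fr_def)
  thus "u = v" by simp
qed

lemma map_to_ac_mult: "map_poly to_ac (P * Q) = map_poly to_ac P * map_poly to_ac Q"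
  by (intro poly_eqI) (simp add: coeff_map_poly coeff_mult to_ac_sum)

lemma map_to_ac_add: "map_poly to_ac (P + Q) = map_poly to_ac P + map_poly to_ac Q"
  by (intro poly_eqI) (simp add: coeff_map_poly)

lemma finite_polys_degree_less: "finite {P :: 'b::{finite,zero} poly. \<forall>i\<ge>n. poly.coeff P i = 0}"
proof -
  have "finite (Poly ` {xs :: 'b list. length xs = n})"
    using finite_lists_length_eq[of "UNIV :: 'b set" n] by simp
  moreover have "P \<in> Poly ` {xs. length xs = n}" if "\<forall>i\<ge>n. poly.coeff P i = 0" for P :: "'b poly"
  proof
    show "P = Poly (map (poly.coeff P) [0..<n])"
      using that by (intro poly_eqI) (auto simp: nth_default_def)
  qed auto
  ultimately show ?thesis by (auto intro: finite_subset)
qed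

text \<open>Modulo a polynomial \<open>g\<close> that annihilates \<open>z\<close>, all powers of
  \<open>z\<close> reduce to the finite set \<open>V\<close> of values of remainders. So two
  iterates coincide, and injectivity of \<open>fr\<close> lets the common part be cancelled.\<close>

lemma fr_periodic: "\<exists>n>0. (fr ^^ n) z = z"
proof -
  obtain g :: "'k poly" where g: "g \<noteq> 0" "poly (map_poly to_ac g) z = 0" by (rule alg_closure_algebraic)
  define V where "V = (\<lambda>c. poly (map_poly to_ac c) z) ` {c :: 'k poly. \<forall>i\<ge>Polynomial.degree g. poly.coeff c i = 0}"
  have "finite V" unfolding V_def by (intro finite_imageI finite_polys_degree_less)
  have pow: "z ^ n \<in> V" for n
  proof -
    let ?r = "Polynomial.monom 1 n mod g"
    have "Polynomial.monom 1 n = Polynomial.monom 1 n div g * g + ?r" by simp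
    hence "poly (map_poly to_ac (Polynomial.monom 1 n)) z = poly (map_poly to_ac ?r) z"
      using g by (metis add_0 map_to_ac_add map_to_ac_mult mult_zero_right poly_add poly_mult)
    moreover have "map_poly to_ac (Polynomial.monom (1::'k) n) = Polynomial.monom 1 n" by (simp add: map_poly_monom)
    ultimately have "z ^ n = poly (map_poly to_ac ?r) z" by (simp add: poly_monom)
    moreover have "poly.coeff ?r i = 0" if "i \<ge> Polynomial.degree g" for i
      using g degree_mod_less[of g "Polynomial.monom 1 n"] that by (auto intro: coeff_eq_0)
    ultimately show ?thesis unfolding V_def by blast
  qed
  have "\<not> inj (\<lambda>n. (fr ^^ n) z)"
  proof
    assume "inj (\<lambda>n. (fr ^^ n) z)"
    moreover have "range (\<lambda>n. (fr ^^ n) z) \<subseteq> V" using pow by (auto simp: funpow_fr)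
    ultimately show False using \<open>finite V\<close> by (meson finite_subset infinite_UNIV_nat finite_imageD)
  qed
  then obtain i j where ij: "i < j" "(fr ^^ i) z = (fr ^^ j) z"
    by (metis (no_types, lifting) injI linorder_neqE_nat)
  hence "(fr ^^ i) ((fr ^^ (j - i)) z) = (fr ^^ i) z"
    by (metis comp_apply funpow_add le_add_diff_inverse less_imp_le)
  hence "(fr ^^ (j - i)) z = z" using inj_fn[OF inj_fr] by (meson injD)
  thus ?thesis using ij by (intro exI[of _ "j - i"]) auto
qed

text \<open>The derivative of \<open>T^(p^n) - T\<close> is \<open>-1\<close> in characteristic
  \<open>p\<close>, so all roots are simple.\<close>

lemma card_frobenius_fixed:
  assumes "n > 0"
  shows "card {z :: 'k alg_closure. z ^ p ^ n = z} = p ^ n"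
proof -
  define P :: "'k alg_closure poly" where "P = Polynomial.monom 1 (p ^ n) - [:0, 1:]"
  have n1: "p ^ n > 1" using p_gt_1 assms by (intro one_less_power)
  have deg: "Polynomial.degree P = p ^ n"
    unfolding P_def using n1 by (subst diff_conv_add_uminus, subst degree_add_eq_left) (auto simp: degree_monom_eq)
  have "pderiv P = Polynomial.monom (of_nat (p ^ n)) (p ^ n - 1) - 1"
    unfolding P_def by (simp add: pderiv_diff pderiv_monom pderiv_pCons one_pCons)
  moreover have "of_nat (p ^ n) = (0 :: 'k alg_closure)" using assms by (simp only: of_nat_ac_eq_0_iff) simp
  ultimately have "pderiv P = -1" by (simp only: monom_eq_0 diff_0)
  hence "card {x. poly P x = 0} = p ^ n" unfolding deg[symmetric] using deg n1
    by (intro card_roots_separable) auto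
  moreover have "poly P x = x ^ p ^ n - x" for x by (simp add: P_def poly_monom)
  ultimately show ?thesis by simp
qed

lemma finite_frobenius_fixed: "n > 0 \<Longrightarrow> finite {z :: 'k alg_closure. z ^ p ^ n = z}"
  using card_frobenius_fixed[of n] p_pos by (intro card_ge_0_finite) simp

lemma card_power_eq:
  assumes "c \<noteq> (0 :: 'k alg_closure)" "\<not> p dvd m"
  shows "card {z. z ^ m = c} = m"
proof -
  have m: "m > 0" using assms by (cases m) auto
  define P :: "'k alg_closure poly" where "P = Polynomial.monom 1 m - [:c:]"
  have deg: "Polynomial.degree P = m"
    unfolding P_def using m by (subst diff_conv_add_uminus, subst degree_add_eq_left) (auto simp: degree_monom_eq)
  have "pderiv P = Polynomial.monom (of_nat m) (m - 1)"
    unfolding P_def by (simp add: pderiv_diff pderiv_monom pderiv_pCons)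
  hence pd: "poly (pderiv P) x = of_nat m * x ^ (m - 1)" for x by (simp add: poly_monom)
  have P: "poly P x = x ^ m - c" for x by (simp add: P_def poly_monom)
  have "card {x. poly P x = 0} = m" unfolding deg[symmetric]
  proof (rule card_roots_separable)
    show "P \<noteq> 0" using deg m by auto
    show "poly (pderiv P) x \<noteq> 0" if "poly P x = 0" for x
      using that assms m unfolding pd P by (auto simp: of_nat_ac_eq_0_iff power_0_left)
  qed
  thus ?thesis by (simp add: P)
qed

lemma range_to_ac: "range (to_ac :: 'k \<Rightarrow> _) = {z. z ^ p = z}"
proof (rule card_subset_eq)
  show "finite {z :: 'k alg_closure. z ^ p = z}" using finite_frobenius_fixed[of 1] by simp
  show "range (to_ac :: 'k \<Rightarrow> _) \<subseteq> {z. z ^ p = z}" by (auto simp: k_power_p simp flip: to_ac_power)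
  show "card (range (to_ac :: 'k \<Rightarrow> _)) = card {z :: 'k alg_closure. z ^ p = z}"
    using card_frobenius_fixed[of 1] by (simp add: card_image inj_to_ac card_k)
qed

lemma descend_frobenius_invariant:
  assumes "\<And>i. poly.coeff P i ^ p = poly.coeff P i"
  obtains Q :: "'k poly" where "P = map_poly to_ac Q"
proof
  show "P = map_poly to_ac (map_poly of_ac P)"
    by (intro poly_eqI) (use assms range_to_ac in \<open>simp add: coeff_map_poly to_ac_of_ac\<close>)
qed

end

section \<open>The Euler product over Frobenius orbits\<close>

lemma power_mod_exponent: "(u :: 'b :: monoid_mult) ^ n = 1 \<Longrightarrow> u ^ i = u ^ (i mod n)"
  by (metis mod_mult_div_eq mult.right_neutral power_add power_mult power_one)

locale artin_schreier = prime_order_field p tk for p and tk :: "'k :: {field, finite} itself" +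
  fixes q :: nat and a :: 'k
  assumes prime_q: "prime q" and p_neq_q: "p \<noteq> q" and a_nonzero: "a \<noteq> 0"
begin

definition k :: nat where "k = ord q p"

lemma q_pos: "q > 0" and q_gt_1: "q > 1"
  using prime_q prime_gt_0_nat prime_gt_1_nat by auto

lemma coprime_qp: "coprime q p"
  using prime_q prime_p p_neq_q primes_coprime by blast

lemma p_not_dvd_q: "\<not> p dvd q"
  using prime_q prime_p p_neq_q primes_dvd_imp_eq by blast

lemma k_pos: "k > 0"
  using coprime_qp by (simp add: k_def ord_eq_0)

lemma k_dvd: "k dvd q - 1"
  unfolding k_def using order_divides_totient[OF coprime_qp] totient_prime[OF prime_q] by simp

lemma q_dvd_iff: "q dvd p ^ n - 1 \<longleftrightarrow> k dvd n"
proof -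
  have "q dvd p ^ n - 1 \<longleftrightarrow> [p ^ n = 1] (mod q)"
    using p_pos by (metis cong_altdef_nat cong_sym_eq one_le_power Suc_leI One_nat_def)
  thus ?thesis using ord_divides' by (simp add: k_def ord_divides)
qed

definition fa :: "'k alg_closure \<Rightarrow> 'k alg_closure" where "fa z = z ^ p - z + to_ac a"

definition pts :: "('k alg_closure \<times> 'k alg_closure) set" where "pts = {(z, w). w ^ q = fa z}"

definition frp :: "'k alg_closure \<times> 'k alg_closure \<Rightarrow> 'k alg_closure \<times> 'k alg_closure" where
  "frp = map_prod fr fr"

lemma funpow_frp: "(frp ^^ n) (z, w) = (z ^ p ^ n, w ^ p ^ n)"
proof -
  have "(frp ^^ n) (z, w) = ((fr ^^ n) z, (fr ^^ n) w)" by (induction n) (auto simp: frp_def)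
  thus ?thesis by (simp add: funpow_fr)
qed

sublocale line: periodic_map fr
  by unfold_locales (rule fr_periodic)

sublocale curve: periodic_map frp
proof
  fix P :: "'k alg_closure \<times> 'k alg_closure"
  obtain z w where P: "P = (z, w)" by (cases P)
  let ?n = "line.per z * line.per w"
  have "(fr ^^ ?n) z = z" "(fr ^^ ?n) w = w" by (simp_all add: line.funpow_eq_iff)
  hence "(frp ^^ ?n) P = P" by (simp add: P funpow_fr funpow_frp)
  thus "\<exists>n>0. (frp ^^ n) P = P" using line.per_pos by (intro exI[of _ ?n]) auto
qed

lemma line_per_dvd: "line.per z dvd n \<longleftrightarrow> z ^ p ^ n = z"
  by (simp flip: line.funpow_eq_iff add: funpow_fr)

lemma curve_per_dvd: "curve.per (z, w) dvd n \<longleftrightarrow> z ^ p ^ n = z \<and> w ^ p ^ n = w"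
  by (simp flip: curve.funpow_eq_iff add: funpow_frp)

lemma fa_power: "fa (z ^ p ^ n) = fa z ^ p ^ n"
proof -
  have "fa z ^ p ^ n = (z ^ p) ^ p ^ n - z ^ p ^ n + to_ac a ^ p ^ n"
    unfolding fa_def by (simp add: power_add_char[OF char_ac] power_diff_char[OF char_ac])
  also have "to_ac a ^ p ^ n = to_ac a" by (simp add: k_power flip: to_ac_power)
  also have "(z ^ p) ^ p ^ n = (z ^ p ^ n) ^ p" by (simp add: mult.commute flip: power_mult)
  finally show ?thesis by (simp add: fa_def)
qed

lemma frp_pts: "frp ` pts \<subseteq> pts"
proof (clarsimp simp: frp_def pts_def)
  fix z w assume "w ^ q = fa z"
  have "fr w ^ q = (w ^ q) ^ p ^ 1" by (simp add: fr_def mult.commute flip: power_mult)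
  also have "\<dots> = fa (fr z)" unfolding \<open>w ^ q = fa z\<close> fa_power[symmetric] by (simp add: fr_def)
  finally show "fr w ^ q = fa (fr z)" .
qed

section \<open>Fibres of the curve over the Frobenius orbits of the line\<close>

definition fibre :: "'k alg_closure set \<Rightarrow> ('k alg_closure \<times> 'k alg_closure) set" where
  "fibre L = {P \<in> pts. fst P \<in> L}"

lemma frp_fibre: "frp ` fibre (line.orb z) \<subseteq> fibre (line.orb z)"
proof -
  have "fr u \<in> line.orb z" if "u \<in> line.orb z" for u
  proof -
    obtain n where "u = (fr ^^ n) z" using \<open>u \<in> line.orb z\<close> by (auto simp: line.orb_def)
    hence "fr u = (fr ^^ Suc n) z" by simp
    thus ?thesis unfolding line.orb_def by (rule range_eqI)
  qed
  thus ?thesis using frp_pts by (auto simp: fibre_def frp_def)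
qed

lemma card_qth_roots: "fa z \<noteq> 0 \<Longrightarrow> card {w. w ^ q = fa z} = q"
  using card_power_eq p_not_dvd_q by blast

lemma finite_qth_roots: "finite {w. w ^ q = fa z}"
proof (cases "fa z = 0")
  case True
  hence "{w. w ^ q = fa z} = {0}" using q_pos by auto
  thus ?thesis by simp
next
  case False
  thus ?thesis using card_qth_roots q_pos by (metis card_gt_0_iff)
qed

lemma fibre_eq: "fibre L = (SIGMA z:L. {w. w ^ q = fa z})"
  by (auto simp: fibre_def pts_def)

lemma finite_fibre: "finite L \<Longrightarrow> finite (fibre L)"
  unfolding fibre_eq using finite_qth_roots by blast

lemma fa_orb: "u \<in> line.orb z \<Longrightarrow> \<exists>n. fa u = fa z ^ p ^ n"
  by (auto simp: line.orb_def funpow_fr fa_power)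

lemma fa_orb_nonzero: "u \<in> line.orb z \<Longrightarrow> fa z \<noteq> 0 \<Longrightarrow> fa u \<noteq> 0"
  using fa_orb by fastforce

lemma card_fibre: "fa z \<noteq> 0 \<Longrightarrow> card (fibre (line.orb z)) = line.per z * q"
  unfolding fibre_eq using finite_qth_roots line.finite_orb fa_orb_nonzero card_qth_roots
  by (subst card_SigmaI) (auto simp: line.card_orb)

lemma prod_geo_const_per:
  assumes "finite S" "frp ` S \<subseteq> S" "\<And>P. P \<in> S \<Longrightarrow> curve.per P = s" "card S = s * m" "s > 0"
  shows "(\<Prod>O'\<in>curve.orb ` S. geo 1 (card O')) = geo 1 s ^ m"
proof -
  have "card (curve.orb ` S) * s = m * s" using curve.card_orbits_const_per[OF assms(1-3)] assms(4) by (metis mult.commute)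
  hence "card (curve.orb ` S) = m" using assms(5) by simp
  moreover have "(\<Prod>O'\<in>curve.orb ` S. geo 1 (card O')) = (\<Prod>O'\<in>curve.orb ` S. geo 1 s)"
    using assms(3) by (intro prod.cong) (auto simp: curve.card_orb)
  ultimately show ?thesis by simp
qed

lemma power_eq_one_prime:
  assumes "(u :: 'k alg_closure) ^ q = 1" "u \<noteq> 1"
  shows "u ^ n = 1 \<longleftrightarrow> q dvd n"
proof
  assume n: "u ^ n = 1"
  show "q dvd n"
  proof (rule ccontr)
    assume "\<not> q dvd n"
    hence "coprime n q" using prime_q by (metis coprime_commute prime_imp_coprime)
    then obtain x where x: "[n * x = 1] (mod q)" by (metis cong_solve_coprime_nat One_nat_def)
    have m: "u ^ i = u ^ (i mod q)" for i
      by (rule power_mod_exponent[OF assms(1)])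
    have "u = u ^ (1 mod q)" using q_gt_1 by simp
    also have "\<dots> = u ^ (n * x)" using x m[of "n * x"] by (simp add: cong_def)
    also have "\<dots> = 1" using n by (simp add: power_mult)
    finally show False using assms(2) by simp
  qed
next
  assume "q dvd n"
  thus "u ^ n = 1" using assms(1) by (auto simp: power_mult)
qed

text \<open>For \<open>k dvd d\<close> this collapses to \<open>geo 1 d ^ q\<close>, so one
  expression serves every orbit and the product over all orbits has the shape of
  \<open>euler_product_nth\<close> with \<open>r = q - 1\<close>.\<close>

definition local_factor :: "nat \<Rightarrow> int fps" where
  "local_factor d = geo 1 d * geo 1 (lcm d k) ^ ((q - 1) * gcd d k div k)"

lemma power_p_minus_1: "(u :: 'k alg_closure) ^ p ^ n = u ^ (p ^ n - 1) * u"
proof -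
  have "p ^ n = Suc (p ^ n - 1)" using p_pos by simp
  thus ?thesis by (metis power_Suc2)
qed

text \<open>Write \<open>p^d - 1 = q m\<close>. For a point \<open>(u, w)\<close> of the fibre,
  \<open>w^(p^d)\<close> is \<open>w\<close> times \<open>fa u ^ m\<close>, a \<open>q\<close>-th
  root of unity fixed by the \<open>d\<close>-th Frobenius power, so \<open>n\<close> rounds
  multiply \<open>w\<close> by its \<open>n\<close>-th power. Whether it is 1 does not vary along
  the orbit of \<open>z\<close>, since its values are conjugate. Hence all periods are
  \<open>d\<close>, or all are \<open>q d\<close>.\<close>

lemma euler_factor_dvd:
  assumes "fa z \<noteq> 0" "k dvd line.per z"
  shows "fps_cong q (\<Prod>O'\<in>curve.orb ` fibre (line.orb z). geo 1 (card O')) (local_factor (line.per z))"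
proof -
  define d where "d = line.per z"
  define m where "m = (p ^ d - 1) div q"
  have d: "d > 0" unfolding d_def by (rule line.per_pos)
  have "q dvd p ^ d - 1" using assms(2) q_dvd_iff d_def by simp
  hence m: "p ^ d - 1 = q * m" unfolding m_def by simp
  have lf: "local_factor d = geo 1 d ^ q"
  proof -
    have "lcm d k = d" "gcd d k = k" using assms(2) by (auto simp: d_def lcm_proj1_if_dvd_nat gcd_proj2_if_dvd_nat)
    thus ?thesis using k_pos q_pos by (simp add: local_factor_def flip: power_Suc)
  qed
  have fin: "finite (fibre (line.orb z))" by (intro finite_fibre line.finite_orb)
  have main: "w ^ p ^ (d * n) = (fa u ^ m) ^ n * w \<and> (fa u ^ m) ^ q = 1 \<and> (fa u ^ m = 1 \<longleftrightarrow> fa z ^ m = 1) \<and> w \<noteq> 0 \<and> line.per u = d"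
    if P: "(u, w) \<in> fibre (line.orb z)" for u w n
  proof -
    have u: "u \<in> line.orb z" and w: "w ^ q = fa u" using P by (auto simp: fibre_def pts_def)
    have per: "line.per u = d" using line.per_orb[OF u] by (simp add: d_def)
    have w0: "w \<noteq> 0" using fa_orb_nonzero[OF u assms(1)] w q_pos by (metis power_0_left less_irrefl)
    have fixed: "fa u ^ p ^ d = fa u" using line_per_dvd[of u d] per by (simp flip: fa_power)
    hence "fa u ^ (p ^ d - 1) = 1" using power_p_minus_1[of "fa u" d] fa_orb_nonzero[OF u assms(1)] by simp
    hence om: "(fa u ^ m) ^ q = 1" unfolding m by (metis power_mult mult.commute)
    have ompow: "(fa u ^ m) ^ p ^ d = fa u ^ m" using fixed by (metis power_mult mult.commute)
    have wd: "w ^ p ^ d = fa u ^ m * w" using power_p_minus_1[of w d] unfolding m power_mult w .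
    have "w ^ p ^ (d * n) = (fa u ^ m) ^ n * w"
    proof (induction n)
      case (Suc n)
      have "w ^ p ^ (d * Suc n) = (w ^ p ^ (d * n)) ^ p ^ d"
        by (simp add: power_add mult.commute flip: power_mult)
      also have "\<dots> = ((fa u ^ m) ^ p ^ d) ^ n * w ^ p ^ d"
        unfolding Suc by (simp add: power_mult_distrib mult_ac flip: power_mult)
      finally show ?case by (simp only: ompow wd power_Suc2 mult.assoc)
    qed simp
    moreover obtain n where "fa u = fa z ^ p ^ n" using fa_orb[OF u] by blast
    hence "fa u ^ m = (fa z ^ m) ^ p ^ n" by (metis power_mult mult.commute)
    hence "fa u ^ m = 1 \<longleftrightarrow> fa z ^ m = 1"
      using inj_fn[OF inj_fr, of n] by (metis (no_types, lifting) funpow_fr injD power_one)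
    ultimately show ?thesis using om w0 per by blast
  qed
  show ?thesis
  proof (cases "fa z ^ m = 1")
    case True
    have "curve.per P = d" if "P \<in> fibre (line.orb z)" for P
    proof (cases P)
      case (Pair u w)
      have "curve.per P dvd d" using main[of u w 1] that True line_per_dvd[of u d] by (simp add: Pair curve_per_dvd)
      moreover have "d dvd curve.per P"
        using main[of u w 1] that line_per_dvd[of u "curve.per P"] curve_per_dvd[of u w "curve.per P"] by (simp add: Pair)
      ultimately show ?thesis by (rule dvd_antisym)
    qed
    hence "(\<Prod>O'\<in>curve.orb ` fibre (line.orb z). geo 1 (card O')) = geo 1 d ^ q"
      using card_fibre[OF assms(1)] d by (intro prod_geo_const_per fin frp_fibre) (auto simp: d_def)
    thus ?thesis unfolding d_def[symmetric] lf by (simp add: fps_cong_refl)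
  next
    case False
    have "curve.per P = q * d" if P': "P \<in> fibre (line.orb z)" for P
    proof (cases P)
      case (Pair u w)
      have *: "w ^ p ^ (d * n) = w \<longleftrightarrow> q dvd n" for n
      proof -
        have "w ^ p ^ (d * n) = w \<longleftrightarrow> (fa u ^ m) ^ n = 1" using main[of u w n] that by (auto simp: Pair)
        also have "\<dots> \<longleftrightarrow> q dvd n" using main[of u w 1] that False by (intro power_eq_one_prime) (auto simp: Pair)
        finally show ?thesis .
      qed
      have pu: "line.per u = d" using main[of u w 1] P' by (simp add: Pair)
      have "curve.per P dvd d * q" using *[of q] line_per_dvd[of u "d * q"] by (simp add: Pair curve_per_dvd pu)
      moreover have "d dvd curve.per P"
        using pu line_per_dvd[of u "curve.per P"] curve_per_dvd[of u w "curve.per P"] by (simp add: Pair)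
      then obtain n where n: "curve.per P = d * n" by blast
      hence "q dvd n" using *[of n] curve_per_dvd[of u w "curve.per P"] by (simp add: Pair)
      hence "d * q dvd curve.per P" using n by simp
      ultimately show ?thesis by (metis dvd_antisym mult.commute)
    qed
    hence "(\<Prod>O'\<in>curve.orb ` fibre (line.orb z). geo 1 (card O')) = geo 1 (q * d) ^ 1"
      using card_fibre[OF assms(1)] d q_pos by (intro prod_geo_const_per fin frp_fibre) (auto simp: d_def)
    \<comment> \<open>In this case the two sides differ as series and agree only modulo
      \<open>q\<close>.\<close>
    thus ?thesis unfolding d_def[symmetric] lf
      using fps_cong_sym[OF geo_frobenius[OF prime_q d]] by simp
  qed
qed

text \<open>Raising to the \<open>q\<close>-th power is a bijection on the units of the field with
  \<open>p^d\<close> elements, so each \<open>fa u\<close> has exactly one \<open>q\<close>-th root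
  there. The other roots differ from it by a nontrivial \<open>q\<close>-th root of unity, which
  lies in the field with \<open>p^n\<close> elements exactly when \<open>k dvd n\<close>; their
  periods are therefore \<open>lcm d k\<close>.\<close>

lemma euler_factor_not_dvd:
  assumes "fa z \<noteq> 0" "\<not> k dvd line.per z"
  shows "(\<Prod>O'\<in>curve.orb ` fibre (line.orb z). geo 1 (card O')) = local_factor (line.per z)"
proof -
  define d where "d = line.per z"
  define S where "S = fibre (line.orb z)"
  have d: "d > 0" unfolding d_def by (rule line.per_pos)
  have "\<not> q dvd p ^ d - 1" using assms(2) q_dvd_iff d_def by simp
  hence "coprime q (p ^ d - 1)" using prime_q by (simp add: prime_imp_coprime)
  then obtain x where x: "[q * x = 1] (mod (p ^ d - 1))" by (metis cong_solve_coprime_nat One_nat_def)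
  \<comment> \<open>So \<open>x\<close> is the exponent that extracts the rational
    \<open>q\<close>-th root.\<close>
  have pw: "v ^ (q * x) = v" if "v ^ p ^ d = v" "v \<noteq> 0" for v :: "'k alg_closure"
  proof -
    have v1: "v ^ (p ^ d - 1) = 1" using power_p_minus_1[of v d] that by simp
    have m: "v ^ i = v ^ (i mod (p ^ d - 1))" for i
      by (rule power_mod_exponent[OF v1])
    show ?thesis using m[of "q * x"] m[of 1] x by (simp add: cong_def)
  qed
  define S1 where "S1 = {P \<in> S. snd P ^ p ^ d = snd P}"
  have fin: "finite S" unfolding S_def by (intro finite_fibre line.finite_orb)
  have mem: "line.per u = d \<and> fa u ^ p ^ d = fa u \<and> fa u \<noteq> 0 \<and> w ^ q = fa u \<and> w \<noteq> 0 \<and> u \<in> line.orb z"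
    if "(u, w) \<in> S" for u w
  proof -
    have u: "u \<in> line.orb z" and w: "w ^ q = fa u" using that by (auto simp: S_def fibre_def pts_def)
    have per: "line.per u = d" using line.per_orb[OF u] by (simp add: d_def)
    have "fa u ^ p ^ d = fa u" using line_per_dvd[of u d] per by (simp flip: fa_power)
    thus ?thesis using per w u fa_orb_nonzero[OF u assms(1)] q_pos by (metis power_0_left less_irrefl)
  qed
  have S1: "S1 = (\<lambda>u. (u, fa u ^ x)) ` line.orb z"
  proof (intro equalityI subsetI)
    fix P assume "P \<in> S1"
    moreover obtain u w where P: "P = (u, w)" by (cases P)
    ultimately have P1: "(u, w) \<in> S" "w ^ p ^ d = w" by (auto simp: S1_def)
    hence "w = fa u ^ x" using pw[of w] mem[OF P1(1)] by (simp add: power_mult)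
    thus "P \<in> (\<lambda>u. (u, fa u ^ x)) ` line.orb z" using P mem[OF P1(1)] by blast
  next
    fix P assume "P \<in> (\<lambda>u. (u, fa u ^ x)) ` line.orb z"
    then obtain u where u: "u \<in> line.orb z" "P = (u, fa u ^ x)" by blast
    have per: "line.per u = d" using line.per_orb[OF u(1)] by (simp add: d_def)
    have f: "fa u ^ p ^ d = fa u" using line_per_dvd[of u d] per by (simp flip: fa_power)
    hence "(fa u ^ x) ^ q = fa u" using pw[OF f fa_orb_nonzero[OF u(1) assms(1)]] by (metis power_mult mult.commute)
    moreover have "(fa u ^ x) ^ p ^ d = fa u ^ x" using f by (metis power_mult mult.commute)
    ultimately show "P \<in> S1" using u by (auto simp: S1_def S_def fibre_def pts_def)
  qed
  have c1: "card S1 = d" unfolding S1 by (subst card_image) (auto simp: inj_on_def line.card_orb d_def)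
  have inv: "frp ` S \<subseteq> S" unfolding S_def by (rule frp_fibre)
  have snd_frp: "snd (frp P) ^ p ^ d = snd (frp P) \<longleftrightarrow> snd P ^ p ^ d = snd P" for P
  proof -
    have "snd (frp P) ^ p ^ d = fr (snd P ^ p ^ d)" by (simp add: frp_def fr_def mult.commute flip: power_mult)
    thus ?thesis using inj_fr by (auto simp: frp_def inj_eq)
  qed
  have inv1: "frp ` S1 \<subseteq> S1" and inv2: "frp ` (S - S1) \<subseteq> S - S1"
    using inv snd_frp by (auto simp: S1_def)
  have per1: "curve.per P = d" if "P \<in> S1" for P
  proof (cases P)
    case (Pair u w)
    have S: "(u, w) \<in> S" "w ^ p ^ d = w" using that by (auto simp: S1_def Pair)
    have "curve.per P dvd d" using S mem[OF S(1)] line_per_dvd[of u d] by (simp add: Pair curve_per_dvd)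
    moreover have "d dvd curve.per P"
      using mem[OF S(1)] line_per_dvd[of u "curve.per P"] curve_per_dvd[of u w "curve.per P"] by (simp add: Pair)
    ultimately show ?thesis by (rule dvd_antisym)
  qed
  have per2: "curve.per P = lcm d k" if "P \<in> S - S1" for P
  proof (cases P)
    case (Pair u w)
    have S: "(u, w) \<in> S" "w ^ p ^ d \<noteq> w" using that by (auto simp: S1_def Pair)
    note M = mem[OF S(1)]
    \<comment> \<open>The rational root over \<open>u\<close> serves as base point; the period of
      \<open>w\<close> is then governed by the root of unity \<open>u' = w / w0\<close>.\<close>
    define w0 where "w0 = fa u ^ x"
    have w0q: "w0 ^ q = fa u" using pw[of "fa u"] M unfolding w0_def by (metis power_mult mult.commute)
    have w0d: "w0 ^ p ^ d = w0" using M unfolding w0_def by (metis power_mult mult.commute)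
    have w00: "w0 \<noteq> 0" using M by (simp add: w0_def)
    define u' where "u' = w / w0"
    have w: "w = w0 * u'" using w00 by (simp add: u'_def)
    have u'q: "u' ^ q = 1" using M w0q by (simp add: u'_def power_divide)
    have u'1: "u' \<noteq> 1" using S(2) w0d w by auto
    have u'0: "u' \<noteq> 0" using M w by auto
    have "curve.per P dvd n \<longleftrightarrow> lcm d k dvd n" for n
    proof -
      have "curve.per P dvd n \<longleftrightarrow> d dvd n \<and> w ^ p ^ n = w"
        using M line_per_dvd[of u n] by (simp add: Pair curve_per_dvd)
      also have "\<dots> \<longleftrightarrow> d dvd n \<and> u' ^ p ^ n = u'"
      proof (intro conj_cong refl)
        assume "d dvd n"
        hence "w0 ^ p ^ n = w0" using w0d by (metis dvd_trans line_per_dvd)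
        thus "w ^ p ^ n = w \<longleftrightarrow> u' ^ p ^ n = u'" using w00 by (simp add: w power_mult_distrib)
      qed
      also have "u' ^ p ^ n = u' \<longleftrightarrow> u' ^ (p ^ n - 1) = 1" using power_p_minus_1[of u' n] u'0 by auto
      also have "\<dots> \<longleftrightarrow> k dvd n" using power_eq_one_prime[OF u'q u'1] q_dvd_iff by simp
      finally show ?thesis by (simp add: lcm_least_iff)
    qed
    thus ?thesis by (metis dvd_antisym dvd_refl)
  qed
  define e where "e = (q - 1) * gcd d k div k"
  have l0: "lcm d k > 0" using d k_pos by (simp add: lcm_pos_nat)
  have "k dvd (q - 1) * gcd d k" using k_dvd by simp
  hence "e * k * lcm d k = (q - 1) * (gcd d k * lcm d k)" unfolding e_def by (simp add: mult.assoc)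
  hence "lcm d k * e * k = (q - 1) * d * k" by (simp only: prod_gcd_lcm_nat[symmetric] mult_ac)
  hence e: "lcm d k * e = (q - 1) * d" using k_pos by simp
  have c2: "card (S - S1) = lcm d k * e"
    using card_fibre[OF assms(1)] c1 fin
    unfolding e by (subst card_Diff_subset) (auto simp: S_def[symmetric] d_def[symmetric] S1_def algebra_simps)
  have p1: "(\<Prod>O'\<in>curve.orb ` S1. geo 1 (card O')) = geo 1 d ^ 1"
    using c1 d fin by (intro prod_geo_const_per inv1 per1) (auto simp: S1_def)
  have p2: "(\<Prod>O'\<in>curve.orb ` (S - S1). geo 1 (card O')) = geo 1 (lcm d k) ^ e"
    using c2 l0 fin by (intro prod_geo_const_per inv2 per2) auto
  have "d \<noteq> lcm d k" using assms(2) d_def by (metis dvd_lcm2)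
  hence "curve.orb ` S1 \<inter> curve.orb ` (S - S1) = {}"
    using per1 per2 by (auto simp flip: curve.card_orb)
      (metis DiffI curve.card_orb)
  moreover have "curve.orb ` S = curve.orb ` S1 \<union> curve.orb ` (S - S1)" by (auto simp: S1_def)
  ultimately have "(\<Prod>O'\<in>curve.orb ` S. geo 1 (card O')) = geo 1 d * geo 1 (lcm d k) ^ e"
    using p1 p2 fin by (simp add: prod.union_disjoint S1_def)
  thus ?thesis by (simp add: S_def d_def local_factor_def e_def)
qed

text \<open>On a root of \<open>z^p - z + a\<close>, Frobenius is the translation by
  \<open>- a\<close>, which has order \<open>p\<close> because \<open>a\<close> is nonzero.\<close>

lemma per_root:
  assumes "fa z = 0" shows "line.per z = p"
proof -
  have "(fr ^^ n) z = z - of_nat n * to_ac a" for n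
  proof (induction n)
    case (Suc n)
    have "(fr ^^ Suc n) z = (z - of_nat n * to_ac a) ^ p ^ 1" using Suc by (simp add: fr_def[of "z - of_nat n * to_ac a"])
    also have "\<dots> = z ^ p - of_nat n ^ p * to_ac a ^ p"
      by (simp only: power_diff_char[OF char_ac] power_mult_distrib) simp
    also have "to_ac a ^ p = to_ac a" by (simp add: k_power_p flip: to_ac_power)
    also have "of_nat n ^ p = (of_nat n :: 'k alg_closure)"
      using k_power_p[of "of_nat n"] by (metis to_ac_of_nat to_ac_power)
    also have "z ^ p = z - to_ac a" using assms by (simp add: fa_def algebra_simps)
    finally show ?case by (simp add: algebra_simps)
  qed simp
  hence "line.per z dvd n \<longleftrightarrow> p dvd n" for n
    using a_nonzero by (simp flip: line.funpow_eq_iff of_nat_ac_eq_0_iff)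
  thus ?thesis by (metis dvd_antisym dvd_refl)
qed

lemma euler_factor_root:
  assumes "fa z = 0"
  shows "(\<Prod>O'\<in>curve.orb ` fibre (line.orb z). geo 1 (card O')) = geo 1 p"
proof -
  have fz: "fa u = 0" if "u \<in> line.orb z" for u using fa_orb[OF that] assms p_pos by auto
  have S: "fibre (line.orb z) = (\<lambda>u. (u, 0)) ` line.orb z"
    unfolding fibre_eq using fz q_pos by auto
  have "card (fibre (line.orb z)) = p * 1"
    unfolding S by (subst card_image) (auto simp: inj_on_def line.card_orb per_root[OF assms])
  moreover have "curve.per P = p" if "P \<in> fibre (line.orb z)" for P
  proof -
    obtain u where u: "u \<in> line.orb z" "P = (u, 0)" using \<open>P \<in> fibre (line.orb z)\<close> S by auto
    have "curve.per P dvd n \<longleftrightarrow> line.per u dvd n" for n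
      using u p_pos by (simp add: curve_per_dvd line_per_dvd power_0_left)
    hence "curve.per P = line.per u" by (metis dvd_antisym dvd_refl)
    thus ?thesis using line.per_orb[OF u(1)] per_root[OF assms] by simp
  qed
  ultimately show ?thesis
    using p_pos prod_geo_const_per[of "fibre (line.orb z)" p 1]
    by (simp add: finite_fibre line.finite_orb frp_fibre)
qed

text \<open>The orbit of one root already has \<open>p\<close> elements, as many as the degree
  allows.\<close>

lemma roots_one_orbit:
  obtains z where "fa z = 0" "{u. fa u = 0} = line.orb z"
proof -
  define P :: "'k alg_closure poly" where "P = Polynomial.monom 1 p - [:- to_ac a, 1:]"
  have ev: "poly P x = fa x" for x by (simp add: P_def poly_monom fa_def)
  have deg: "Polynomial.degree P = p" unfolding P_def using p_gt_1
    by (subst diff_conv_add_uminus, subst degree_add_eq_left) (auto simp: degree_monom_eq)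
  hence P0: "P \<noteq> 0" using p_pos by auto
  obtain z where z: "fa z = 0" using alg_closed_imp_poly_has_root[of P] deg p_pos ev by auto
  have fin: "finite {u. fa u = 0}" using poly_roots_finite[OF P0] ev by simp
  have "card {u. fa u = 0} \<le> p" using card_poly_roots_bound[OF P0] deg ev by simp
  moreover have sub: "line.orb z \<subseteq> {u. fa u = 0}" using fa_orb z p_pos by fastforce
  moreover have "card (line.orb z) = p" using line.card_orb per_root[OF z] by simp
  ultimately have "line.orb z = {u. fa u = 0}" using fin by (intro card_seteq) auto
  thus ?thesis using that z by blast
qed

section \<open>The truncated Euler product and its reduction modulo \<open>q\<close>\<close>

definition line_orbs :: "nat \<Rightarrow> 'k alg_closure set set" where
  "line_orbs N = line.orb ` {z. line.per z \<le> N}"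

text \<open>The bound is put on the orbit below, on the line, so that whole fibres occur and the
  product factors over \<open>line_orbs\<close>. Orbits larger than \<open>N\<close> that occur on
  the curve do not affect coefficients up to \<open>N\<close>.\<close>

definition curve_orbs :: "nat \<Rightarrow> ('k alg_closure \<times> 'k alg_closure) set set" where
  "curve_orbs N = curve.orb ` {P \<in> pts. line.per (fst P) \<le> N}"

lemma finite_per_le: "finite {z. line.per z \<le> N}"
proof -
  have "{z. line.per z \<le> N} \<subseteq> (\<Union>n\<in>{1..N}. {z. z ^ p ^ n = z})"
    using line.per_pos line_per_dvd by (auto simp: Suc_le_eq simp flip: line_per_dvd) (metis dvd_refl Suc_leI atLeastAtMost_iff)
  moreover have "finite (\<Union>n\<in>{1..N}. {z :: 'k alg_closure. z ^ p ^ n = z})"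
    using finite_frobenius_fixed by auto
  ultimately show ?thesis by (rule finite_subset)
qed

text \<open>The field with \<open>p^n\<close> elements is the disjoint union of the orbits whose
  size divides \<open>n\<close>.\<close>

lemma sum_line_orbs:
  assumes "0 < n" "n \<le> N"
  shows "(\<Sum>L\<in>{L \<in> line_orbs N. card L dvd n}. card L) = p ^ n"
proof -
  have "{L \<in> line_orbs N. card L dvd n} = line.orb ` {z. z ^ p ^ n = z}"
  proof -
    have "line.per z \<le> N" if "line.per z dvd n" for z using that assms dvd_imp_le order_trans by blast
    thus ?thesis by (auto simp: line_orbs_def line.card_orb line_per_dvd)
  qed
  moreover have "fr ` {z. z ^ p ^ n = z} \<subseteq> {z. z ^ p ^ n = z}"
    by (auto simp: fr_def) (metis power_mult mult.commute)
  ultimately show ?thesis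
    using line.card_eq_sum_orb[of "{z. z ^ p ^ n = z}"] finite_frobenius_fixed[OF assms(1)] card_frobenius_fixed[OF assms(1)]
    by simp
qed

lemma prod_curve_orbs:
  "(\<Prod>O'\<in>curve_orbs N. g (card O')) = (\<Prod>L\<in>line_orbs N. \<Prod>O'\<in>curve.orb ` fibre L. g (card O'))"
proof -
  have "{P \<in> pts. line.per (fst P) \<le> N} = (\<Union>L\<in>line_orbs N. fibre L)"
    using line.orb_self line.per_orb by (fastforce simp: line_orbs_def fibre_def)
  hence c: "curve_orbs N = (\<Union>L\<in>line_orbs N. curve.orb ` fibre L)"
    by (simp add: curve_orbs_def image_UN)
  have disj: "curve.orb ` fibre L \<inter> curve.orb ` fibre L' = {}" if L: "L \<in> line_orbs N" "L' \<in> line_orbs N" "L \<noteq> L'" for L L'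
  proof -
    obtain z z' where z: "L = line.orb z" "L' = line.orb z'" using L by (auto simp: line_orbs_def)
    have "fst P \<in> L \<inter> L'" if "P \<in> fibre L" "P' \<in> fibre L'" "curve.orb P = curve.orb P'" for P P'
    proof -
      have "P \<in> curve.orb P'" using that curve.orb_self by blast
      moreover have "curve.orb P' \<subseteq> fibre L'" using curve.orb_subset[OF frp_fibre] that z by blast
      ultimately show ?thesis using that by (auto simp: fibre_def)
    qed
    thus ?thesis using line.orb_disjoint[of z z'] L z by auto
  qed
  show ?thesis unfolding c
    by (rule prod.UNION_disjoint) (use disj finite_per_le finite_fibre line.finite_orb in \<open>auto simp: line_orbs_def\<close>)
qed

text \<open>Replacing every fibre factor by its \<open>local_factor\<close> is correct modulo
  \<open>q\<close> except over the branch orbit, where the true factor is \<open>geo 1 p\<close>.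
  The series \<open>W\<close> inverts the second factor of \<open>local_factor p\<close> and repairs
  this. The corrected product is the zeta function of the line times its analogue for
  \<open>k\<close>, times \<open>W\<close>, and \<open>p^k\<close> is 1 modulo
  \<open>q\<close>.\<close>

theorem curve_orbs_zeta:
  "\<exists>n0. \<forall>n\<ge>n0. int q dvd fps_nth (\<Prod>O'\<in>curve_orbs n. geo 1 (card O')) n \<longleftrightarrow> p dvd k"
proof -
  define W :: "int fps" where "W = (1 - fps_X ^ lcm p k) ^ ((q - 1) * gcd p k div k)"
  define Z where "Z = geo (int p) 1 * geo 1 k ^ ((q - 1) div k) * W"
  define H where "H = geo (int p) 1 * geo (int p ^ k) k ^ ((q - 1) div k)"
  have "\<exists>n0. \<forall>n\<ge>n0. int q dvd fps_nth Z n \<longleftrightarrow> p dvd k"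
    unfolding Z_def W_def k_def by (rule zeta_coefficients[OF prime_p prime_q p_neq_q])
  then obtain n0 where n0: "\<And>n. n \<ge> n0 \<Longrightarrow> int q dvd fps_nth Z n \<longleftrightarrow> p dvd k" by blast
  have "fps_cong q (geo (int p ^ k) k) (geo 1 k)"
  proof (rule fps_cong_nthI)
    fix n
    have "[p ^ k = 1] (mod q)" unfolding k_def by (rule ord)
    hence "[int p ^ k = 1] (mod int q)" by (metis cong_int_iff of_nat_1 of_nat_power)
    hence "[(int p ^ k) ^ (n div k) = 1 ^ (n div k)] (mod int q)" by (rule cong_pow)
    thus "int q dvd fps_nth (geo (int p ^ k) k) n - fps_nth (geo 1 k) n" by (auto simp: geo_nth cong_iff_dvd_diff)
  qed
  hence HZ: "fps_cong q (H * W) Z"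
    unfolding H_def Z_def by (intro fps_cong_mult fps_cong_refl fps_cong_power)
  \<comment> \<open>From \<open>n = p\<close> on, the branch orbit, which has size \<open>p\<close>,
    belongs to the truncated product.\<close>
  have main: "int q dvd fps_nth (\<Prod>O'\<in>curve_orbs n. geo 1 (card O')) n - fps_nth Z n" if n: "n \<ge> p" for n
  proof -
    obtain z0 where z0: "fa z0 = 0" "{u. fa u = 0} = line.orb z0" by (rule roots_one_orbit)
    have L0: "line.orb z0 \<in> line_orbs n" using n per_root[OF z0(1)] by (auto simp: line_orbs_def)
    have fin: "finite (line_orbs n)" using finite_per_le by (simp add: line_orbs_def)
    define E where "E L = (\<Prod>O'\<in>curve.orb ` fibre L. geo 1 (card O'))" for L
    have E0: "E (line.orb z0) = local_factor (card (line.orb z0)) * W"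
    proof -
      have "lcm p k > 0" using p_pos k_pos by (simp add: lcm_pos_nat)
      hence "geo 1 (lcm p k) * (1 - fps_X ^ lcm p k) = 1"
        using geo_inverse[of "lcm p k" 1] by (simp add: mult.commute)
      hence "geo 1 (lcm p k) ^ m * (1 - fps_X ^ lcm p k) ^ m = 1" for m
        by (simp flip: power_mult_distrib)
      thus ?thesis unfolding E_def euler_factor_root[OF z0(1)] line.card_orb per_root[OF z0(1)] local_factor_def W_def
        by (simp add: mult.assoc)
    qed
    have E1: "fps_cong q (E L) (local_factor (card L))" if "L \<in> line_orbs n - {line.orb z0}" for L
    proof -
      obtain z where z: "L = line.orb z" using \<open>L \<in> line_orbs n - {line.orb z0}\<close> by (auto simp: line_orbs_def)
      have "fa z \<noteq> 0"
      proof
        assume "fa z = 0"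
        hence "z \<in> line.orb z0" using z0 by blast
        thus False using that z line.orb_eqI by blast
      qed
      thus ?thesis using euler_factor_dvd[of z] euler_factor_not_dvd[of z] fps_cong_refl[of q "local_factor (line.per z)"]
        unfolding E_def z line.card_orb by (cases "k dvd line.per z") simp_all
    qed
    have "fps_cong q (E (line.orb z0) * (\<Prod>L\<in>line_orbs n - {line.orb z0}. E L))
       (local_factor (card (line.orb z0)) * W * (\<Prod>L\<in>line_orbs n - {line.orb z0}. local_factor (card L)))"
      unfolding E0 by (intro fps_cong_mult fps_cong_prod fps_cong_refl E1)
    hence "fps_cong q (\<Prod>L\<in>line_orbs n. E L) ((\<Prod>L\<in>line_orbs n. local_factor (card L)) * W)"
      by (simp add: prod.remove[OF fin L0] mult_ac)
    hence c1: "int q dvd fps_nth (\<Prod>O'\<in>curve_orbs n. geo 1 (card O')) n - fps_nth ((\<Prod>L\<in>line_orbs n. local_factor (card L)) * W) n"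
      unfolding prod_curve_orbs E_def by (rule fps_cong_nthD)
    have "fps_nth (\<Prod>L\<in>line_orbs n. local_factor (card L)) m = fps_nth H m" if "m \<le> n" for m
      unfolding local_factor_def H_def using fin k_pos k_dvd that
      by (intro euler_product_nth[where N = n] sum_line_orbs) (auto simp: line_orbs_def line.card_orb line.per_pos)
    \<comment> \<open>The two series agree only up to \<open>T^n\<close>, which suffices for the
      \<open>n\<close>-th coefficient of their products with \<open>W\<close>.\<close>
    hence "fps_nth ((\<Prod>L\<in>line_orbs n. local_factor (card L)) * W) n = fps_nth (H * W) n"
      unfolding fps_mult_nth by (intro sum.cong) auto
    thus ?thesis using dvd_add[OF c1 fps_cong_nthD[OF HZ, of n]] by simp
  qed
  have "int q dvd fps_nth (\<Prod>O'\<in>curve_orbs n. geo 1 (card O')) n \<longleftrightarrow> p dvd k" if "n \<ge> max p n0" for n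
    using main[of n] n0[of n] that by (metis dvd_diffD dvd_diffD1 int_dvd_int_iff max.bounded_iff
        dvd_diff_commute zdvd_zdiffD)
  thus ?thesis by blast
qed

end

section \<open>Polynomials in two variables modulo the curve equation\<close>

locale ring_morphism =
  fixes h :: "'b :: comm_ring_1 \<Rightarrow> 'c :: comm_ring_1"
  assumes add: "h (u + v) = h u + h v" and mult: "h (u * v) = h u * h v" and one: "h 1 = 1"
begin

lemma zero: "h 0 = 0"
  using add[of 0 0] by simp

lemma diff: "h (u - v) = h u - h v"
  using add[of "u - v" v] by simp

lemma sum: "h (\<Sum>i\<in>I. g i) = (\<Sum>i\<in>I. h (g i))"
  by (induction I rule: infinite_finite_induct) (auto simp: zero add)

lemma power: "h (u ^ n) = h u ^ n"
  by (induction n) (auto simp: one mult)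

end

text \<open>Nested use evaluates polynomials in two variables: the inner evaluation in
  \<open>x\<close> is the coefficient map of the outer one in \<open>y\<close>.\<close>

definition eval_hom :: "('b :: comm_ring_1 \<Rightarrow> 'c :: comm_ring_1) \<Rightarrow> 'c \<Rightarrow> 'b poly \<Rightarrow> 'c" where
  "eval_hom h v P = poly (map_poly h P) v"

context ring_morphism
begin

lemma eval_hom_morphism: "ring_morphism (eval_hom h v)"
proof
  show "eval_hom h v (P + Q) = eval_hom h v P + eval_hom h v Q" for P Q
  proof -
    have "map_poly h (P + Q) = map_poly h P + map_poly h Q"
      by (intro poly_eqI) (simp add: coeff_map_poly zero add)
    thus ?thesis by (simp add: eval_hom_def)
  qed
  show "eval_hom h v (P * Q) = eval_hom h v P * eval_hom h v Q" for P Q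
  proof -
    have "map_poly h (P * Q) = map_poly h P * map_poly h Q"
      by (intro poly_eqI) (simp add: coeff_map_poly zero coeff_mult sum mult)
    thus ?thesis by (simp add: eval_hom_def)
  qed
  show "eval_hom h v 1 = 1" by (simp add: eval_hom_def one)
qed

lemma eval_hom_monom: "eval_hom h v (Polynomial.monom c n) = h c * v ^ n"
  by (simp add: eval_hom_def map_poly_monom zero poly_monom)

lemma eval_hom_pCons: "eval_hom h v (pCons c P) = h c + v * eval_hom h v P"
  by (simp add: eval_hom_def map_poly_pCons zero)

lemma eval_hom_0: "eval_hom h v 0 = 0"
  by (simp add: eval_hom_def)

lemma eval_hom_const: "eval_hom h v [:c:] = h c"
  by (simp add: eval_hom_def map_poly_pCons zero)

lemma eval_hom_altdef:
  assumes "Polynomial.degree P \<le> N"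
  shows "eval_hom h v P = (\<Sum>i\<le>N. h (poly.coeff P i) * v ^ i)"
proof -
  have "(\<Sum>i\<le>Polynomial.degree P. h (poly.coeff P i) * v ^ i) = (\<Sum>i\<le>N. h (poly.coeff P i) * v ^ i)"
    using assms by (intro sum.mono_neutral_left) (auto simp: zero coeff_eq_0)
  moreover have "Polynomial.degree (map_poly h P) \<le> Polynomial.degree P"
    by (intro degree_le) (auto simp: coeff_map_poly zero coeff_eq_0)
  hence "poly (map_poly h P) v = (\<Sum>i\<le>Polynomial.degree P. h (poly.coeff P i) * v ^ i)"
    unfolding poly_altdef coeff_map_poly[of h, OF zero]
    by (intro sum.mono_neutral_left) (auto simp: coeff_eq_0 zero dest!: not_le_imp_less simp flip: coeff_map_poly[of h, OF zero])
  ultimately show ?thesis by (simp add: eval_hom_def)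
qed

end

text \<open>The weight determines \<open>p j\<close> modulo \<open>q\<close>, hence
  \<open>j\<close>. So the monomials \<open>x^i y^j\<close> with \<open>j < q\<close> have pairwise
  distinct pole orders.\<close>

lemma weighted_pair_unique:
  fixes p q :: nat
  assumes "coprime p q" "q * i + p * j = q * i' + p * j'" "j < q" "j' < q"
  shows "i = i' \<and> j = j'"
proof -
  have "[p * j = p * j'] (mod q)" using assms(2) by (metis cong_def mod_mult_self4)
  hence "[j = j'] (mod q)" using assms(1) by (simp add: cong_mult_lcancel_nat coprime_commute)
  hence "j = j'" using assms by (simp add: cong_def)
  thus ?thesis using assms by simp
qed

text \<open>Take \<open>j\<close> as the residue of \<open>n / p\<close> modulo \<open>q\<close>;
  the bound on \<open>n\<close> ensures \<open>p j\<close> does not exceed it. This is the origin of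
  the constant \<open>p * q\<close> in everything that follows.\<close>

lemma weighted_pair_exists:
  fixes p q :: nat
  assumes "coprime p q" "q > 0" "n \<ge> p * q"
  obtains i j where "n = q * i + p * j" "j < q"
proof -
  obtain x where x: "[p * x = 1] (mod q)" using cong_solve_coprime_nat[OF assms(1)] by auto
  define j where "j = (x * n) mod q"
  have "[p * j = p * (x * n)] (mod q)" unfolding j_def by (intro cong_mult cong_refl) (simp add: cong_def)
  also have "[p * (x * n) = 1 * n] (mod q)" unfolding mult.assoc[symmetric] by (intro cong_mult cong_refl x)
  finally have c: "[p * j = n] (mod q)" by simp
  have "j < q" using assms(2) by (simp add: j_def)
  hence "p * j \<le> n" using assms(3) by (meson le_trans less_imp_le mult_le_mono2)
  hence "q dvd n - p * j" using c by (metis cong_altdef_nat cong_sym)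
  then obtain i where "n - p * j = q * i" by blast
  thus ?thesis using that[of i j] \<open>j < q\<close> \<open>p * j \<le> n\<close> by simp
qed

context artin_schreier
begin

section \<open>Weights, reduced polynomials and division by the curve equation\<close>

definition fpoly :: "'k poly" where "fpoly = Polynomial.monom 1 p - [:- a, 1:]"

definition rel :: "'k poly poly" where "rel = Polynomial.monom 1 q - [:fpoly:]"

abbreviation cf :: "'k poly poly \<Rightarrow> nat \<Rightarrow> nat \<Rightarrow> 'k" where
  "cf U j i \<equiv> poly.coeff (poly.coeff U j) i"

definition reduced :: "'k poly poly \<Rightarrow> bool" where "reduced U \<longleftrightarrow> (\<forall>j\<ge>q. poly.coeff U j = 0)"

text \<open>The weights are the pole orders \<open>q\<close> of \<open>x\<close> and
  \<open>p\<close> of \<open>y\<close>, under which \<open>y^q\<close> and \<open>x^p\<close>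
  balance.\<close>

definition weight_le :: "nat \<Rightarrow> 'k poly poly \<Rightarrow> bool" where
  "weight_le n U \<longleftrightarrow> (\<forall>i j. cf U j i \<noteq> 0 \<longrightarrow> q * i + p * j \<le> n)"

text \<open>
  The parametrisation \<open>x = Z^q\<close>, \<open>y = Z^p\<close> of the leading form \<open>y^q = x^p\<close>: the degree of the image
  of a reduced polynomial is its pole order at infinity.
\<close>

definition theta :: "'k poly poly \<Rightarrow> 'k poly" where
  "theta = eval_hom (eval_hom (\<lambda>c. [:c:]) (Polynomial.monom 1 q)) (Polynomial.monom 1 p)"

sublocale cst: ring_morphism "\<lambda>c :: 'k. [:c:]"
  by unfold_locales (simp_all add: one_pCons)

sublocale cst1: ring_morphism "eval_hom (\<lambda>c :: 'k. [:c:]) (Polynomial.monom 1 q)"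
  by (rule cst.eval_hom_morphism)

sublocale theta: ring_morphism theta
  unfolding theta_def by (rule cst1.eval_hom_morphism)

lemma theta_monom: "theta (Polynomial.monom (Polynomial.monom c i) j) = Polynomial.monom c (q * i + p * j)"
proof -
  have "theta (Polynomial.monom (Polynomial.monom c i) j) = [:c:] * Polynomial.monom 1 q ^ i * Polynomial.monom 1 p ^ j"
    by (simp add: theta_def cst1.eval_hom_monom cst.eval_hom_monom)
  also have "\<dots> = Polynomial.monom c (q * i + p * j)"
    by (simp add: monom_power mult_monom smult_monom mult.commute add.commute)
  finally show ?thesis .
qed

lemma bipoly_sum: "U = (\<Sum>j\<le>Polynomial.degree U. \<Sum>i\<le>Polynomial.degree (poly.coeff U j). Polynomial.monom (Polynomial.monom (cf U j i) i) j)"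
proof -
  have "(\<Sum>i\<le>Polynomial.degree c. Polynomial.monom (Polynomial.monom (poly.coeff c i) i) j) = Polynomial.monom c j" for c :: "'k poly" and j
  proof -
    have "(\<Sum>i\<in>I. Polynomial.monom (g i) j) = Polynomial.monom (\<Sum>i\<in>I. g i) j" for g :: "nat \<Rightarrow> 'k poly" and I
      by (induction I rule: infinite_finite_induct) (auto simp: add_monom)
    thus ?thesis by (simp add: poly_as_sum_of_monoms)
  qed
  thus ?thesis by (simp add: poly_as_sum_of_monoms)
qed

lemma theta_sum: "theta U = (\<Sum>j\<le>Polynomial.degree U. \<Sum>i\<le>Polynomial.degree (poly.coeff U j). Polynomial.monom (cf U j i) (q * i + p * j))"
  by (subst bipoly_sum) (simp only: theta.sum theta_monom)

lemma degree_theta_le: "weight_le n U \<Longrightarrow> Polynomial.degree (theta U) \<le> n"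
proof -
  assume U: "weight_le n U"
  have "Polynomial.degree (Polynomial.monom (cf U j i) (q * i + p * j)) \<le> n" for i j
    using U degree_monom_le[of "cf U j i" "q * i + p * j"] by (cases "cf U j i = 0") (auto simp: weight_le_def intro: order_trans)
  thus ?thesis unfolding theta_sum by (intro degree_sum_le) auto
qed

text \<open>Distinct reduced monomials have distinct weights, so \<open>theta\<close> only relabels
  the coefficients of a reduced polynomial. Its injectivity on reduced polynomials follows.\<close>

lemma coeff_theta_reduced:
  assumes "reduced U" "j < q"
  shows "poly.coeff (theta U) (q * i + p * j) = cf U j i"
proof -
  have e: "(if q * i' + p * j' = q * i + p * j then cf U j' i' else 0) = (if j' = j then if i' = i then cf U j i else 0 else 0)" for i' j'
  proof (cases "j' < q")
    case True
    thus ?thesis using weighted_pair_unique[of p q i' j' i j] assms(2) coprime_qp by (auto simp: coprime_commute)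
  next
    case False
    thus ?thesis using assms by (auto simp: reduced_def)
  qed
  have "poly.coeff (theta U) (q * i + p * j) = (\<Sum>j'\<le>Polynomial.degree U. \<Sum>i'\<le>Polynomial.degree (poly.coeff U j').
      if j' = j then if i' = i then cf U j i else 0 else 0)"
    unfolding theta_sum by (simp add: coeff_sum e)
  also have "\<dots> = (\<Sum>j'\<le>Polynomial.degree U. if j' = j then (\<Sum>i'\<le>Polynomial.degree (poly.coeff U j).
      if i' = i then cf U j i else 0) else 0)"
    by (intro sum.cong) auto
  also have "\<dots> = cf U j i" by (auto simp: coeff_eq_0)
  finally show ?thesis .
qed

lemma theta_eq_0_iff: "reduced U \<Longrightarrow> theta U = 0 \<longleftrightarrow> U = 0"
proof
  assume U: "reduced U" "theta U = 0"
  show "U = 0"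
  proof (intro poly_eqI)
    fix j i show "cf U j i = cf 0 j i"
      using coeff_theta_reduced[OF U(1), of j i] U by (cases "j < q") (auto simp: reduced_def)
  qed
qed (simp add: theta.zero)

lemma weight_le_theta: "reduced U \<Longrightarrow> weight_le (Polynomial.degree (theta U)) U"
  unfolding weight_le_def
proof (intro allI impI)
  fix i j assume U: "reduced U" "cf U j i \<noteq> 0"
  hence "j < q" by (metis reduced_def coeff_0 not_le)
  thus "q * i + p * j \<le> Polynomial.degree (theta U)" using U coeff_theta_reduced by (metis le_degree)
qed

lemma reduced_add: "reduced U \<Longrightarrow> reduced V \<Longrightarrow> reduced (U + V)"
  and reduced_diff: "reduced U \<Longrightarrow> reduced V \<Longrightarrow> reduced (U - V)"
  and reduced_0: "reduced 0"
  and reduced_monom: "j < q \<Longrightarrow> reduced (Polynomial.monom c j)"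
  by (auto simp: reduced_def)

lemma reduced_const: "reduced [:c:]"
  using q_pos by (auto simp: reduced_def coeff_pCons split: nat.splits)

lemma weight_le_diff: "weight_le n U \<Longrightarrow> weight_le n V \<Longrightarrow> weight_le n (U - V)"
  unfolding weight_le_def by (metis coeff_diff diff_self)

lemma weight_le_mult: "weight_le m U \<Longrightarrow> weight_le n V \<Longrightarrow> weight_le (m + n) (U * V)"
  unfolding weight_le_def
proof (intro allI impI)
  fix i j
  assume U: "\<forall>i j. cf U j i \<noteq> 0 \<longrightarrow> q * i + p * j \<le> m" and V: "\<forall>i j. cf V j i \<noteq> 0 \<longrightarrow> q * i + p * j \<le> n"
    and *: "cf (U * V) j i \<noteq> 0"
  have "cf (U * V) j i = (\<Sum>l\<le>j. \<Sum>r\<le>i. cf U l r * cf V (j - l) (i - r))"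
    by (simp add: coeff_mult coeff_sum)
  then obtain l where l: "l \<le> j" "(\<Sum>r\<le>i. cf U l r * cf V (j - l) (i - r)) \<noteq> 0"
    using * by (metis (no_types, lifting) atMost_iff sum.not_neutral_contains_not_neutral)
  then obtain r where r: "r \<le> i" "cf U l r * cf V (j - l) (i - r) \<noteq> 0"
    by (metis (no_types, lifting) atMost_iff sum.not_neutral_contains_not_neutral)
  have "q * r + p * l \<le> m" "q * (i - r) + p * (j - l) \<le> n" using U V r by auto
  moreover have "q * i = q * r + q * (i - r)" "p * j = p * l + p * (j - l)" using l r by (simp_all flip: add_mult_distrib2)
  ultimately show "q * i + p * j \<le> m + n" by linarith
qed

lemma coeff_fpoly: "poly.coeff fpoly i = (if i = p then 1 else 0) + (if i = 0 then a else 0) - (if i = 1 then 1 else 0)"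
  by (auto simp: fpoly_def coeff_pCons split: nat.splits)

lemma coeff_rel: "poly.coeff rel j = (if j = q then 1 else 0) - (if j = 0 then fpoly else 0)"
  by (auto simp: rel_def coeff_pCons split: nat.splits)

lemma weight_le_rel: "weight_le (p * q) rel"
  using p_pos p_gt_1 q_pos unfolding weight_le_def
  by (auto simp: coeff_rel coeff_fpoly mult.commute coeff_pCons one_pCons split: if_splits nat.splits)

text \<open>The two terms of top weight cancel. What remains has degree \<open>q\<close>, less than
  the weight \<open>p * q\<close> of \<open>rel\<close>; this gap is what keeps leading terms intact
  under reduction.\<close>

lemma theta_rel: "theta rel = Polynomial.monom 1 q - [:a:]"
proof -
  have "rel = Polynomial.monom (Polynomial.monom 1 0) q - Polynomial.monom (Polynomial.monom 1 p) 0
      + Polynomial.monom (Polynomial.monom 1 1) 0 - Polynomial.monom (Polynomial.monom a 0) 0"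
    by (intro poly_eqI) (auto simp: coeff_rel coeff_fpoly)
  thus ?thesis by (simp only: theta.add theta.diff theta_monom) (simp add: monom_0 mult.commute)
qed

lemma degree_theta_rel: "Polynomial.degree (theta rel) = q" "theta rel \<noteq> 0"
proof -
  show "Polynomial.degree (theta rel) = q" unfolding theta_rel using q_pos
    by (subst diff_conv_add_uminus, subst degree_add_eq_left) (auto simp: degree_monom_eq)
  thus "theta rel \<noteq> 0" using q_pos by auto
qed

text \<open>Ordinary division with respect to \<open>y\<close>, in which \<open>rel\<close> is
  monic. The weight is tracked along the way: each quotient term has weight at most
  \<open>n - p * q\<close>, so subtracting its multiple of \<open>rel\<close> stays within weight
  \<open>n\<close>.\<close>

lemma reduction:
  "weight_le n P \<Longrightarrow> \<exists>Q R. P = rel * Q + R \<and> reduced R \<and> weight_le n R \<and>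
     (Q = 0 \<or> p * q \<le> n \<and> weight_le (n - p * q) Q)"
proof (induction "Polynomial.degree P" arbitrary: P rule: less_induct)
  case less
  show ?case
  proof (cases "Polynomial.degree P < q")
    case True
    hence "reduced P" by (auto simp: reduced_def intro: coeff_eq_0)
    thus ?thesis using less.prems by (intro exI[of _ 0] exI[of _ P]) auto
  next
    case False
    define j where "j = Polynomial.degree P"
    define c where "c = Polynomial.lead_coeff P"
    \<comment> \<open>The quotient term that cancels the leading coefficient in
      \<open>y\<close>.\<close>
    define T where "T = Polynomial.monom c (j - q)"
    have jq: "j \<ge> q" "j > 0" using False q_pos by (auto simp: j_def)
    have c: "c \<noteq> 0" using jq unfolding c_def j_def by (metis degree_0 leading_coeff_0_iff less_irrefl)
    then obtain i0 where "poly.coeff c i0 \<noteq> 0" by (metis leading_coeff_0_iff)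
    hence "p * j \<le> n" using less.prems unfolding weight_le_def c_def j_def by (metis add_leD2)
    hence pq: "p * q \<le> n" using jq by (meson le_trans mult_le_mono2)
    have T: "weight_le (n - p * q) T"
      unfolding weight_le_def
    proof (intro allI impI)
      fix i l assume "cf T l i \<noteq> 0"
      hence l: "l = j - q" "poly.coeff c i \<noteq> 0" by (auto simp: T_def split: if_splits)
      hence "q * i + p * j \<le> n" using less.prems by (auto simp: weight_le_def c_def j_def)
      moreover have "p * j = p * l + p * q" using l jq by (simp flip: add_mult_distrib2)
      ultimately show "q * i + p * l \<le> n - p * q" by linarith
    qed
    have T0: "T \<noteq> 0" using c by (simp add: T_def)
    define P' where "P' = P - rel * T"
    have wP': "weight_le n P'"
      unfolding P'_def using less.prems weight_le_mult[OF weight_le_rel T] pq by (intro weight_le_diff) auto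
    have "Polynomial.degree P' < j"
    proof -
      have "poly.coeff (rel * T) l = (if l < j - q then 0 else poly.coeff rel (l - (j - q)) * c)" for l
        unfolding T_def mult.commute[of rel] coeff_monom_mult by (simp add: mult.commute)
      hence "poly.coeff P' l = 0" if "l \<ge> j" for l
        unfolding P'_def using that jq q_pos
        by (cases "l = j") (auto simp: coeff_rel c_def j_def coeff_eq_0)
      hence "Polynomial.degree P' \<le> j - 1" using jq by (intro degree_le) auto
      thus ?thesis using jq by simp
    qed
    then obtain Q R where QR: "P' = rel * Q + R" "reduced R" "weight_le n R" "Q = 0 \<or> p * q \<le> n \<and> weight_le (n - p * q) Q"
      using less.hyps[of P'] wP' by (auto simp: j_def)
    have "weight_le (n - p * q) (Q + T)"
      using QR(4) T weight_le_diff[of "n - p * q" Q "- T"] by (auto simp: weight_le_def)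
    moreover have "P = rel * (Q + T) + R" using QR(1) by (simp add: P'_def algebra_simps)
    ultimately show ?thesis using QR pq by blast
  qed
qed

lemma weight_le_exists: "\<exists>n. weight_le n P"
proof -
  define S where "S = (\<lambda>(j, i). q * i + p * j) ` (SIGMA j:{..Polynomial.degree P}. {..Polynomial.degree (poly.coeff P j)})"
  have "finite S" by (auto simp: S_def)
  have "weight_le (Max S) P" unfolding weight_le_def
  proof (intro allI impI)
    fix i j assume c: "cf P j i \<noteq> 0"
    hence "poly.coeff P j \<noteq> 0" by auto
    hence "(j, i) \<in> (SIGMA j:{..Polynomial.degree P}. {..Polynomial.degree (poly.coeff P j)})"
      using c by (auto intro: le_degree)
    hence "q * i + p * j \<in> S" unfolding S_def by force
    thus "q * i + p * j \<le> Max S" using \<open>finite S\<close> by simp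
  qed
  thus ?thesis by blast
qed

lemma reduction_exists: "\<exists>Q R. P = rel * Q + R \<and> reduced R"
  using weight_le_exists[of P] reduction by blast

text \<open>Additivity of the pole order. The image of the remainder is
  \<open>theta U * theta V\<close> minus \<open>theta rel * theta Q'\<close>, and the latter has
  degree at most \<open>q + n - p * q\<close>, below the degree \<open>n\<close> of the former. In
  particular, the coordinate ring has no zero divisors.\<close>

lemma degree_theta_mult:
  assumes "reduced U" "reduced V" "U \<noteq> 0" "V \<noteq> 0" "U * V = rel * Q + R" "reduced R"
  shows "theta R \<noteq> 0 \<and> Polynomial.degree (theta R) = Polynomial.degree (theta U) + Polynomial.degree (theta V)"
proof -
  define n where "n = Polynomial.degree (theta U) + Polynomial.degree (theta V)"
  have tUV: "theta U \<noteq> 0" "theta V \<noteq> 0" using assms theta_eq_0_iff by auto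
  have dUV: "Polynomial.degree (theta U * theta V) = n" using tUV by (simp add: degree_mult_eq n_def)
  have "weight_le n (U * V)" unfolding n_def by (intro weight_le_mult weight_le_theta assms)
  then obtain Q' R' where QR: "U * V = rel * Q' + R'" "reduced R'" "Q' = 0 \<or> p * q \<le> n \<and> weight_le (n - p * q) Q'"
    using reduction by blast
  \<comment> \<open>Remainders are unique: their difference has degree below \<open>q\<close> in
    \<open>y\<close>, while a nonzero multiple of \<open>rel\<close> has degree at least
    \<open>q\<close>.\<close>
  have "R = R'"
  proof (rule ccontr)
    assume "R \<noteq> R'"
    have e: "rel * (Q - Q') = R' - R" using assms(5) QR(1) by (simp add: algebra_simps)
    have red: "reduced (R' - R)" using assms QR by (intro reduced_diff)
    have "R' - R \<noteq> 0" using \<open>R \<noteq> R'\<close> by simp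
    hence D0: "Q - Q' \<noteq> 0" using e by auto
    define l where "l = Polynomial.degree (Q - Q')"
    have drel: "Polynomial.degree rel = q"
    proof (rule antisym)
      show "Polynomial.degree rel \<le> q" using q_pos by (intro degree_le) (auto simp: coeff_rel)
      show "q \<le> Polynomial.degree rel" using q_pos by (intro le_degree) (auto simp: coeff_rel)
    qed
    hence "rel \<noteq> 0" using q_pos by auto
    hence "Polynomial.degree (R' - R) = q + l" unfolding e[symmetric] l_def using D0 drel by (simp add: degree_mult_eq)
    moreover have "Polynomial.degree (R' - R) \<le> q - 1" using red by (intro degree_le) (auto simp: reduced_def)
    ultimately show False using q_pos by simp
  qed
  have tR: "theta R = theta U * theta V - theta rel * theta Q'"
    using arg_cong[OF QR(1), of theta] \<open>R = R'\<close> by (simp add: theta.add theta.mult)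
  have "Polynomial.degree (theta rel * theta Q') < n \<or> theta rel * theta Q' = 0"
  proof (cases "Q' = 0")
    case False
    hence pq: "p * q \<le> n" and "Polynomial.degree (theta Q') \<le> n - p * q" using QR(3) degree_theta_le by auto
    hence "Polynomial.degree (theta rel * theta Q') \<le> q + (n - p * q)"
      using degree_mult_le[of "theta rel" "theta Q'"] degree_theta_rel(1) by linarith
    moreover have "q < p * q" using p_gt_1 q_pos by simp
    ultimately show ?thesis using pq by linarith
  qed (simp add: theta.zero)
  thus ?thesis
  proof
    assume lt: "Polynomial.degree (theta rel * theta Q') < n"
    hence "Polynomial.degree (theta R) = n"
      unfolding tR diff_conv_add_uminus using dUV by (subst degree_add_eq_left) auto
    thus ?thesis using lt by (auto simp: n_def)
  next
    assume "theta rel * theta Q' = 0"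
    hence "theta R = theta U * theta V" unfolding tR by (metis diff_zero)
    thus ?thesis using dUV tUV by (simp add: n_def)
  qed
qed

text \<open>Division by leading terms: if the pole order of \<open>R\<close> exceeds that of
  \<open>U\<close> by more than \<open>p * q\<close>, some monomial \<open>e\<close> makes up the
  difference, and a scalar multiple of \<open>U * e\<close> cancels the leading term. With the
  finiteness of the base field, nonzero principal ideals have finite index.\<close>

lemma ideal_residue_small:
  assumes U: "reduced U" "U \<noteq> 0"
  shows "\<exists>V Q R. P = U * V + rel * Q + R \<and> reduced R \<and> Polynomial.degree (theta R) \<le> Polynomial.degree (theta U) + p * q"
proof -
  define n0 where "n0 = Polynomial.degree (theta U)"
  have red: "\<exists>V Q R'. R = U * V + rel * Q + R' \<and> reduced R' \<and> Polynomial.degree (theta R') \<le> n0 + p * q"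
    if "reduced R" for R using that
  proof (induction "Polynomial.degree (theta R)" arbitrary: R rule: less_induct)
    case less
    define n where "n = Polynomial.degree (theta R)"
    show ?case
    proof (cases "n \<le> n0 + p * q")
      case True
      thus ?thesis using less.prems n_def by (intro exI[of _ 0] exI[of _ R]) auto
    next
      case False
      hence "n - n0 \<ge> p * q" by simp
      then obtain i j where ij: "n - n0 = q * i + p * j" "j < q"
        using weighted_pair_exists[of p q "n - n0"] coprime_qp q_pos by (auto simp: coprime_commute)
      define e :: "'k poly poly" where "e = Polynomial.monom (Polynomial.monom 1 i) j"
      have e: "reduced e" "e \<noteq> 0" "Polynomial.degree (theta e) = n - n0"
        using ij by (auto simp: e_def reduced_monom theta_monom degree_monom_eq)
      obtain Q S where QS: "U * e = rel * Q + S" "reduced S" using reduction_exists by blast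
      have S: "theta S \<noteq> 0" "Polynomial.degree (theta S) = n"
        using degree_theta_mult[OF U(1) e(1) U(2) e(2) QS] e(3) False by (auto simp: n0_def)
      define c where "c = Polynomial.lead_coeff (theta R) / Polynomial.lead_coeff (theta S)"
      define R2 where "R2 = R - [:[:c:]:] * S"
      have "theta [:[:c:]:] = [:c:]" using theta_monom[of c 0 0] by (simp add: monom_0)
      hence tR2: "theta R2 = theta R - smult c (theta S)" unfolding R2_def theta.diff theta.mult by simp
      have "poly.coeff (theta R2) l = 0" if "l \<ge> n" for l
        using that S leading_coeff_0_iff[of "theta S"]
        by (cases "l = n") (auto simp: tR2 c_def n_def coeff_eq_0)
      hence "Polynomial.degree (theta R2) \<le> n - 1" using False by (intro degree_le) auto
      hence lt: "Polynomial.degree (theta R2) < Polynomial.degree (theta R)" using False by (simp add: n_def)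
      have "reduced R2" unfolding R2_def using less.prems QS(2) by (auto simp: reduced_def)
      then obtain V' Q' R' where h: "R2 = U * V' + rel * Q' + R'" "reduced R'" "Polynomial.degree (theta R') \<le> n0 + p * q"
        using less.hyps[OF lt] by blast
      have "R = U * (V' + [:[:c:]:] * e) + rel * (Q' - [:[:c:]:] * Q) + R'"
      proof -
        have "R = R2 + [:[:c:]:] * S" by (simp add: R2_def)
        also have "S = U * e - rel * Q" using QS by simp
        finally show ?thesis unfolding h(1) by (simp only: algebra_simps)
      qed
      thus ?thesis using h by blast
    qed
  qed
  obtain Q R where QR: "P = rel * Q + R" "reduced R" using reduction_exists by blast
  then obtain V Q' R' where "R = U * V + rel * Q' + R'" "reduced R'" "Polynomial.degree (theta R') \<le> n0 + p * q"
    using red by blast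
  hence "P = U * V + rel * (Q + Q') + R' \<and> reduced R' \<and> Polynomial.degree (theta R') \<le> Polynomial.degree (theta U) + p * q"
    unfolding QR(1) n0_def by (simp add: algebra_simps)
  thus ?thesis by blast
qed

lemma finite_reduced_bounded: "finite {R. reduced R \<and> Polynomial.degree (theta R) \<le> n}"
proof -
  have "inj_on theta {R. reduced R \<and> Polynomial.degree (theta R) \<le> n}"
  proof (rule inj_onI)
    fix R S assume "R \<in> {R. reduced R \<and> Polynomial.degree (theta R) \<le> n}" "S \<in> {R. reduced R \<and> Polynomial.degree (theta R) \<le> n}" "theta R = theta S"
    hence "theta (R - S) = 0" "reduced (R - S)" by (auto simp: theta.diff reduced_diff)
    thus "R = S" using theta_eq_0_iff by auto
  qed
  moreover have "theta ` {R. reduced R \<and> Polynomial.degree (theta R) \<le> n} \<subseteq> {P. \<forall>i\<ge>Suc n. poly.coeff P i = 0}"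
    by (auto intro: coeff_eq_0)
  ultimately show ?thesis
    using finite_subset[OF _ finite_polys_degree_less[where ?'b = 'k and n = "Suc n"]] finite_imageD by blast
qed

text \<open>Pigeonhole on the powers of \<open>P\<close> in the finite quotient ring. This relation
  is the source of all later finiteness: algebraic coordinates of points, finitely many zeros, and
  termination when uniformizers are split off.\<close>

lemma power_diff_in_ideal:
  assumes "reduced U" "U \<noteq> 0"
  shows "\<exists>i j V Q. i < j \<and> P ^ i - P ^ j = U * V + rel * Q"
proof -
  define n where "n = Polynomial.degree (theta U) + p * q"
  have "\<exists>R V Q. P ^ i = U * V + rel * Q + R \<and> reduced R \<and> Polynomial.degree (theta R) \<le> n" for i
    using ideal_residue_small[OF assms, of "P ^ i"] unfolding n_def by blast
  then obtain R where R: "\<And>i. \<exists>V Q. P ^ i = U * V + rel * Q + R i \<and> reduced (R i) \<and> Polynomial.degree (theta (R i)) \<le> n"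
    by metis
  have "\<not> inj R"
  proof
    assume "inj R"
    moreover have "range R \<subseteq> {R. reduced R \<and> Polynomial.degree (theta R) \<le> n}" using R by blast
    ultimately have "finite (UNIV :: nat set)" using finite_reduced_bounded[of n] finite_subset finite_imageD by blast
    thus False by simp
  qed
  then obtain i j where ij: "i < j" "R i = R j" by (metis injI linorder_neqE_nat)
  obtain V Q V' Q' where "P ^ i = U * V + rel * Q + R i" "P ^ j = U * V' + rel * Q' + R j" using R by meson
  hence "P ^ i - P ^ j = U * (V - V') + rel * (Q - Q')" using ij(2) by (simp add: algebra_simps)
  thus ?thesis using ij by blast
qed

end

section \<open>The affine coordinate ring and its points\<close>

text \<open>Here \<open>y\<close> is an arbitrary root in the closure; that its degree over the
  field of rational functions is \<open>q\<close> is contained in \<open>evA_inj\<close>.\<close>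

locale superelliptic = artin_schreier p tk q a
  for p and tk :: "'k :: {field, finite} itself" and q and a +
  fixes y :: "'k ambient"
  assumes y_eq: "y ^ q = var_x ^ p - var_x + const a"
begin

definition io :: "'k poly \<Rightarrow> 'k ambient" where "io c = to_ac (to_fract c)"

sublocale io: ring_morphism io
  by unfold_locales (simp_all add: io_def)

lemma io_eq_0_iff: "io c = 0 \<longleftrightarrow> c = 0"
  by (simp add: io_def)

lemma io_const: "io [:c:] = const c"
  by (simp add: io_def const_def)

lemma io_x: "io [:0, 1:] = var_x"
  by (simp add: io_def var_x_def)

lemma io_monom: "io (Polynomial.monom c n) = const c * var_x ^ n"
proof -
  have "Polynomial.monom c n = [:c:] * [:0, 1:] ^ n" by (simp add: monom_altdef)
  thus ?thesis by (simp only: io.mult io.power io_const io_x)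
qed

sublocale const: ring_morphism "const :: 'k \<Rightarrow> 'k ambient"
proof
  show "const (u + v) = const u + const v" for u v :: 'k by (simp flip: io_const io.add)
  show "const (u * v) = const u * const v" for u v :: 'k unfolding io_const[symmetric] io.mult[symmetric] by (simp add: mult.commute)
  show "const 1 = (1 :: 'k ambient)" by (simp flip: io_const add: io.one flip: one_pCons)
qed

lemma const_eq_0_iff: "const (c :: 'k) = 0 \<longleftrightarrow> c = 0"
  by (simp add: io_eq_0_iff flip: io_const)

lemma const_inverse: "const (inverse c :: 'k) = inverse (const c)"
  using const.mult[of c "inverse c"] const.zero const.one by (cases "c = 0") (auto simp: field_simps const_eq_0_iff const.zero)

definition evA :: "'k poly poly \<Rightarrow> 'k ambient" where "evA = eval_hom io y"

sublocale evA: ring_morphism evA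
  unfolding evA_def by (rule io.eval_hom_morphism)

lemma evA_const: "evA [:c:] = io c"
  by (simp add: evA_def io.eval_hom_const)

lemma evA_rel: "evA rel = 0"
proof -
  have "evA rel = y ^ q - io fpoly"
    unfolding rel_def evA.diff evA_const by (simp add: evA_def io.eval_hom_monom io.one)
  also have "io fpoly = var_x ^ p - (const (- a) + var_x)"
  proof -
    have "[:- a, 1:] = [:- a:] + [:0, 1:]" by simp
    thus ?thesis unfolding fpoly_def io.diff io_monom by (simp only: io.add io_const io_x const.one mult_1_left)
  qed
  also have "const (- a) = - const a" using const.diff[of 0 a] by (simp add: const.zero)
  finally show ?thesis by (simp add: y_eq)
qed

text \<open>A nonzero reduced \<open>U\<close> in the kernel would put some \<open>x^i - x^j\<close>
  with \<open>i < j\<close> into the ideal generated by \<open>U\<close> and \<open>rel\<close>,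
  hence into the kernel, although \<open>x\<close> is transcendental.\<close>

lemma evA_inj:
  assumes "reduced U" "evA U = 0" shows "U = 0"
proof (rule ccontr)
  assume "U \<noteq> 0"
  then obtain i j V Q where ij: "i < j" "[:[:0, 1:]:] ^ i - [:[:0, 1:]:] ^ j = U * V + rel * Q"
    using power_diff_in_ideal[OF assms(1)] by blast
  from arg_cong[OF ij(2), of evA] have "io [:0, 1:] ^ i - io [:0, 1:] ^ j = 0"
    by (simp add: evA.diff evA.power evA_const evA.add evA.mult assms(2) evA_rel)
  hence "io (Polynomial.monom 1 i - Polynomial.monom 1 j) = 0"
    by (simp add: io.diff io_monom io_x const.one)
  hence "Polynomial.monom 1 i = (Polynomial.monom 1 j :: 'k poly)" by (simp add: io_eq_0_iff)
  hence "i = j" by (metis degree_monom_eq one_neq_zero)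
  thus False using ij by simp
qed

definition A :: "'k ambient set" where "A = range evA"

lemma reduced_rep_exists:
  assumes "u \<in> A" shows "\<exists>U. reduced U \<and> evA U = u"
proof -
  obtain P where P: "u = evA P" using assms by (auto simp: A_def)
  obtain Q R where "P = rel * Q + R" "reduced R" using reduction_exists by blast
  thus ?thesis using P by (auto simp: evA.add evA.mult evA_rel)
qed

definition rep :: "'k ambient \<Rightarrow> 'k poly poly" where "rep u = (SOME U. reduced U \<and> evA U = u)"

lemma rep: "u \<in> A \<Longrightarrow> reduced (rep u)" "u \<in> A \<Longrightarrow> evA (rep u) = u"
  using someI_ex[OF reduced_rep_exists] by (auto simp: rep_def)

lemma rep_unique: "reduced U \<Longrightarrow> rep (evA U) = U"
proof -
  assume U: "reduced U"
  have "evA U \<in> A" by (simp add: A_def)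
  hence "reduced (rep (evA U) - U)" "evA (rep (evA U) - U) = 0" using rep U by (auto simp: reduced_diff evA.diff)
  hence "rep (evA U) - U = 0" by (rule evA_inj)
  thus ?thesis by simp
qed

lemma A_add: "u \<in> A \<Longrightarrow> v \<in> A \<Longrightarrow> u + v \<in> A" and A_diff: "u \<in> A \<Longrightarrow> v \<in> A \<Longrightarrow> u - v \<in> A"
  and A_mult: "u \<in> A \<Longrightarrow> v \<in> A \<Longrightarrow> u * v \<in> A"
  unfolding A_def by (auto simp flip: evA.add evA.mult evA.diff)

lemma A_io: "io c \<in> A"
  unfolding A_def by (metis evA_const rangeI)

lemma A_const: "const c \<in> A" and A_x: "var_x \<in> A" and A_0: "0 \<in> A" and A_1: "1 \<in> A"
  using A_io[of "[:c:]"] A_io[of "[:0, 1:]"] A_io[of 0] A_io[of 1] by (simp_all add: io_const io_x io.zero io.one)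

lemma A_y: "y \<in> A"
proof -
  have "evA [:0, 1:] = y" by (simp add: evA_def io.eval_hom_pCons io.eval_hom_const io.eval_hom_0 io.zero io.one)
  thus ?thesis unfolding A_def by (metis rangeI)
qed

lemma A_power: "u \<in> A \<Longrightarrow> u ^ n \<in> A"
  by (induction n) (auto simp: A_1 A_mult)

lemma A_prod: "(\<And>i. i \<in> I \<Longrightarrow> g i \<in> A) \<Longrightarrow> (\<Prod>i\<in>I. g i) \<in> A"
  by (induction I rule: infinite_finite_induct) (auto simp: A_1 A_mult)

lemma io_pCons: "io (pCons c P) = const c + var_x * io P"
proof -
  have "pCons c P = [:c:] + [:0, 1:] * P" by simp
  thus ?thesis by (simp only: io.add io.mult io_const io_x)
qed

lemma A_induct [consumes 1, case_names const x y add mult]: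
  assumes "u \<in> A" "\<And>c. Q (const c)" "Q var_x" "Q y"
    "\<And>u v. u \<in> A \<Longrightarrow> v \<in> A \<Longrightarrow> Q u \<Longrightarrow> Q v \<Longrightarrow> Q (u + v)"
    "\<And>u v. u \<in> A \<Longrightarrow> v \<in> A \<Longrightarrow> Q u \<Longrightarrow> Q v \<Longrightarrow> Q (u * v)"
  shows "Q u"
proof -
  have io: "Q (io c)" for c
  proof (induction c)
    case 0 thus ?case using assms(2)[of 0] by (simp add: const.zero io.zero)
  next
    case (pCons c P)
    thus ?case unfolding io_pCons by (intro assms A_mult A_const A_x A_io)
  qed
  have "Q (evA U)" for U
  proof (induction U)
    case 0 thus ?case using io[of 0] by (simp add: io.zero evA.zero)
  next
    case (pCons c P)
    have "evA (pCons c P) = io c + y * evA P" by (simp add: evA_def io.eval_hom_pCons)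
    thus ?case using pCons A_io A_y by (auto intro!: assms(5,6) A_mult io assms(4) simp: A_def)
  qed
  thus ?thesis using assms(1) by (auto simp: A_def)
qed

section \<open>Pole orders of functions in the coordinate ring\<close>

definition th :: "'k ambient \<Rightarrow> 'k poly" where "th u = theta (rep u)"

definition pole :: "'k ambient \<Rightarrow> nat" where "pole u = Polynomial.degree (th u)"

lemma th_add: "u \<in> A \<Longrightarrow> v \<in> A \<Longrightarrow> th (u + v) = th u + th v"
proof -
  assume uv: "u \<in> A" "v \<in> A"
  have "rep (evA (rep u + rep v)) = rep u + rep v" using uv by (intro rep_unique reduced_add rep)
  thus ?thesis using uv by (simp add: th_def evA.add rep theta.add)
qed

lemma th_diff: "u \<in> A \<Longrightarrow> v \<in> A \<Longrightarrow> th (u - v) = th u - th v"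
proof -
  assume uv: "u \<in> A" "v \<in> A"
  have "rep (evA (rep u - rep v)) = rep u - rep v" using uv by (intro rep_unique reduced_diff rep)
  thus ?thesis using uv by (simp add: th_def evA.diff rep theta.diff)
qed

lemma th_const_mult: "u \<in> A \<Longrightarrow> th (const c * u) = smult c (th u)"
proof -
  assume u: "u \<in> A"
  have "rep (evA ([:[:c:]:] * rep u)) = [:[:c:]:] * rep u" using rep(1)[OF u] by (intro rep_unique) (auto simp: reduced_def)
  moreover have "theta [:[:c:]:] = [:c:]" using theta_monom[of c 0 0] by (simp add: monom_0)
  ultimately show ?thesis using u unfolding th_def evA.mult evA_const io_const rep(2)[OF u] by (simp only: theta.mult) simp
qed

lemma th_eq_0_iff: "u \<in> A \<Longrightarrow> th u = 0 \<longleftrightarrow> u = 0"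
  unfolding th_def using rep theta_eq_0_iff[of "rep u"] evA.zero rep_unique[OF reduced_0] by force

lemma th_const: "th (const c) = [:c:]"
proof -
  have "rep (evA [:[:c:]:]) = [:[:c:]:]" by (intro rep_unique reduced_const)
  thus ?thesis using theta_monom[of c 0 0] by (simp add: th_def evA_const io_const monom_0)
qed

lemma pole_const: "pole (const c) = 0"
  by (simp add: pole_def th_const)

lemma pole_mult:
  assumes "u \<in> A" "v \<in> A" "u \<noteq> 0" "v \<noteq> 0"
  shows "pole (u * v) = pole u + pole v"
proof -
  obtain Q R where QR: "rep u * rep v = rel * Q + R" "reduced R" using reduction_exists by blast
  from arg_cong[OF QR(1), of evA] have "evA R = u * v" using assms by (simp add: evA.add evA.mult evA_rel rep)
  hence "rep (u * v) = R" using rep_unique QR by metis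
  moreover have "rep u \<noteq> 0" "rep v \<noteq> 0" using assms rep(2) evA.zero by force+
  ultimately show ?thesis using degree_theta_mult[OF _ _ _ _ QR] rep assms by (simp add: pole_def th_def)
qed

lemma pole_0: "pole 0 = 0"
  using pole_const[of 0] by (simp add: const.zero)

lemma pole_power: "u \<in> A \<Longrightarrow> u \<noteq> 0 \<Longrightarrow> pole (u ^ n) = n * pole u"
proof (induction n)
  case 0 thus ?case using pole_const[of 1] by (simp add: const.one)
qed (simp add: pole_mult A_power)

lemma rep_monom: "j < q \<Longrightarrow> th (var_x ^ i * y ^ j) = Polynomial.monom 1 (q * i + p * j)"
proof -
  assume j: "j < q"
  have "evA (Polynomial.monom (Polynomial.monom 1 i) j) = var_x ^ i * y ^ j"
    by (simp add: evA_def io.eval_hom_monom io_monom const.one)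
  thus ?thesis using rep_unique[OF reduced_monom[OF j]] by (metis th_def theta_monom)
qed

lemma var_x_nonzero: "(var_x :: 'k ambient) \<noteq> 0"
  using io_eq_0_iff[of "[:0, 1:]"] by (simp add: io_x)

lemma pole_x: "pole var_x = q"
  using rep_monom[of 0 1] q_pos by (simp add: pole_def degree_monom_eq)

lemma pole_y: "pole y = p"
  using rep_monom[of 1 0] q_gt_1 by (simp add: pole_def degree_monom_eq)

lemma y_nonzero: "y \<noteq> 0"
  using pole_y pole_0 p_pos by auto

lemma pole_surj:
  assumes "n \<ge> p * q" obtains u where "u \<in> A" "u \<noteq> 0" "pole u = n"
proof -
  obtain i j where ij: "n = q * i + p * j" "j < q"
    using weighted_pair_exists[of p q n] coprime_qp q_pos assms by (auto simp: coprime_commute)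
  show ?thesis
  proof (rule that)
    show "var_x ^ i * y ^ j \<in> A" by (intro A_mult A_power A_x A_y)
    show "var_x ^ i * y ^ j \<noteq> 0" using var_x_nonzero y_nonzero by simp
    show "pole (var_x ^ i * y ^ j) = n" using ij by (simp add: pole_def rep_monom degree_monom_eq)
  qed
qed

lemma pole_0_const: "u \<in> A \<Longrightarrow> pole u = 0 \<Longrightarrow> \<exists>c. u = const c"
proof -
  assume u: "u \<in> A" "pole u = 0"
  then obtain c where "th u = [:c:]" unfolding pole_def by (elim degree_eq_zeroE)
  hence "th (u - const c) = 0" using u by (simp add: th_diff A_const th_const)
  thus ?thesis using th_eq_0_iff[of "u - const c"] u by (auto simp: A_diff A_const)
qed

text \<open>The Riemann-Roch space of \<open>n\<close> times the point at infinity.\<close>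

definition Fil :: "nat \<Rightarrow> 'k ambient set" where "Fil n = {u \<in> A. pole u \<le> n}"

lemma Fil_add: "u \<in> Fil n \<Longrightarrow> v \<in> Fil n \<Longrightarrow> u + v \<in> Fil n"
  and Fil_diff: "u \<in> Fil n \<Longrightarrow> v \<in> Fil n \<Longrightarrow> u - v \<in> Fil n"
  by (auto simp: Fil_def A_add A_diff pole_def th_add th_diff intro: degree_add_le degree_diff_le)

lemma Fil_const_mult: "u \<in> Fil n \<Longrightarrow> const c * u \<in> Fil n"
  by (auto simp: Fil_def A_mult A_const pole_def th_const_mult intro: order_trans[OF degree_smult_le])

text \<open>The leading coefficients lie in the base field, so one scalar lowers the pole order.
  Consecutive filtration steps thus differ by at most a factor \<open>p\<close>, and infinity has
  degree 1.\<close>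

lemma cancel_leading:
  assumes "u \<in> A" "v \<in> A" "v \<noteq> 0" "pole u = Suc n" "pole v = Suc n"
  shows "\<exists>c. u - const c * v \<in> Fil n"
proof -
  define c where "c = Polynomial.lead_coeff (th u) / Polynomial.lead_coeff (th v)"
  have v0: "th v \<noteq> 0" using assms th_eq_0_iff by simp
  have t: "th (u - const c * v) = th u - smult c (th v)" using assms by (simp add: th_diff th_const_mult A_mult A_const)
  have "poly.coeff (th (u - const c * v)) l = 0" if "l > n" for l
    using that assms v0 leading_coeff_0_iff[of "th v"] unfolding t
    by (cases "l = Suc n") (auto simp: c_def pole_def coeff_eq_0)
  hence "pole (u - const c * v) \<le> n" unfolding pole_def by (intro degree_le) auto
  thus ?thesis using assms by (auto simp: Fil_def A_diff A_mult A_const)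
qed

lemma power_diff_in_principal:
  assumes "u \<in> A" "u \<noteq> 0" "w \<in> A"
  shows "\<exists>i j v. i < j \<and> v \<in> A \<and> w ^ i - w ^ j = u * v"
proof -
  have "rep u \<noteq> 0" using assms rep(2) evA.zero by force
  then obtain i j V Q where ij: "i < j" "rep w ^ i - rep w ^ j = rep u * V + rel * Q"
    using power_diff_in_ideal[OF rep(1)[OF assms(1)]] by blast
  from arg_cong[OF ij(2), of evA] have "w ^ i - w ^ j = u * evA V"
    using assms by (simp add: evA.diff evA.power evA.add evA.mult evA_rel rep)
  thus ?thesis using ij by (auto simp: A_def)
qed

section \<open>Evaluation at the points over the algebraic closure\<close>

sublocale ac: ring_morphism "to_ac :: 'k \<Rightarrow> 'k alg_closure"
  by unfold_locales simp_all

lemma ac_eval_morphism: "ring_morphism (eval_hom (to_ac :: 'k \<Rightarrow> 'k alg_closure) z)"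
  by (rule ac.eval_hom_morphism)

lemma eval_fpoly: "eval_hom to_ac z fpoly = fa z"
proof -
  interpret e: ring_morphism "eval_hom (to_ac :: 'k \<Rightarrow> 'k alg_closure) z" by (rule ac_eval_morphism)
  show ?thesis unfolding fpoly_def e.diff by (simp add: ac.eval_hom_monom ac.eval_hom_pCons ac.eval_hom_const ac.eval_hom_0 fa_def)
qed

definition evP :: "'k alg_closure \<times> 'k alg_closure \<Rightarrow> 'k poly poly \<Rightarrow> 'k alg_closure" where
  "evP P = eval_hom (eval_hom to_ac (fst P)) (snd P)"

definition ev :: "'k alg_closure \<times> 'k alg_closure \<Rightarrow> 'k ambient \<Rightarrow> 'k alg_closure" where
  "ev P u = evP P (rep u)"

lemma evP_morphism: "ring_morphism (evP P)"
proof -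
  interpret e: ring_morphism "eval_hom (to_ac :: 'k \<Rightarrow> 'k alg_closure) (fst P)" by (rule ac_eval_morphism)
  show ?thesis unfolding evP_def by (rule e.eval_hom_morphism)
qed

lemma evP_rel: "P \<in> pts \<Longrightarrow> evP P rel = 0"
proof -
  assume P: "P \<in> pts"
  interpret e: ring_morphism "eval_hom (to_ac :: 'k \<Rightarrow> 'k alg_closure) (fst P)" by (rule ac_eval_morphism)
  interpret f: ring_morphism "evP P" by (rule evP_morphism)
  show ?thesis using P unfolding rel_def f.diff
    by (auto simp: evP_def e.eval_hom_monom e.eval_hom_const eval_fpoly e.one pts_def)
qed

lemma ev_evA: "P \<in> pts \<Longrightarrow> ev P (evA U) = evP P U"
proof -
  assume P: "P \<in> pts"
  interpret f: ring_morphism "evP P" by (rule evP_morphism)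
  obtain Q R where "U = rel * Q + R" "reduced R" using reduction_exists by blast
  thus ?thesis using P by (simp add: ev_def evA.add evA.mult evA_rel rep_unique f.add f.mult evP_rel)
qed

lemma ev_add: "P \<in> pts \<Longrightarrow> u \<in> A \<Longrightarrow> v \<in> A \<Longrightarrow> ev P (u + v) = ev P u + ev P v"
  and ev_diff: "P \<in> pts \<Longrightarrow> u \<in> A \<Longrightarrow> v \<in> A \<Longrightarrow> ev P (u - v) = ev P u - ev P v"
  and ev_mult: "P \<in> pts \<Longrightarrow> u \<in> A \<Longrightarrow> v \<in> A \<Longrightarrow> ev P (u * v) = ev P u * ev P v"
proof -
  interpret f: ring_morphism "evP P" by (rule evP_morphism)
  assume "P \<in> pts" "u \<in> A" "v \<in> A"
  thus "ev P (u + v) = ev P u + ev P v" "ev P (u - v) = ev P u - ev P v" "ev P (u * v) = ev P u * ev P v"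
    by (auto simp: A_def ev_evA f.add f.mult f.diff simp flip: evA.add evA.mult evA.diff)
qed

lemma ev_io: "P \<in> pts \<Longrightarrow> ev P (io c) = eval_hom to_ac (fst P) c"
proof -
  assume P: "P \<in> pts"
  interpret e: ring_morphism "eval_hom (to_ac :: 'k \<Rightarrow> 'k alg_closure) (fst P)" by (rule ac_eval_morphism)
  show ?thesis using ev_evA[OF P, of "[:c:]"] by (simp add: evA_const evP_def e.eval_hom_const)
qed

lemma ev_const: "P \<in> pts \<Longrightarrow> ev P (const c) = to_ac c"
  using ev_io[of P "[:c:]"] by (simp add: io_const ac.eval_hom_const)

lemma ev_x: "P \<in> pts \<Longrightarrow> ev P var_x = fst P"
  using ev_io[of P "[:0, 1:]"] by (simp add: io_x ac.eval_hom_pCons ac.eval_hom_const ac.eval_hom_0)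

lemma ev_0: "P \<in> pts \<Longrightarrow> ev P 0 = 0" and ev_1: "P \<in> pts \<Longrightarrow> ev P 1 = 1"
  using ev_const[of P 0] ev_const[of P 1] by (simp_all add: const.zero const.one)

lemma ev_y: "P \<in> pts \<Longrightarrow> ev P y = snd P"
proof -
  assume P: "P \<in> pts"
  interpret e: ring_morphism "eval_hom (to_ac :: 'k \<Rightarrow> 'k alg_closure) (fst P)" by (rule ac_eval_morphism)
  have "evA [:0, 1:] = y" by (simp add: evA_def io.eval_hom_pCons io.eval_hom_const io.eval_hom_0 io.zero io.one)
  thus ?thesis using ev_evA[OF P, of "[:0, 1:]"] by (simp add: evP_def e.eval_hom_pCons e.eval_hom_const e.eval_hom_0 e.zero e.one)
qed

lemma ev_power: "P \<in> pts \<Longrightarrow> u \<in> A \<Longrightarrow> ev P (u ^ n) = ev P u ^ n"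
  by (induction n) (auto simp: ev_1 ev_mult A_power)

lemma ev_prod: "P \<in> pts \<Longrightarrow> (\<And>i. i \<in> I \<Longrightarrow> g i \<in> A) \<Longrightarrow> ev P (\<Prod>i\<in>I. g i) = (\<Prod>i\<in>I. ev P (g i))"
  by (induction I rule: infinite_finite_induct) (auto simp: ev_1 ev_mult A_prod)

lemma ev_funpow_frp:
  assumes "P \<in> pts" "u \<in> A"
  shows "(frp ^^ n) P \<in> pts \<and> ev ((frp ^^ n) P) u = ev P u ^ p ^ n"
proof
  show P: "(frp ^^ n) P \<in> pts" using frp_pts assms(1) by (induction n) auto
  show "ev ((frp ^^ n) P) u = ev P u ^ p ^ n"
    using assms(2)
  proof (induction u rule: A_induct)
    case (const c)
    thus ?case using P assms(1) by (simp add: ev_const k_power flip: to_ac_power)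
  next
    case x
    thus ?case using P assms(1) by (cases P) (simp add: ev_x funpow_frp)
  next
    case y
    thus ?case using P assms(1) by (cases P) (simp add: ev_y funpow_frp)
  next
    case (add u v)
    thus ?case using P assms(1) by (simp add: ev_add power_add_char[OF char_ac])
  next
    case (mult u v)
    thus ?case using P assms(1) by (simp add: ev_mult power_mult_distrib)
  qed
qed

lemma A_sum: "u \<in> A \<Longrightarrow> u = (\<Sum>j<q. io (poly.coeff (rep u) j) * y ^ j)"
proof -
  assume u: "u \<in> A"
  have "Polynomial.degree (rep u) \<le> q - 1" using rep(1)[OF u] q_pos by (intro degree_le) (auto simp: reduced_def)
  hence "evA (rep u) = (\<Sum>j\<le>q-1. io (poly.coeff (rep u) j) * y ^ j)" unfolding evA_def by (rule io.eval_hom_altdef)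
  moreover have "{..q-1} = {..<q}" using q_pos by auto
  ultimately show ?thesis using rep(2)[OF u] by simp
qed

lemma ev_sum: "P \<in> pts \<Longrightarrow> u \<in> A \<Longrightarrow> ev P u = (\<Sum>j<q. eval_hom to_ac (fst P) (poly.coeff (rep u) j) * snd P ^ j)"
proof -
  assume P: "P \<in> pts" and u: "u \<in> A"
  interpret e: ring_morphism "eval_hom (to_ac :: 'k \<Rightarrow> 'k alg_closure) (fst P)" by (rule ac_eval_morphism)
  have "Polynomial.degree (rep u) \<le> q - 1" using rep(1)[OF u] q_pos by (intro degree_le) (auto simp: reduced_def)
  hence "ev P u = (\<Sum>j\<le>q-1. eval_hom to_ac (fst P) (poly.coeff (rep u) j) * snd P ^ j)"
    unfolding ev_def evP_def by (rule e.eval_hom_altdef)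
  moreover have "{..q-1} = {..<q}" using q_pos by auto
  ultimately show ?thesis by simp
qed

text \<open>Over an unbranched \<open>z\<close> there are \<open>q\<close> points, and the
  restriction of \<open>u\<close> to the fibre is a polynomial in \<open>w\<close> of degree below
  \<open>q\<close> with \<open>q\<close> roots.\<close>

lemma coeffs_vanish:
  assumes "u \<in> A" "fa z \<noteq> 0" "\<And>w. w ^ q = fa z \<Longrightarrow> ev (z, w) u = 0" "j < q"
  shows "eval_hom to_ac z (poly.coeff (rep u) j) = 0"
proof -
  define G where "G = (\<Sum>j<q. Polynomial.monom (eval_hom to_ac z (poly.coeff (rep u) j)) j)"
  have cG: "poly.coeff G l = (if l < q then eval_hom to_ac z (poly.coeff (rep u) l) else 0)" for l
    by (simp add: G_def coeff_sum)
  have deg: "Polynomial.degree G < q" using q_pos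
    by (intro le_less_trans[OF degree_le[of "q - 1"]]) (auto simp: cG)
  have pG: "poly G w = 0" if "w ^ q = fa z" for w
    using assms(3)[OF that] ev_sum[of "(z, w)" u] assms(1) that by (simp add: G_def poly_sum poly_monom pts_def)
  have "G = 0"
  proof (rule ccontr)
    assume G: "G \<noteq> 0"
    have "card {w. w ^ q = fa z} \<le> card {w. poly G w = 0}"
      using pG poly_roots_finite[OF G] by (intro card_mono) auto
    hence "q \<le> Polynomial.degree G" using card_qth_roots[OF assms(2)] card_poly_roots_bound[OF G] by linarith
    thus False using deg by simp
  qed
  thus ?thesis using cG[of j] assms(4) by simp
qed

section \<open>Nonzero prime ideals are the kernels of points\<close>

definition A_ideal :: "'k ambient set \<Rightarrow> bool" where
  "A_ideal M \<longleftrightarrow> M \<subseteq> A \<and> 0 \<in> M \<and> (\<forall>u\<in>M. \<forall>v\<in>M. u + v \<in> M) \<and> (\<forall>u\<in>M. \<forall>v\<in>A. u * v \<in> M)"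

definition A_prime :: "'k ambient set \<Rightarrow> bool" where
  "A_prime M \<longleftrightarrow> A_ideal M \<and> 1 \<notin> M \<and> (\<forall>u\<in>A. \<forall>v\<in>A. u * v \<in> M \<longrightarrow> u \<in> M \<or> v \<in> M)"

lemma A_ideal_sum: "A_ideal M \<Longrightarrow> (\<And>i. i \<in> I \<Longrightarrow> g i \<in> M) \<Longrightarrow> (\<Sum>i\<in>I. g i) \<in> M"
  by (induction I rule: infinite_finite_induct) (auto simp: A_ideal_def)

lemma A_ideal_mult: "A_ideal M \<Longrightarrow> u \<in> M \<Longrightarrow> v \<in> A \<Longrightarrow> u * v \<in> M"
  and A_ideal_mult': "A_ideal M \<Longrightarrow> u \<in> M \<Longrightarrow> v \<in> A \<Longrightarrow> v * u \<in> M"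
  by (auto simp: A_ideal_def mult.commute)

lemma A_prime_power: "A_prime M \<Longrightarrow> u \<in> A \<Longrightarrow> u ^ n \<in> M \<Longrightarrow> u \<in> M"
proof (induction n)
  case (Suc n)
  have "u ^ n \<in> A" using Suc.prems(2) by (rule A_power)
  hence "u \<in> M \<or> u ^ n \<in> M" using Suc.prems by (auto simp: A_prime_def)
  thus ?case using Suc by blast
qed (auto simp: A_prime_def)

lemma A_prime_prod:
  "A_prime M \<Longrightarrow> (\<And>i. i \<in> I \<Longrightarrow> g i \<in> A) \<Longrightarrow> (\<Prod>i\<in>I. g i) \<in> M \<Longrightarrow> \<exists>i\<in>I. g i \<in> M"
proof (induction I rule: infinite_finite_induct)
  case (insert i I)
  have "g i \<in> M \<or> (\<Prod>i\<in>I. g i) \<in> M"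
    using insert.prems insert.hyps A_prod[of I g] by (auto simp: A_prime_def)
  thus ?case using insert by auto
qed (auto simp: A_prime_def)

text \<open>
  A weak Nullstellensatz: if for every point \<open>(z, w)\<close> over a fixed \<open>z\<close> the prime contains some \<open>h\<^sub>w\<close>
  not vanishing there, then the product of the \<open>1 - h\<^sub>w^(p^N - 1)\<close> vanishes at all these points,
  which forces it into the prime.
\<close>

theorem prime_is_point:
  assumes M: "A_prime M" and u0: "u0 \<in> M" "u0 \<noteq> 0"
  obtains P where "P \<in> pts" "M = {u \<in> A. ev P u = 0}"
proof -
  have I: "A_ideal M" and M1: "1 \<notin> M" and prm: "\<And>u v. u \<in> A \<Longrightarrow> v \<in> A \<Longrightarrow> u * v \<in> M \<Longrightarrow> u \<in> M \<or> v \<in> M"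
    using M by (auto simp: A_prime_def)
  have MA: "M \<subseteq> A" using I by (simp add: A_ideal_def)
  have pd: "\<exists>i j. i < j \<and> w ^ i - w ^ j \<in> M" if "w \<in> A" for w
    using power_diff_in_principal[of u0 w] u0 MA that A_ideal_mult[OF I] by (metis subsetD)
  obtain i j where ij: "i < j" "var_x ^ i - var_x ^ j \<in> M" using pd[OF A_x] by blast
  \<comment> \<open>\<open>Q\<close> singles out the nonzero polynomials in \<open>x\<close> alone
    that lie in \<open>M\<close>; a root \<open>z\<close> of one of least degree becomes the first
    coordinate.\<close>
  define Q where "Q g \<longleftrightarrow> g \<noteq> 0 \<and> io g \<in> M" for g
  have "Q (Polynomial.monom 1 i - Polynomial.monom 1 j)"
  proof -
    have "Polynomial.monom 1 i \<noteq> (Polynomial.monom 1 j :: 'k poly)" using ij(1) by (metis degree_monom_eq nat_neq_iff one_neq_zero)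
    thus ?thesis using ij(2) by (simp add: Q_def io.diff io_monom const.one)
  qed
  then obtain g where g: "Q g" and gmin: "\<And>g'. Q g' \<Longrightarrow> Polynomial.degree g \<le> Polynomial.degree g'"
    using ex_has_least_nat[of Q _ Polynomial.degree] by blast
  have "Polynomial.degree g > 0"
  proof (rule ccontr)
    assume "\<not> Polynomial.degree g > 0"
    then obtain c where c: "g = [:c:]" by (auto elim: degree_eq_zeroE)
    hence "const c \<in> M" "c \<noteq> 0" using g by (auto simp: Q_def io_const)
    hence "const c * const (inverse c) \<in> M" using A_ideal_mult[OF I] A_const by blast
    thus False using \<open>c \<noteq> 0\<close> M1 by (simp add: const.one flip: const.mult)
  qed
  hence "Polynomial.degree (map_poly (to_ac :: 'k \<Rightarrow> 'k alg_closure) g) > 0" by (subst degree_map_poly) auto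
  then obtain z where z: "eval_hom to_ac z g = 0" using alg_closed_imp_poly_has_root unfolding eval_hom_def by blast
  interpret e: ring_morphism "eval_hom (to_ac :: 'k \<Rightarrow> 'k alg_closure) z" by (rule ac_eval_morphism)
  \<comment> \<open>A minimal \<open>m\<close> for \<open>V\<close> is a minimal polynomial of
    \<open>z\<close>. The cofactor \<open>s\<close> of \<open>m\<close> in \<open>g\<close> has
    smaller degree than \<open>g\<close> and so is outside \<open>M\<close>; primality puts
    \<open>m\<close>, and with it every polynomial vanishing at \<open>z\<close>, into
    \<open>M\<close>.\<close>
  define V where "V m \<longleftrightarrow> m \<noteq> 0 \<and> eval_hom to_ac z m = 0" for m
  have "V g" using g z by (simp add: V_def Q_def)
  then obtain m where m: "V m" and mmin: "\<And>m'. V m' \<Longrightarrow> Polynomial.degree m \<le> Polynomial.degree m'"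
    using ex_has_least_nat[of V _ Polynomial.degree] by blast
  have mdvd: "m dvd c" if "eval_hom to_ac z c = 0" for c
  proof -
    have "c = c div m * m + c mod m" by simp
    hence "eval_hom to_ac z (c mod m) = 0" using that m by (metis V_def add_0 e.add e.mult mult_zero_right)
    hence "c mod m = 0" using mmin[of "c mod m"] degree_mod_less[of m c] m by (fastforce simp: V_def)
    thus ?thesis by (simp add: dvd_eq_mod_eq_0)
  qed
  have mdeg: "Polynomial.degree m > 0"
  proof (rule ccontr)
    assume "\<not> Polynomial.degree m > 0"
    then obtain c where "m = [:c:]" by (auto elim: degree_eq_zeroE)
    thus False using m by (auto simp: V_def ac.eval_hom_const)
  qed
  obtain s where s: "g = m * s" using mdvd[OF z] by blast
  have s0: "s \<noteq> 0" "m \<noteq> 0" using s g by (auto simp: Q_def)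
  have "io s \<notin> M"
  proof
    assume "io s \<in> M"
    hence "Polynomial.degree g \<le> Polynomial.degree s" using s0 gmin by (simp add: Q_def)
    thus False using s mdeg s0 by (simp add: degree_mult_eq)
  qed
  moreover have "io m * io s \<in> M" using g s by (simp add: Q_def io.mult)
  ultimately have mM: "io m \<in> M" using prm A_io by blast
  have vM: "io c \<in> M" if "eval_hom to_ac z c = 0" for c
    using mdvd[OF that] A_ideal_mult[OF I mM A_io] by (auto simp: io.mult)
  have "\<exists>w. w ^ q = fa z \<and> (\<forall>u\<in>M. ev (z, w) u = 0)"
  proof (rule ccontr)
    assume "\<not> (\<exists>w. w ^ q = fa z \<and> (\<forall>u\<in>M. ev (z, w) u = 0))"
    then obtain h where h: "\<And>w. w ^ q = fa z \<Longrightarrow> h w \<in> M \<and> ev (z, w) (h w) \<noteq> 0" by metis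
    define B where "B = {w. w ^ q = fa z}"
    have finB: "finite B" unfolding B_def by (rule finite_qth_roots)
    have pB: "(z, w) \<in> pts" if "w \<in> B" for w using that by (simp add: B_def pts_def)
    have hA: "h w \<in> A" if "w \<in> B" for w using h MA that by (auto simp: B_def)
    define N where "N w = p ^ line.per (ev (z, w) (h w)) - 1" for w
    have N: "ev (z, w) (h w) ^ N w = 1 \<and> N w > 0" if "w \<in> B" for w
    proof -
      let ?v = "ev (z, w) (h w)"
      have "?v ^ p ^ line.per ?v = ?v" by (simp flip: line_per_dvd)
      hence "?v ^ N w * ?v = ?v" unfolding N_def using power_p_minus_1 by metis
      moreover have "p ^ line.per ?v > 1" using p_gt_1 line.per_pos by (intro one_less_power)
      ultimately show ?thesis using h that by (auto simp: N_def B_def)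
    qed
    define v where "v = (\<Prod>w\<in>B. 1 - h w ^ N w)"
    have vA: "v \<in> A" unfolding v_def by (intro A_prod A_diff A_1 A_power hA)
    have ev0: "ev (z, w) v = 0" if w: "w \<in> B" for w
    proof -
      have "ev (z, w) v = (\<Prod>w'\<in>B. ev (z, w) (1 - h w' ^ N w'))"
        unfolding v_def using pB[OF w] hA by (intro ev_prod A_diff A_1 A_power)
      moreover have "ev (z, w) (1 - h w ^ N w) = 0"
        using pB[OF w] hA[OF w] N[OF w] by (simp add: ev_diff ev_1 ev_power A_1 A_power)
      ultimately show ?thesis using finB w by (auto intro: prod_zero)
    qed
    have "v \<in> M"
    proof (cases "fa z = 0")
      case False
      have "io (poly.coeff (rep v) j) \<in> M" if "j < q" for j
        using coeffs_vanish[OF vA False _ that] ev0 by (intro vM) (auto simp: B_def)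
      hence "(\<Sum>j<q. io (poly.coeff (rep v) j) * y ^ j) \<in> M"
        by (intro A_ideal_sum[OF I] A_ideal_mult[OF I] A_power A_y) auto
      thus ?thesis using A_sum[OF vA] by simp
    next
      \<comment> \<open>Over a branch point the only value is \<open>w = 0\<close>, too few for the
        coefficient argument. Instead \<open>y^q = fpoly\<close> lies in \<open>M\<close>, hence so
        does \<open>y\<close>, and only the coefficient of \<open>y^0\<close> remains.\<close>
      case True
      have "0 \<in> B" using True q_pos by (simp add: B_def)
      have q: "{..<q} = insert 0 {1..<q}" using q_pos by auto
      have s: "(\<Sum>j<q. g j) = g 0 + (\<Sum>j\<in>{1..<q}. g j)" for g :: "nat \<Rightarrow> 'c :: comm_monoid_add" unfolding q by simp
      have "ev (z, 0) v = eval_hom to_ac z (poly.coeff (rep v) 0)"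
        using ev_sum[OF pB[OF \<open>0 \<in> B\<close>] vA] q_pos by (simp add: s)
      hence c0: "io (poly.coeff (rep v) 0) \<in> M" using ev0[OF \<open>0 \<in> B\<close>] by (intro vM) simp
      have "io fpoly \<in> M" using True by (intro vM) (simp add: eval_fpoly)
      moreover have "y ^ q = io fpoly" using evA_rel
        by (simp add: rel_def evA.diff evA_const) (simp add: evA_def io.eval_hom_monom io.one)
      ultimately have "y \<in> M" using A_prime_power[OF M A_y, of q] by simp
      have "io (poly.coeff (rep v) j) * y ^ j \<in> M" if "j \<in> {1..<q}" for j
      proof -
        have "y ^ j = y * y ^ (j - 1)" using that by (cases j) auto
        thus ?thesis using A_ideal_mult[OF I \<open>y \<in> M\<close>] A_ideal_mult'[OF I] A_power A_y A_io by simp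
      qed
      hence "(\<Sum>j\<in>{1..<q}. io (poly.coeff (rep v) j) * y ^ j) \<in> M" by (intro A_ideal_sum[OF I])
      with c0 have "(\<Sum>j<q. io (poly.coeff (rep v) j) * y ^ j) \<in> M"
        using I unfolding s A_ideal_def by simp
      thus ?thesis using A_sum[OF vA] by simp
    qed
    then obtain w where w: "w \<in> B" "1 - h w ^ N w \<in> M"
      using A_prime_prod[OF M, of B "\<lambda>w. 1 - h w ^ N w"] hA A_diff A_1 A_power unfolding v_def by blast
    have "h w ^ N w = h w * h w ^ (N w - 1)" using N[OF w(1)] by (metis Suc_diff_1 power_Suc)
    hence "h w ^ N w \<in> M" using A_ideal_mult[OF I _ A_power[OF hA[OF w(1)]]] h w(1) by (simp add: B_def)
    hence "1 - h w ^ N w + h w ^ N w \<in> M" using I w(2) unfolding A_ideal_def by blast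
    thus False using M1 by simp
  qed
  then obtain w where w: "w ^ q = fa z" "\<And>u. u \<in> M \<Longrightarrow> ev (z, w) u = 0" by blast
  have P: "(z, w) \<in> pts" using w by (simp add: pts_def)
  show ?thesis
  proof (rule that[OF P], intro equalityI subsetI)
    fix u assume "u \<in> M" thus "u \<in> {u \<in> A. ev (z, w) u = 0}" using w MA by auto
  next
    fix u assume "u \<in> {u \<in> A. ev (z, w) u = 0}"
    hence u: "u \<in> A" "ev (z, w) u = 0" by auto
    \<comment> \<open>For the converse inclusion, \<open>u^i * (1 - u^(j - i))\<close> lies in
      \<open>M\<close>, and the second factor has value 1 at the point, so \<open>u\<close> lies in
      \<open>M\<close>.\<close>
    obtain i j where ij: "i < j" "u ^ i - u ^ j \<in> M" using pd[OF u(1)] by blast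
    have "u ^ i * (1 - u ^ (j - i)) = u ^ i - u ^ j" using ij(1) by (simp add: algebra_simps flip: power_add)
    hence "u ^ i \<in> M \<or> 1 - u ^ (j - i) \<in> M" using ij(2) prm[of "u ^ i" "1 - u ^ (j - i)"] u(1) by (simp add: A_power A_diff A_1)
    moreover have "1 - u ^ (j - i) \<notin> M"
    proof
      assume "1 - u ^ (j - i) \<in> M"
      hence "ev (z, w) (1 - u ^ (j - i)) = 0" by (rule w(2))
      thus False using P u ij(1) by (simp add: ev_diff ev_1 ev_power A_1 A_power power_0_left)
    qed
    ultimately show "u \<in> M" using A_prime_power[OF M u(1)] by blast
  qed
qed

end

section \<open>Valuation rings\<close>

text \<open>A uniformizer is part of the data: factorisations by a fixed one are what must be
  exhibited to evaluate the definite description in \<open>place_val\<close>.\<close>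

locale dvr =
  fixes K R :: "'b :: field set" and t :: 'b
  assumes K: "is_subfield K" and R_sub: "R \<subseteq> K" and one: "1 \<in> R"
    and add: "u \<in> R \<Longrightarrow> v \<in> R \<Longrightarrow> u + v \<in> R" and diff: "u \<in> R \<Longrightarrow> v \<in> R \<Longrightarrow> u - v \<in> R"
    and mult: "u \<in> R \<Longrightarrow> v \<in> R \<Longrightarrow> u * v \<in> R"
    and t: "t \<in> R" "t \<noteq> 0" "inverse t \<notin> R"
    and factor: "z \<in> K \<Longrightarrow> z \<noteq> 0 \<Longrightarrow> \<exists>n :: int. \<exists>u. u \<noteq> 0 \<and> u \<in> R \<and> inverse u \<in> R \<and> z = t powi n * u"
begin

definition unit :: "'b \<Rightarrow> bool" where "unit u \<longleftrightarrow> u \<noteq> 0 \<and> u \<in> R \<and> inverse u \<in> R"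

lemma unit_mult: "unit u \<Longrightarrow> unit v \<Longrightarrow> unit (u * v)"
  by (auto simp: unit_def mult)

lemma unit_inverse: "unit u \<Longrightarrow> unit (inverse u)"
  by (auto simp: unit_def)

lemma unit_1: "unit 1"
  by (simp add: unit_def one)

lemma unit_power: "unit u \<Longrightarrow> unit (u ^ n)"
  by (induction n) (auto simp: unit_1 unit_mult)

lemma unit_powi: "unit u \<Longrightarrow> unit (u powi n)"
  by (auto simp: power_int_def unit_power unit_inverse)

lemma R_power: "u \<in> R \<Longrightarrow> u ^ n \<in> R"
  by (induction n) (auto simp: one mult)

lemma zero: "0 \<in> R"
  using diff[OF one one] by simp

lemma powi_unit_in_R_iff:
  assumes "unit u" shows "t powi n * u \<in> R \<longleftrightarrow> n \<ge> 0"
proof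
  assume "n \<ge> 0"
  thus "t powi n * u \<in> R" using assms t R_power by (auto simp: power_int_def unit_def intro!: mult)
next
  assume *: "t powi n * u \<in> R"
  show "n \<ge> 0"
  proof (rule ccontr)
    assume n: "\<not> n \<ge> 0"
    have "t powi n * u * inverse u * t ^ nat (- n - 1) \<in> R"
      using assms by (intro mult[OF mult[OF *]] R_power t(1)) (auto simp: unit_def)
    also have "t powi n * u * inverse u * t ^ nat (- n - 1) = t powi n * t powi (- n - 1)"
      using assms n by (simp add: unit_def power_int_def)
    also have "\<dots> = t powi (n + (- n - 1))" using t(2) by (subst power_int_add) auto
    also have "\<dots> = inverse t" by simp
    finally show False using t(3) by simp
  qed
qed

lemma powi_unit_unique:
  assumes "unit u" "unit v" "t powi n * u = t powi m * v" shows "n = m"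
proof -
  have le: "m' \<le> n'" if "unit u'" "unit v'" "t powi n' * u' = t powi m' * v'" for n' m' u' v'
  proof -
    have "t powi (n' - m') * (u' * inverse v') = 1"
      using that t(2) by (simp add: power_int_diff unit_def field_simps)
    hence "t powi (n' - m') * (u' * inverse v') \<in> R" using one by simp
    thus ?thesis using powi_unit_in_R_iff[of "u' * inverse v'" "n' - m'"] that by (simp add: unit_mult unit_inverse)
  qed
  show ?thesis using le[OF assms] le[OF assms(2,1) assms(3)[symmetric]] by simp
qed

lemma inverse_powi_unit: "inverse (t powi n * u) = t powi (- n) * inverse u"
  by (simp add: power_int_minus)

lemma max_ideal_iff:
  assumes "unit u" shows "t powi n * u \<in> max_ideal R \<longleftrightarrow> n \<ge> 1"
proof -
  have "t powi n * u \<noteq> 0" using assms t by (simp add: unit_def)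
  moreover have "inverse (t powi n * u) \<in> R \<longleftrightarrow> n \<le> 0"
    unfolding inverse_powi_unit using powi_unit_in_R_iff[OF unit_inverse[OF assms], of "- n"] by simp
  ultimately show ?thesis using powi_unit_in_R_iff[OF assms, of n] by (auto simp: max_ideal_def)
qed

lemma max_ideal_eq: "max_ideal R = (\<lambda>z. t * z) ` R"
proof (intro equalityI subsetI)
  fix z assume z: "z \<in> max_ideal R"
  show "z \<in> (\<lambda>z. t * z) ` R"
  proof (cases "z = 0")
    case True thus ?thesis using zero by (intro image_eqI[of _ _ 0]) auto
  next
    case False
    then obtain n u where nu: "unit u" "z = t powi n * u"
      using factor[of z] z R_sub by (auto simp: max_ideal_def unit_def)
    hence "n \<ge> 1" using z max_ideal_iff by simp
    hence "t powi (n - 1) * u \<in> R" using powi_unit_in_R_iff[OF nu(1)] by simp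
    moreover have "z = t * (t powi (n - 1) * u)" using nu t(2) by (simp add: power_int_diff)
    ultimately show ?thesis by blast
  qed
next
  fix z assume "z \<in> (\<lambda>z. t * z) ` R"
  then obtain r where r: "r \<in> R" "z = t * r" by blast
  show "z \<in> max_ideal R"
  proof (cases "r = 0")
    case True thus ?thesis using r zero by (simp add: max_ideal_def)
  next
    case False
    then obtain n u where nu: "unit u" "r = t powi n * u" using factor[of r] r R_sub by (auto simp: unit_def)
    hence "n \<ge> 0" using r powi_unit_in_R_iff by simp
    moreover have "z = t powi (n + 1) * u" using nu r t(2) by (simp add: power_int_add)
    ultimately show ?thesis using max_ideal_iff[OF nu(1)] by simp
  qed
qed

text \<open>Another generator of the maximal ideal differs from \<open>t\<close> by a unit, which is
  absorbed, so the exponent does not depend on it.\<close>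

lemma val_eq:
  assumes "unit u" shows "place_val R (t powi n * u) = n"
  unfolding place_val_def
proof (rule the_equality)
  show "\<exists>t' u'. max_ideal R = (\<lambda>z. t' * z) ` R \<and> u' \<noteq> 0 \<and> u' \<in> R \<and> inverse u' \<in> R \<and> t powi n * u = t' powi n * u'"
    using assms max_ideal_eq by (auto simp: unit_def)
next
  fix m assume "\<exists>t' u'. max_ideal R = (\<lambda>z. t' * z) ` R \<and> u' \<noteq> 0 \<and> u' \<in> R \<and> inverse u' \<in> R \<and> t powi n * u = t' powi m * u'"
  then obtain t' u' where t': "(\<lambda>z. t * z) ` R = (\<lambda>z. t' * z) ` R" and u': "unit u'" and e: "t powi n * u = t' powi m * u'"
    unfolding max_ideal_eq by (auto simp: unit_def)
  have "t' * 1 \<in> (\<lambda>z. t * z) ` R" "t * 1 \<in> (\<lambda>z. t' * z) ` R" using t' one by blast+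
  then obtain r r' where r: "r \<in> R" "t' = t * r" "r' \<in> R" "t = t' * r'" unfolding mult_1_right by blast
  hence "t * (r * r') = t * 1" by (simp flip: mult.assoc)
  hence rr: "r * r' = 1" using t(2) by (metis mult_left_cancel)
  hence "inverse r = r'" by (rule inverse_unique)
  hence "unit r" using r rr by (auto simp: unit_def)
  have "t powi n * u = t powi m * (r powi m * u')" using e r(2) by (simp add: power_int_mult_distrib mult.assoc)
  thus "m = n" using powi_unit_unique[OF assms, of "r powi m * u'" n m] unit_mult[OF unit_powi[OF \<open>unit r\<close>] u'] by simp
qed

abbreviation val :: "'b \<Rightarrow> int" where "val \<equiv> place_val R"

lemma val_factor: "z \<in> K \<Longrightarrow> z \<noteq> 0 \<Longrightarrow> \<exists>u. unit u \<and> z = t powi val z * u"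
  using factor[of z] val_eq by (metis unit_def)

lemma val_mult: "z \<in> K \<Longrightarrow> w \<in> K \<Longrightarrow> z \<noteq> 0 \<Longrightarrow> w \<noteq> 0 \<Longrightarrow> val (z * w) = val z + val w"
proof -
  assume "z \<in> K" "w \<in> K" "z \<noteq> 0" "w \<noteq> 0"
  then obtain u v where uv: "unit u" "z = t powi val z * u" "unit v" "w = t powi val w * v" using val_factor by blast
  have "t powi val z * u * (t powi val w * v) = t powi (val z + val w) * (u * v)"
    using t(2) by (simp add: power_int_add)
  hence "z * w = t powi (val z + val w) * (u * v)" using uv(2,4) by simp
  thus ?thesis using val_eq[OF unit_mult[OF uv(1,3)]] by metis
qed

lemma val_inverse: "z \<in> K \<Longrightarrow> z \<noteq> 0 \<Longrightarrow> val (inverse z) = - val z"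
proof -
  assume "z \<in> K" "z \<noteq> 0"
  then obtain u where u: "unit u" "z = t powi val z * u" using val_factor by blast
  have "inverse z = t powi (- val z) * inverse u" using inverse_powi_unit u(2) by metis
  thus ?thesis using val_eq[OF unit_inverse[OF u(1)]] by metis
qed

lemma in_R_iff: "z \<in> K \<Longrightarrow> z \<noteq> 0 \<Longrightarrow> z \<in> R \<longleftrightarrow> val z \<ge> 0"
  using val_factor[of z] powi_unit_in_R_iff by metis

lemma in_max_ideal_iff: "z \<in> K \<Longrightarrow> z \<noteq> 0 \<Longrightarrow> z \<in> max_ideal R \<longleftrightarrow> val z \<ge> 1"
  using val_factor[of z] max_ideal_iff by metis

lemma val_1: "val 1 = 0"
  using val_eq[OF unit_1, of 0] by simp

lemma val_t: "val t = 1"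
  using val_eq[OF unit_1, of 1] by simp

lemma val_power: "z \<in> K \<Longrightarrow> z \<noteq> 0 \<Longrightarrow> val (z ^ n) = int n * val z"
proof (induction n)
  case (Suc n)
  have "z ^ n \<in> K" using K Suc.prems by (induction n) (auto simp: is_subfield_def)
  thus ?case using Suc by (simp add: val_mult algebra_simps)
qed (simp add: val_1)

lemma valuation_ring: "z \<in> K \<Longrightarrow> z \<in> R \<or> inverse z \<in> R"
proof (cases "z = 0")
  case False
  moreover assume "z \<in> K"
  ultimately show ?thesis using in_R_iff[of z] in_R_iff[of "inverse z"] val_inverse[of z] K by (auto simp: is_subfield_def)
qed (simp add: zero)

lemma R_proper: "R \<noteq> K"
  using t R_sub K by (auto simp: is_subfield_def)

text \<open>An element outside \<open>R\<close> has negative value, so together with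
  \<open>R\<close> it produces \<open>inverse t\<close> and then all of \<open>K\<close>. Because of
  this, a place is identified by an inclusion alone.\<close>

lemma maximal:
  assumes "R \<subseteq> R'" "R' \<subseteq> K" "R' \<noteq> K" and m: "\<And>u v. u \<in> R' \<Longrightarrow> v \<in> R' \<Longrightarrow> u * v \<in> R'"
  shows "R' = R"
proof (rule ccontr)
  assume "R' \<noteq> R"
  then obtain z where z: "z \<in> R'" "z \<notin> R" using assms by blast
  have z0: "z \<noteq> 0" using z zero by auto
  have zK: "z \<in> K" using z assms by blast
  then obtain u where u: "unit u" "z = t powi val z * u" using val_factor z0 by blast
  have neg: "val z < 0" using in_R_iff[OF zK z0] z by simp
  have "z * inverse u * t ^ nat (- val z - 1) \<in> R'"
    using assms(1) z u R_power[OF t(1)] by (intro m) (auto simp: unit_def)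
  also have "z * inverse u * t ^ nat (- val z - 1) = t powi val z * t powi (- val z - 1)"
  proof -
    have "z * inverse u = t powi val z * (u * inverse u)" using u(2) by (metis mult.assoc)
    moreover have "u * inverse u = 1" using u(1) by (simp add: unit_def)
    moreover have "t powi (- val z - 1) = t ^ nat (- val z - 1)" using neg by (simp add: power_int_def)
    ultimately show ?thesis by simp
  qed
  also have "\<dots> = t powi (val z + (- val z - 1))" using t(2) by (subst power_int_add) auto
  finally have ti: "inverse t \<in> R'" by simp
  have "K \<subseteq> R'"
  proof
    fix w assume w: "w \<in> K"
    show "w \<in> R'"
    proof (cases "w = 0")
      case True thus ?thesis using zero assms by auto
    next
      case False
      then obtain v where v: "unit v" "w = t powi val w * v" using val_factor w by blast
      have "x ^ n \<in> R'" if "x \<in> R'" for x n using that one assms by (induction n) (auto intro: m)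
      hence "t powi val w \<in> R'" using ti t(1) assms(1) by (auto simp: power_int_def)
      thus ?thesis using v assms(1) m by (metis subsetD unit_def)
    qed
  qed
  thus False using assms by blast
qed

end

context superelliptic
begin

section \<open>The function field and the local rings of the affine points\<close>

definition K :: "'k ambient set" where "K = curve_field y"

lemma K_eq: "K = {u / w |u w. u \<in> A \<and> w \<in> A \<and> w \<noteq> 0}"
proof -
  define F where "F = {u / w |u w. u \<in> A \<and> w \<in> A \<and> w \<noteq> 0}"
  have sub: "is_subfield F"
  proof -
    have "0 / 1 \<in> F" "1 / 1 \<in> F" using A_0 A_1 one_neq_zero unfolding F_def by blast+
    hence "0 \<in> F" "1 \<in> F" by simp_all
    moreover have "u + v \<in> F \<and> u - v \<in> F \<and> u * v \<in> F" if uv: "u \<in> F" "v \<in> F" for u v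
    proof -
      obtain a b c d where *: "u = a / b" "v = c / d" "a \<in> A" "b \<in> A" "b \<noteq> 0" "c \<in> A" "d \<in> A" "d \<noteq> 0"
        using uv by (auto simp: F_def)
      have "u + v = (a * d + c * b) / (b * d)" "u - v = (a * d - c * b) / (b * d)" "u * v = (a * c) / (b * d)"
        using * by (auto simp: field_simps)
      moreover have "a * d + c * b \<in> A" "a * d - c * b \<in> A" "a * c \<in> A" "b * d \<in> A" "b * d \<noteq> 0"
        using * by (auto intro: A_add A_diff A_mult)
      ultimately show ?thesis unfolding F_def by blast
    qed
    moreover have "inverse u \<in> F" if u: "u \<in> F" for u
    proof (cases "u = 0")
      case True thus ?thesis using u by simp
    next
      case False
      obtain a b where *: "u = a / b" "a \<in> A" "b \<in> A" "b \<noteq> 0" using u by (auto simp: F_def)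
      hence "inverse u = b / a" "a \<noteq> 0" using False by auto
      thus ?thesis using * unfolding F_def by blast
    qed
    ultimately show ?thesis by (simp add: is_subfield_def)
  qed
  have AF: "A \<subseteq> F" unfolding F_def using A_1 by (force intro: exI[of _ 1])
  hence "range const \<union> {var_x, y} \<subseteq> F" using A_const A_x A_y by blast
  hence "K \<subseteq> F" unfolding K_def curve_field_def using sub by (rule hull_minimal)
  moreover have "F \<subseteq> K"
  proof -
    have sf: "is_subfield K"
      unfolding K_def curve_field_def hull_def by (auto simp: is_subfield_def)
    have gen: "range const \<union> {var_x, y} \<subseteq> K" unfolding K_def curve_field_def by (rule hull_subset)
    have AK: "u \<in> K" if "u \<in> A" for u
      using that by (induction u rule: A_induct) (use sf gen in \<open>auto simp: is_subfield_def\<close>)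
    show ?thesis
    proof
      fix z assume "z \<in> F"
      then obtain u w where "z = u / w" "u \<in> A" "w \<in> A" by (auto simp: F_def)
      thus "z \<in> K" using AK[of u] AK[of w] \<open>is_subfield K\<close> by (simp add: is_subfield_def divide_inverse)
    qed
  qed
  ultimately show ?thesis by (simp add: F_def)
qed

lemma K_field: "is_subfield K"
  unfolding K_def curve_field_def hull_def by (auto simp: is_subfield_def)

lemma A_sub_K: "A \<subseteq> K"
  unfolding K_eq using A_1 by (force intro: exI[of _ 1])

lemma K_divide: "u \<in> A \<Longrightarrow> w \<in> A \<Longrightarrow> u / w \<in> K"
  using A_sub_K K_field by (auto simp: is_subfield_def divide_inverse)

lemma char_ambient: "CHAR('k ambient) = p"
proof (rule CHAR_eqI)
  have c: "of_nat n = (const (of_nat n) :: 'k ambient)" for n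
    by (induction n) (auto simp: const.zero const.one const.add)
  show "of_nat p = (0 :: 'k ambient)" unfolding c using char_k by (metis const.zero of_nat_CHAR)
  show "p dvd n" if "of_nat n = (0 :: 'k ambient)" for n
    using that unfolding c const_eq_0_iff by (simp add: of_nat_eq_0_iff_char_dvd char_k)
qed

definition loc :: "'k alg_closure \<times> 'k alg_closure \<Rightarrow> 'k ambient set" where
  "loc P = {u / w |u w. u \<in> A \<and> w \<in> A \<and> ev P w \<noteq> 0}"

lemma loc_K: "P \<in> pts \<Longrightarrow> loc P \<subseteq> K"
  unfolding loc_def K_eq using ev_0 by blast

lemma loc_ring:
  assumes P: "P \<in> pts" and "u \<in> loc P" "v \<in> loc P"
  shows "u + v \<in> loc P" "u - v \<in> loc P" "u * v \<in> loc P"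
proof -
  obtain a b c d where *: "u = a / b" "v = c / d" "a \<in> A" "b \<in> A" "ev P b \<noteq> 0" "c \<in> A" "d \<in> A" "ev P d \<noteq> 0"
    using assms by (auto simp: loc_def)
  have "b \<noteq> 0" "d \<noteq> 0" using * ev_0[OF P] by auto
  hence "u + v = (a * d + c * b) / (b * d)" "u - v = (a * d - c * b) / (b * d)" "u * v = (a * c) / (b * d)"
    using * by (auto simp: field_simps)
  moreover have "a * d + c * b \<in> A" "a * d - c * b \<in> A" "a * c \<in> A" "b * d \<in> A" "ev P (b * d) \<noteq> 0"
    using * P by (auto intro: A_add A_diff A_mult simp: ev_mult)
  ultimately show "u + v \<in> loc P" "u - v \<in> loc P" "u * v \<in> loc P" unfolding loc_def by blast+
qed

lemma A_sub_loc: "P \<in> pts \<Longrightarrow> A \<subseteq> loc P"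
proof
  fix u assume "P \<in> pts" "u \<in> A"
  hence "u = u / 1 \<and> u \<in> A \<and> 1 \<in> A \<and> ev P 1 \<noteq> 0" by (simp add: A_1 ev_1)
  thus "u \<in> loc P" unfolding loc_def by blast
qed

lemma loc_divide: "P \<in> pts \<Longrightarrow> u \<in> loc P \<Longrightarrow> w \<in> A \<Longrightarrow> ev P w \<noteq> 0 \<Longrightarrow> u / w \<in> loc P"
proof -
  assume *: "P \<in> pts" "u \<in> loc P" "w \<in> A" "ev P w \<noteq> 0"
  hence "1 / w \<in> loc P" using A_1 unfolding loc_def by blast
  thus ?thesis using loc_ring(3)[OF *(1,2), of "1 / w"] by simp
qed

text \<open>The functions that the \<open>N\<close>-th Frobenius power fixes modulo \<open>t\<close>
  form a ring containing the constants, so it suffices to test the two generators.\<close>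

lemma frobenius_mod_uniformizer:
  assumes P: "P \<in> pts" and t: "t \<in> A"
    and x: "\<exists>r\<in>loc P. var_x ^ p ^ N - var_x = t * r" and y: "\<exists>r\<in>loc P. y ^ p ^ N - y = t * r"
    and u: "u \<in> A"
  shows "\<exists>r\<in>loc P. u ^ p ^ N - u = t * r"
  using u
proof (induction u rule: A_induct)
  case (const c)
  have "const c ^ p ^ N = const c" by (simp add: k_power flip: const.power)
  thus ?case using A_sub_loc[OF P] A_0 by (intro bexI[of _ 0]) auto
next
  case (add u v)
  then obtain r s where rs: "r \<in> loc P" "s \<in> loc P" "u ^ p ^ N - u = t * r" "v ^ p ^ N - v = t * s" by blast
  have "(u + v) ^ p ^ N - (u + v) = t * (r + s)"
    using rs by (simp add: power_add_char[OF char_ambient] algebra_simps)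
  thus ?case using rs loc_ring[OF P] by blast
next
  case (mult u v)
  then obtain r s where rs: "r \<in> loc P" "s \<in> loc P" "u ^ p ^ N - u = t * r" "v ^ p ^ N - v = t * s" by blast
  have "(u * v) ^ p ^ N - u * v = u ^ p ^ N * (v ^ p ^ N - v) + v * (u ^ p ^ N - u)"
    by (simp add: power_mult_distrib algebra_simps)
  also have "\<dots> = t * (u ^ p ^ N * s + v * r)" using rs by (simp add: algebra_simps)
  finally show ?case using rs mult A_power A_sub_loc[OF P] loc_ring[OF P] by (metis subsetD)
qed (use x y in auto)

lemma frobenius_difference_x:
  assumes "N > 0" shows "var_x ^ p ^ N - var_x \<noteq> (0 :: 'k ambient)"
proof
  assume "var_x ^ p ^ N - var_x = (0 :: 'k ambient)"
  hence "io (Polynomial.monom 1 (p ^ N) - Polynomial.monom 1 1) = 0"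
    by (simp add: io.diff io_monom const.one)
  hence "Polynomial.monom 1 (p ^ N) = (Polynomial.monom 1 1 :: 'k poly)" by (simp add: io_eq_0_iff)
  hence "p ^ N = 1" by (metis degree_monom_eq one_neq_zero)
  moreover have "p ^ N > 1" using assms p_gt_1 by (intro one_less_power)
  ultimately show False by (metis less_irrefl)
qed

text \<open>
  Away from the branch points \<open>x^(p^N) - x\<close> is a uniformizer for suitable \<open>N\<close>; at a branch point \<open>y\<close> is one.
\<close>

lemma uniformizer_exists:
  assumes P: "P \<in> pts"
  shows "\<exists>t N. t \<in> A \<and> t \<noteq> 0 \<and> N > 0 \<and> ev P t = 0 \<and> (\<exists>r\<in>loc P. var_x ^ p ^ N - var_x = t * r)
    \<and> (\<exists>r\<in>loc P. y ^ p ^ N - y = t * r)"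
proof (cases "snd P = 0")
  case False
  \<comment> \<open>With the period of \<open>P\<close> as \<open>N\<close>, Frobenius returns to
    \<open>P\<close>, and \<open>var_x ^ p ^ N - var_x\<close> vanishes there.\<close>
  define N where "N = curve.per P"
  define t :: "'k ambient" where "t = var_x ^ p ^ N - var_x"
  have N: "N > 0" unfolding N_def by (rule curve.per_pos)
  have fixed: "fst P ^ p ^ N = fst P" "snd P ^ p ^ N = snd P"
    using curve_per_dvd[of "fst P" "snd P" N] by (auto simp: N_def)
  have tA: "t \<in> A" unfolding t_def by (intro A_diff A_power A_x)
  have evt: "ev P t = 0" unfolding t_def using P fixed by (simp add: ev_diff ev_power ev_x A_power A_x)
  define s where "s = y ^ (p ^ N - 1)"
  have sA: "s \<in> A" unfolding s_def by (intro A_power A_y)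
  have s: "y ^ p ^ N = s * y"
  proof -
    have "p ^ N = Suc (p ^ N - 1)" using p_pos by simp
    thus ?thesis unfolding s_def by (metis power_Suc2)
  qed
  have "ev P s * snd P = snd P" using arg_cong[OF s, of "ev P"] P fixed sA by (simp add: ev_power ev_mult ev_y A_y)
  hence evs: "ev P s = 1" using False by simp
  \<comment> \<open>At \<open>P\<close> the function \<open>s\<close> has value 1, so
    \<open>S\<close> has value \<open>q\<close>, which is nonzero in characteristic
    \<open>p\<close>.\<close>
  define S where "S = (\<Sum>i<q. s ^ i)"
  have SA: "(\<Sum>i\<in>I. s ^ i) \<in> A" for I :: "nat set"
    by (induction I rule: infinite_finite_induct) (auto simp: A_0 A_add A_power sA)
  have "ev P (\<Sum>i\<in>I. s ^ i) = of_nat (card I)" if "finite I" for I :: "nat set"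
    using that by (induction I rule: finite_induct) (simp_all add: ev_0 ev_add P SA A_power sA ev_power evs)
  hence evS: "ev P S \<noteq> 0" using p_not_dvd_q by (simp add: S_def of_nat_ac_eq_0_iff)
  \<comment> \<open>Frobenius applied to the curve equation; the constant \<open>a\<close> drops
    out. The left side is \<open>y^q * (s - 1) * S\<close>, whose factors other than
    \<open>s - 1\<close> do not vanish at \<open>P\<close>, so \<open>s - 1\<close> is a multiple of
    \<open>t\<close>.\<close>
  have "(y ^ q) ^ p ^ N - y ^ q = t ^ p - t"
  proof -
    have "(y ^ q) ^ p ^ N = (var_x ^ p) ^ p ^ N - var_x ^ p ^ N + const a ^ p ^ N"
      unfolding y_eq by (simp add: power_add_char[OF char_ambient] power_diff_char[OF char_ambient])
    moreover have "const a ^ p ^ N = (const a :: 'k ambient)" by (simp add: k_power flip: const.power)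
    moreover have "t ^ p = (var_x ^ p ^ N) ^ p - var_x ^ p"
      unfolding t_def using power_diff_char[OF char_ambient, of _ _ 1] by simp
    moreover have "(var_x ^ p) ^ p ^ N = (var_x ^ p ^ N) ^ p" by (simp add: mult.commute flip: power_mult)
    ultimately show ?thesis unfolding y_eq t_def by (simp add: algebra_simps)
  qed
  moreover have "(y ^ q) ^ p ^ N = y ^ q * s ^ q"
  proof -
    have "(y ^ q) ^ p ^ N = (y ^ p ^ N) ^ q" by (simp add: mult.commute flip: power_mult)
    thus ?thesis by (simp add: s power_mult_distrib mult.commute)
  qed
  moreover have "t ^ p = t * t ^ (p - 1)" using p_pos by (metis Suc_diff_1 power_Suc)
  moreover have "s ^ q - 1 = (s - 1) * S" unfolding S_def by (rule power_diff_1_eq)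
  ultimately have "y ^ q * ((s - 1) * S) = t * (t ^ (p - 1) - 1)" by (metis mult_1_right right_diff_distrib)
  hence "y ^ q * S * (s - 1) = t * (t ^ (p - 1) - 1)" by (simp only: mult_ac)
  moreover have nz: "y ^ q * S \<noteq> 0" using evS ev_0[OF P] y_nonzero by auto
  ultimately have "s - 1 = t * ((t ^ (p - 1) - 1) / (y ^ q * S))" by (simp add: field_simps)
  moreover have "y ^ p ^ N - y = y * (s - 1)" by (simp add: s algebra_simps)
  ultimately have "y ^ p ^ N - y = t * (y * ((t ^ (p - 1) - 1) / (y ^ q * S)))" by (simp only: mult_ac)
  moreover have "y * ((t ^ (p - 1) - 1) / (y ^ q * S)) \<in> loc P"
  proof -
    have "ev P (y ^ q * S) \<noteq> 0" using evS False P SA A_power A_y by (simp add: ev_mult ev_power ev_y S_def)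
    hence "(t ^ (p - 1) - 1) / (y ^ q * S) \<in> loc P"
      using A_sub_loc[OF P] A_power A_y SA tA A_diff A_1 A_mult by (intro loc_divide[OF P]) (auto simp: S_def)
    thus ?thesis using A_sub_loc[OF P] A_y by (intro loc_ring[OF P]) auto
  qed
  moreover have "\<exists>r\<in>loc P. var_x ^ p ^ N - var_x = t * r"
    using A_1 A_sub_loc[OF P] by (intro bexI[of _ 1]) (auto simp: t_def)
  ultimately show ?thesis using tA N evt frobenius_difference_x[OF N] unfolding t_def by blast
next
  case True
  \<comment> \<open>Modulo \<open>y\<close> the equation reads \<open>x^p = x - a\<close>, so each
    Frobenius step subtracts \<open>a\<close>, and after \<open>p\<close> steps the total
    \<open>p * a\<close> vanishes.\<close>
  have "\<exists>v\<in>A. var_x ^ p ^ n = var_x - of_nat n * const a + y * v" for n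
  proof (induction n)
    case 0 show ?case using A_0 by (intro bexI[of _ 0]) auto
  next
    case (Suc n)
    then obtain v where v: "v \<in> A" "var_x ^ p ^ n = var_x - of_nat n * const a + y * v" by blast
    have "var_x ^ p ^ Suc n = (var_x ^ p ^ n) ^ p ^ 1" by (simp add: mult.commute flip: power_mult)
    also have "\<dots> = (var_x - of_nat n * const a + y * v) ^ p ^ 1" unfolding v(2) ..
    also have "\<dots> = var_x ^ p - of_nat n ^ p * const a ^ p + y ^ p * v ^ p"
      unfolding power_add_char[OF char_ambient] power_diff_char[OF char_ambient] by (simp add: power_mult_distrib)
    also have "const a ^ p = (const a :: 'k ambient)" by (simp add: k_power_p flip: const.power)
    also have "of_nat n ^ p = (of_nat n :: 'k ambient)"
    proof -
      have c: "of_nat n = (const (of_nat n) :: 'k ambient)"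
        by (induction n) (auto simp: const.zero const.one const.add)
      thus ?thesis by (simp only: c k_power_p flip: const.power)
    qed
    also have "var_x ^ p = var_x - const a + y ^ q" by (simp add: y_eq)
    also have "var_x - const a + y ^ q - of_nat n * const a + y ^ p * v ^ p
        = var_x - of_nat (Suc n) * const a + y * (y ^ (q - 1) + y ^ (p - 1) * v ^ p)"
    proof -
      have "y ^ q = y * y ^ (q - 1)" "y ^ p = y * y ^ (p - 1)" using p_pos q_pos by (metis Suc_diff_1 power_Suc)+
      thus ?thesis by (simp add: algebra_simps)
    qed
    finally show ?case using v(1) by (intro bexI[of _ "y ^ (q - 1) + y ^ (p - 1) * v ^ p"] A_add A_mult A_power A_y)
  qed
  then obtain v where v: "v \<in> A" "var_x ^ p ^ p = var_x - of_nat p * const a + y * v" by blast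
  have "of_nat p = (0 :: 'k ambient)" using char_ambient by (metis of_nat_CHAR)
  hence "var_x ^ p ^ p - var_x = y * v" using v by simp
  hence "\<exists>r\<in>loc P. var_x ^ p ^ p - var_x = y * r" using v A_sub_loc[OF P] by auto
  moreover have "y ^ p ^ p - y = y * (y ^ (p ^ p - 1) - 1)"
  proof -
    have "p ^ p = Suc (p ^ p - 1)" using p_pos by simp
    hence "y ^ p ^ p = y * y ^ (p ^ p - 1)" by (metis power_Suc)
    thus ?thesis by (simp add: algebra_simps)
  qed
  moreover have "y ^ (p ^ p - 1) - 1 \<in> loc P" using A_sub_loc[OF P] A_diff A_power A_y A_1 by blast
  ultimately show ?thesis using P True p_pos y_nonzero A_y by (intro exI[of _ y] exI[of _ p]) (auto simp: ev_y)
qed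

text \<open>A function \<open>u\<close> vanishing at \<open>P\<close> is divisible by
  \<open>t\<close>, since \<open>u * (u^(p^N - 1) - 1)\<close> is and the second factor has value
  \<open>-1\<close> there. Conversely every nonzero function divides some power \<open>t^i\<close>
  locally, by \<open>power_diff_in_principal\<close>, so at most \<open>i\<close> factors
  \<open>t\<close> can be split off before a unit is left.\<close>

lemma loc_dvr:
  assumes P: "P \<in> pts"
  shows "\<exists>t\<in>A. ev P t = 0 \<and> dvr K (loc P) t"
proof -
  obtain t N where t: "t \<in> A" "t \<noteq> 0" "N > 0" "ev P t = 0"
    and xy: "\<exists>r\<in>loc P. var_x ^ p ^ N - var_x = t * r" "\<exists>r\<in>loc P. y ^ p ^ N - y = t * r"
    using uniformizer_exists[OF P] by blast
  have one: "1 \<in> loc P" using A_sub_loc[OF P] A_1 by blast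
  have step: "\<exists>r\<in>loc P. u = t * r" if u: "u \<in> A" "ev P u = 0" for u
  proof -
    obtain r where r: "r \<in> loc P" "u ^ p ^ N - u = t * r" using frobenius_mod_uniformizer[OF P t(1) xy u(1)] by blast
    define v where "v = u ^ (p ^ N - 1) - 1"
    have vA: "v \<in> A" unfolding v_def by (intro A_diff A_power A_1 u)
    have "p ^ N > 1" using t(3) p_gt_1 by (intro one_less_power)
    hence evv: "ev P v = - 1" unfolding v_def using P u by (simp add: ev_diff ev_power ev_1 A_power A_1 power_0_left)
    have "u * v = t * r"
    proof -
      have "p ^ N = Suc (p ^ N - 1)" using p_pos by simp
      hence "u ^ p ^ N = u * u ^ (p ^ N - 1)" by (metis power_Suc)
      thus ?thesis using r by (simp add: v_def algebra_simps)
    qed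
    moreover have "v \<noteq> 0" using evv ev_0[OF P] by auto
    ultimately have "u = t * (r / v)" by (simp add: field_simps)
    moreover have "r / v \<in> loc P" using loc_divide[OF P r(1) vA] evv by simp
    ultimately show ?thesis by blast
  qed
  have inv: "inverse z \<in> loc P" if "z = u / w" "u \<in> A" "w \<in> A" "ev P u \<noteq> 0" for z u w
    using that unfolding loc_def by (auto simp: field_simps)
  have fac: "\<exists>n u. u \<noteq> 0 \<and> u \<in> loc P \<and> inverse u \<in> loc P \<and> z = t ^ n * u"
    if "z \<in> loc P" "r \<in> loc P" "z * r = t ^ i" for z r i
    using that
  proof (induction i arbitrary: z)
    case 0
    hence "inverse z = r" "z \<noteq> 0" by (auto intro: inverse_unique)
    thus ?case using 0 by (intro exI[of _ 0] exI[of _ z]) auto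
  next
    case (Suc i)
    obtain u w where uw: "z = u / w" "u \<in> A" "w \<in> A" "ev P w \<noteq> 0" using Suc.prems(1) by (auto simp: loc_def)
    have z0: "z \<noteq> 0" using Suc.prems t by auto
    show ?case
    proof (cases "ev P u = 0")
      case False
      thus ?thesis using inv[OF uw(1,2,3)] z0 Suc.prems(1) by (intro exI[of _ 0] exI[of _ z]) auto
    next
      case True
      then obtain r' where r': "r' \<in> loc P" "u = t * r'" using step uw by blast
      define z' where "z' = r' / w"
      have z': "z' \<in> loc P" "z = t * z'" using loc_divide[OF P r'(1) uw(3,4)] uw r' by (auto simp: z'_def)
      have "z' * r = t ^ i" using Suc.prems(3) z'(2) t(2) by simp
      then obtain n v where "v \<noteq> 0" "v \<in> loc P" "inverse v \<in> loc P" "z' = t ^ n * v" using Suc.IH[OF z'(1) Suc.prems(2)] by blast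
      thus ?thesis using z' by (intro exI[of _ "Suc n"] exI[of _ v]) auto
    qed
  qed
  have facA: "\<exists>n u. u \<noteq> 0 \<and> u \<in> loc P \<and> inverse u \<in> loc P \<and> z = t ^ n * u" if z: "z \<in> A" "z \<noteq> 0" for z
  proof -
    \<comment> \<open>Here \<open>t ^ i - t ^ j\<close> is \<open>t ^ i\<close> times
      \<open>d\<close>, and \<open>d\<close> has value 1 at \<open>P\<close>.\<close>
    obtain i j v where ij: "i < j" "v \<in> A" "t ^ i - t ^ j = z * v" using power_diff_in_principal[OF z t(1)] by blast
    define d where "d = 1 - t ^ (j - i)"
    have dA: "d \<in> A" unfolding d_def by (intro A_diff A_1 A_power t)
    have evd: "ev P d = 1" unfolding d_def using P t ij by (simp add: ev_diff ev_1 ev_power A_1 A_power power_0_left)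
    hence "d \<noteq> 0" using ev_0[OF P] by auto
    moreover have "t ^ j = t ^ i * t ^ (j - i)" using ij(1) by (simp flip: power_add)
    hence "t ^ i * d = z * v" using ij by (simp add: d_def algebra_simps)
    ultimately have "z * (v / d) = t ^ i" by (simp add: field_simps)
    moreover have "v / d \<in> loc P" using loc_divide[OF P _ dA] ij A_sub_loc[OF P] evd by auto
    ultimately show ?thesis using fac z A_sub_loc[OF P] by blast
  qed
  have "dvr K (loc P) t"
  proof
    show "is_subfield K" by (rule K_field)
    show "loc P \<subseteq> K" by (rule loc_K[OF P])
    show "1 \<in> loc P" by (rule one)
    show "u + v \<in> loc P" "u - v \<in> loc P" "u * v \<in> loc P" if "u \<in> loc P" "v \<in> loc P" for u v
      using loc_ring[OF P that] by auto
    show "t \<in> loc P" using t A_sub_loc[OF P] by blast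
    show "t \<noteq> 0" by (rule t)
    show "inverse t \<notin> loc P"
    proof
      assume "inverse t \<in> loc P"
      then obtain u w where "inverse t = u / w" "u \<in> A" "w \<in> A" "ev P w \<noteq> 0" by (auto simp: loc_def)
      moreover from this have "w \<noteq> 0" using ev_0[OF P] by auto
      ultimately have "w = t * u" using t by (simp add: field_simps)
      hence "ev P w = 0" using P t \<open>u \<in> A\<close> by (simp add: ev_mult)
      thus False using \<open>ev P w \<noteq> 0\<close> by simp
    qed
    fix z assume z: "z \<in> K" "z \<noteq> 0"
    then obtain u w where uw: "z = u / w" "u \<in> A" "w \<in> A" "w \<noteq> 0" "u \<noteq> 0" by (auto simp: K_eq)
    obtain n u' m w' where nm: "u' \<noteq> 0" "u' \<in> loc P" "inverse u' \<in> loc P" "u = t ^ n * u'"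
      "w' \<noteq> 0" "w' \<in> loc P" "inverse w' \<in> loc P" "w = t ^ m * w'" using facA uw by meson
    have "z = t powi (int n - int m) * (u' * inverse w')"
      using nm uw t by (simp add: power_int_diff field_simps)
    moreover have "u' * inverse w' \<in> loc P" "inverse (u' * inverse w') \<in> loc P" "u' * inverse w' \<noteq> 0"
      using nm loc_ring[OF P] by auto
    ultimately show "\<exists>n u. u \<noteq> 0 \<and> u \<in> loc P \<and> inverse u \<in> loc P \<and> z = t powi n * u" by blast
  qed
  thus ?thesis using t by blast
qed

lemma in_max_ideal_loc:
  assumes "P \<in> pts" "u \<in> A" shows "u \<in> max_ideal (loc P) \<longleftrightarrow> ev P u = 0"
proof (cases "u = 0")
  case True
  moreover have "0 \<in> loc P" using A_sub_loc[OF assms(1)] A_0 by blast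
  ultimately show ?thesis using ev_0[OF assms(1)] by (simp add: max_ideal_def)
next
  case False
  have "inverse u \<in> loc P \<longleftrightarrow> ev P u \<noteq> 0"
  proof
    assume "inverse u \<in> loc P"
    then obtain v w where vw: "inverse u = v / w" "v \<in> A" "w \<in> A" "ev P w \<noteq> 0" by (auto simp: loc_def)
    hence "w \<noteq> 0" using ev_0[OF assms(1)] by auto
    hence "w = u * v" using vw False by (simp add: field_simps)
    thus "ev P u \<noteq> 0" using vw assms by (auto simp: ev_mult)
  next
    assume "ev P u \<noteq> 0"
    thus "inverse u \<in> loc P" using assms A_1 unfolding loc_def by (auto simp: inverse_eq_divide)
  qed
  thus ?thesis using False assms A_sub_loc[OF assms(1)] by (auto simp: max_ideal_def)
qed

section \<open>The place at infinity\<close>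

definition inf_ring :: "'k ambient set" where
  "inf_ring = {u / w |u w. u \<in> A \<and> w \<in> A \<and> w \<noteq> 0 \<and> pole u \<le> pole w}"

lemma inf_ring_ring:
  assumes "u \<in> inf_ring" "v \<in> inf_ring"
  shows "u + v \<in> inf_ring" "u - v \<in> inf_ring" "u * v \<in> inf_ring"
proof -
  obtain a b c d where *: "u = a / b" "v = c / d" "a \<in> A" "b \<in> A" "b \<noteq> 0" "c \<in> A" "d \<in> A" "d \<noteq> 0"
      "pole a \<le> pole b" "pole c \<le> pole d"
    using assms by (auto simp: inf_ring_def)
  have m: "pole (f * g) \<le> pole b + pole d" if "f \<in> A" "g \<in> A" "pole f \<le> pole b" "pole g \<le> pole d" for f g
    using that pole_mult[of f g] pole_0 by (cases "f = 0 \<or> g = 0") auto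
  have "a * d \<in> Fil (pole b + pole d)" "c * b \<in> Fil (pole b + pole d)" "a * c \<in> Fil (pole b + pole d)"
    using * m[of a d] m[of b c] m[of a c] by (auto simp: Fil_def A_mult mult.commute)
  moreover have "u + v = (a * d + c * b) / (b * d)" "u - v = (a * d - c * b) / (b * d)" "u * v = (a * c) / (b * d)"
    using * by (auto simp: field_simps)
  moreover have "pole (b * d) = pole b + pole d" "b * d \<in> A" "b * d \<noteq> 0" using * by (auto simp: pole_mult A_mult)
  ultimately show "u + v \<in> inf_ring" "u - v \<in> inf_ring" "u * v \<in> inf_ring"
    using Fil_add Fil_diff unfolding inf_ring_def Fil_def by (smt (verit) mem_Collect_eq)+
qed

text \<open>A uniformizer is a quotient of two functions whose pole orders are consecutive;
  \<open>p * q\<close> and \<open>p * q + 1\<close> both occur. Quotients of equal pole orders are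
  units, so every function is a power of it times a unit.\<close>

lemma inf_dvr: "\<exists>t. dvr K inf_ring t \<and> (\<forall>u\<in>A. \<forall>w\<in>A. u \<noteq> 0 \<longrightarrow> w \<noteq> 0 \<longrightarrow> place_val inf_ring (u / w) = int (pole w) - int (pole u))"
proof -
  obtain b where b: "b \<in> A" "b \<noteq> 0" "pole b = Suc (p * q)" using pole_surj[of "Suc (p * q)"] by auto
  obtain c where c: "c \<in> A" "c \<noteq> 0" "pole c = p * q" using pole_surj[of "p * q"] by auto
  define t where "t = c / b"
  have t0: "t \<noteq> 0" using b c by (simp add: t_def)
  have unit: "z \<noteq> 0 \<and> z \<in> inf_ring \<and> inverse z \<in> inf_ring" if "z = u / w" "u \<in> A" "w \<in> A" "u \<noteq> 0" "w \<noteq> 0" "pole u = pole w" for z u w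
  proof -
    have "inverse z = w / u" using that by simp
    moreover have "u / w \<in> inf_ring" "w / u \<in> inf_ring" using that unfolding inf_ring_def by force+
    ultimately show ?thesis using that by auto
  qed
  have fac: "\<exists>u'. u' \<noteq> 0 \<and> u' \<in> inf_ring \<and> inverse u' \<in> inf_ring \<and> u / w = t powi (int (pole w) - int (pole u)) * u'"
    if uw: "u \<in> A" "w \<in> A" "u \<noteq> 0" "w \<noteq> 0" for u w
  proof (cases "pole u \<le> pole w")
    case True
    define m where "m = pole w - pole u"
    have "u / w = t ^ m * ((u * b ^ m) / (w * c ^ m))" using b c by (simp add: t_def power_divide field_simps)
    moreover have "pole (u * b ^ m) = pole (w * c ^ m)"
      using uw b c True by (simp add: pole_mult pole_power A_power m_def)
    hence "(u * b ^ m) / (w * c ^ m) \<noteq> 0 \<and> (u * b ^ m) / (w * c ^ m) \<in> inf_ring \<and> inverse ((u * b ^ m) / (w * c ^ m)) \<in> inf_ring"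
      using uw b c by (intro unit[OF refl]) (auto simp: A_mult A_power)
    moreover have "t powi (int (pole w) - int (pole u)) = t ^ m" using True by (simp add: m_def flip: power_int_of_nat of_nat_diff)
    ultimately show ?thesis by metis
  next
    case False
    define m where "m = pole u - pole w"
    have "u / w = inverse (t ^ m) * ((u * c ^ m) / (w * b ^ m))" using b c by (simp add: t_def power_divide field_simps)
    moreover have "pole (u * c ^ m) = pole (w * b ^ m)"
      using uw b c False by (simp add: pole_mult pole_power A_power m_def)
    hence "(u * c ^ m) / (w * b ^ m) \<noteq> 0 \<and> (u * c ^ m) / (w * b ^ m) \<in> inf_ring \<and> inverse ((u * c ^ m) / (w * b ^ m)) \<in> inf_ring"
      using uw b c by (intro unit[OF refl]) (auto simp: A_mult A_power)
    moreover have "t powi (int (pole w) - int (pole u)) = inverse (t ^ m)"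
    proof -
      have "int (pole w) - int (pole u) = - int m" using False by (simp add: m_def)
      thus ?thesis by (simp add: power_int_minus)
    qed
    ultimately show ?thesis by metis
  qed
  have dvr: "dvr K inf_ring t"
  proof
    show "is_subfield K" by (rule K_field)
    show "inf_ring \<subseteq> K" unfolding inf_ring_def K_eq by blast
    show "1 \<in> inf_ring" unfolding inf_ring_def using A_1 by (auto intro!: exI[of _ 1])
    show "u + v \<in> inf_ring" "u - v \<in> inf_ring" "u * v \<in> inf_ring" if "u \<in> inf_ring" "v \<in> inf_ring" for u v
      using inf_ring_ring[OF that] by auto
    show "t \<in> inf_ring" using b c unfolding inf_ring_def t_def by force
    show "t \<noteq> 0" by (rule t0)
    show "inverse t \<notin> inf_ring"
    proof
      assume "inverse t \<in> inf_ring"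
      then obtain u w where uw: "inverse t = u / w" "u \<in> A" "w \<in> A" "w \<noteq> 0" "pole u \<le> pole w" by (auto simp: inf_ring_def)
      hence e: "b * w = c * u" using b c by (simp add: t_def field_simps)
      have "u \<noteq> 0" using e b uw by auto
      thus False using arg_cong[OF e, of pole] b c uw by (simp add: pole_mult)
    qed
    fix z assume z: "z \<in> K" "z \<noteq> 0"
    then obtain u w where "z = u / w" "u \<in> A" "w \<in> A" "w \<noteq> 0" "u \<noteq> 0" by (auto simp: K_eq)
    thus "\<exists>n u. u \<noteq> 0 \<and> u \<in> inf_ring \<and> inverse u \<in> inf_ring \<and> z = t powi n * u" using fac by blast
  qed
  interpret dvr K inf_ring t by (rule dvr)
  have "place_val inf_ring (u / w) = int (pole w) - int (pole u)" if uw: "u \<in> A" "w \<in> A" "u \<noteq> 0" "w \<noteq> 0" for u w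
  proof -
    obtain u' where u': "unit u'" "u / w = t powi (int (pole w) - int (pole u)) * u'"
      using fac[OF uw] unfolding unit_def by blast
    thus ?thesis using val_eq by simp
  qed
  thus ?thesis using dvr by blast
qed

end

section \<open>Classification of the places\<close>

text \<open>A finite subring of a field is a field, since powers of a nonzero element repeat. It is
  rebuilt as an explicit algebraic structure in order to apply the theorem on generators of finite
  multiplicative groups.\<close>

lemma finite_field_cyclic:
  fixes V :: "'b :: field set"
  assumes fin: "finite V" and V: "0 \<in> V" "1 \<in> V" "\<And>u v. u \<in> V \<Longrightarrow> v \<in> V \<Longrightarrow> u + v \<in> V"
    "\<And>u v. u \<in> V \<Longrightarrow> v \<in> V \<Longrightarrow> u - v \<in> V" "\<And>u v. u \<in> V \<Longrightarrow> v \<in> V \<Longrightarrow> u * v \<in> V"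
  obtains g where "g \<in> V" "\<And>v. v \<in> V \<Longrightarrow> v \<noteq> 0 \<Longrightarrow> \<exists>i. v = g ^ i"
proof -
  define S :: "'b ring" where "S = \<lparr>carrier = V, monoid.mult = (\<lambda>x y. x * y), one = 1, ring.zero = 0, add = (\<lambda>x y. x + y)\<rparr>"
  have pw: "v ^ n \<in> V" if "v \<in> V" for v n using that V by (induction n) auto
  have inv: "inverse v \<in> V" if v: "v \<in> V" "v \<noteq> 0" for v
  proof -
    have "\<not> inj (\<lambda>n. v ^ n)"
    proof
      assume "inj (\<lambda>n. v ^ n)"
      hence "infinite (range (\<lambda>n. v ^ n))" using finite_imageD infinite_UNIV_nat by blast
      moreover have "range (\<lambda>n. v ^ n) \<subseteq> V" using pw v by blast
      ultimately show False using fin finite_subset by blast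
    qed
    then obtain i j where ij: "i < j" "v ^ i = v ^ j" by (metis injI linorder_neqE_nat)
    have "v ^ j = v ^ i * v ^ (j - i)" using ij(1) by (simp flip: power_add)
    hence "v ^ (j - i) = 1" using ij v by simp
    moreover have "v ^ (j - i) = v * v ^ (j - i - 1)" using ij(1) by (metis Suc_diff_1 power_Suc zero_less_diff)
    ultimately have "inverse v = v ^ (j - i - 1)" by (intro inverse_unique) simp
    thus ?thesis using pw v by simp
  qed
  have neg: "\<exists>w\<in>V. v + w = 0" if "v \<in> V" for v using V(4)[OF V(1) that] by (intro bexI[of _ "0 - v"]) auto
  have neg': "\<exists>w\<in>V. w + v = 0" if "v \<in> V" for v using V(4)[OF V(1) that] by (intro bexI[of _ "0 - v"]) auto
  have cr: "cring S"
  proof (rule cringI)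
    show "abelian_group S" unfolding S_def
      by (rule abelian_groupI) (use V neg' in \<open>auto simp: algebra_simps\<close>)
    show "comm_monoid S" unfolding S_def
      by (rule comm_monoidI) (use V in \<open>auto simp: algebra_simps\<close>)
  qed (auto simp: S_def algebra_simps)
  have "field S"
  proof (rule cring.cring_fieldI2[OF cr])
    show "\<zero>\<^bsub>S\<^esub> \<noteq> \<one>\<^bsub>S\<^esub>" by (simp add: S_def)
    show "\<exists>b\<in>carrier S. a \<otimes>\<^bsub>S\<^esub> b = \<one>\<^bsub>S\<^esub>" if "a \<in> carrier S" "a \<noteq> \<zero>\<^bsub>S\<^esub>" for a
      using that inv by (intro bexI[of _ "inverse a"]) (auto simp: S_def)
  qed
  then interpret S: field S .
  have "finite (carrier S)" using fin by (simp add: S_def)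
  then obtain g where g: "g \<in> carrier (mult_of S)" "carrier (mult_of S) = {g [^]\<^bsub>S\<^esub> i |i :: nat. i \<in> UNIV}"
    using S.finite_field_mult_group_has_gen by auto
  have pow: "g [^]\<^bsub>S\<^esub> i = g ^ i" for i :: nat
    by (induction i) (auto simp: S_def nat_pow_def mult.commute)
  show ?thesis
  proof
    show "g \<in> V" using g(1) by (simp add: mult_of_def S_def)
    show "\<exists>i. v = g ^ i" if "v \<in> V" "v \<noteq> 0" for v
    proof -
      have "v \<in> carrier (mult_of S)" using that by (simp add: mult_of_def S_def)
      thus ?thesis using g(2) pow by auto
    qed
  qed
qed

context superelliptic
begin

lemma const_in_R: "R \<in> places K \<Longrightarrow> const c \<in> R"
  by (auto simp: places_def)

lemma loc_place: "P \<in> pts \<Longrightarrow> loc P \<in> places K"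
proof -
  assume P: "P \<in> pts"
  then obtain t where "dvr K (loc P) t" using loc_dvr by blast
  then interpret dvr K "loc P" t .
  have "const c \<in> loc P" for c using A_sub_loc[OF P] A_const by blast
  thus ?thesis using R_sub R_proper add diff mult valuation_ring by (auto simp: places_def)
qed

lemma inf_place: "inf_ring \<in> places K"
proof -
  obtain t where "dvr K inf_ring t" using inf_dvr by blast
  then interpret dvr K inf_ring t .
  have "const c \<in> inf_ring" for c
  proof -
    have "const c = const c / 1" by simp
    thus ?thesis unfolding inf_ring_def using A_const A_1 pole_const by (smt (verit) mem_Collect_eq one_neq_zero zero_le)
  qed
  thus ?thesis using R_sub R_proper add diff mult valuation_ring by (auto simp: places_def)
qed

lemma pole_monomial: "u \<in> A \<Longrightarrow> u \<noteq> 0 \<Longrightarrow> \<exists>i j. j < q \<and> pole u = q * i + p * j"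
proof -
  assume u: "u \<in> A" "u \<noteq> 0"
  define n where "n = pole u"
  have "th u \<noteq> 0" using u th_eq_0_iff by blast
  hence "poly.coeff (theta (rep u)) n \<noteq> 0" by (simp add: n_def pole_def th_def)
  then obtain j i where "poly.coeff (Polynomial.monom (cf (rep u) j i) (q * i + p * j)) n \<noteq> 0"
    unfolding theta_sum coeff_sum by (meson sum.not_neutral_contains_not_neutral)
  hence "q * i + p * j = n" "cf (rep u) j i \<noteq> 0" by (auto split: if_splits)
  moreover from this have "j < q" using rep(1)[OF u(1)] by (metis reduced_def coeff_0 not_le)
  ultimately show ?thesis unfolding n_def by metis
qed

text \<open>
  If \<open>x\<close> is not in the valuation ring, then \<open>y^q = g x^p\<close> with a unit \<open>g\<close>, so the \<open>q\<close>-th power of a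
  quotient of monomials is a unit times a power of \<open>x\<close>, whose exponent is the difference of the weights.
\<close>

lemma place_classification:
  assumes R: "R \<in> places K"
  shows "R = inf_ring \<or> (\<exists>P\<in>pts. R = loc P)"
proof -
  have RK: "R \<subseteq> K" "R \<noteq> K" and cR: "\<And>c. const c \<in> R"
    and ring: "\<And>u v. u \<in> R \<Longrightarrow> v \<in> R \<Longrightarrow> u + v \<in> R" "\<And>u v. u \<in> R \<Longrightarrow> v \<in> R \<Longrightarrow> u - v \<in> R"
      "\<And>u v. u \<in> R \<Longrightarrow> v \<in> R \<Longrightarrow> u * v \<in> R"
    and val: "\<And>z. z \<in> K \<Longrightarrow> z \<in> R \<or> inverse z \<in> R"
    using R by (auto simp: places_def)
  have one: "1 \<in> R" and zero: "0 \<in> R" using cR[of 1] cR[of 0] by (simp_all add: const.one const.zero)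
  have pow: "u ^ n \<in> R" if "u \<in> R" for u n using that one ring by (induction n) auto
  define m where "m = max_ideal R"
  have mR: "m \<subseteq> R" by (auto simp: m_def max_ideal_def)
  have m0: "0 \<in> m" using zero by (simp add: m_def max_ideal_def)
  have m_iff: "z \<in> m \<longleftrightarrow> z \<in> R \<and> (z = 0 \<or> inverse z \<notin> R)" for z by (auto simp: m_def max_ideal_def)
  have m1: "1 \<notin> m" using one by (simp add: m_iff)
  have m_mult: "u * v \<in> m" if "u \<in> m" "v \<in> R" for u v
  proof (rule ccontr)
    assume n: "u * v \<notin> m"
    have uv: "u * v \<in> R" using that mR ring by blast
    hence "u * v \<noteq> 0" "inverse (u * v) \<in> R" using n by (auto simp: m_iff)
    hence "v * inverse (u * v) \<in> R" "u \<noteq> 0" using that ring(3) by auto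
    moreover have "v * inverse (u * v) = inverse u" using \<open>u * v \<noteq> 0\<close> by simp
    ultimately have "inverse u \<in> R" "u \<noteq> 0" by metis+
    thus False using that(1) by (auto simp: m_iff)
  qed
  have Kd: "u / v \<in> K" if "u \<in> R" "v \<in> R" for u v
    using that RK K_field by (auto simp: is_subfield_def divide_inverse)
  have m_add: "u + v \<in> m" if "u \<in> m" "v \<in> m" for u v
  proof (cases "u = 0 \<or> v = 0")
    case True thus ?thesis using that by auto
  next
    case False
    have "u / v \<in> R \<or> v / u \<in> R" using val[OF Kd[of u v]] that mR by auto
    thus ?thesis
    proof
      assume "u / v \<in> R"
      hence "v * (u / v + 1) \<in> m" using that one ring by (intro m_mult) auto
      thus ?thesis using False by (simp add: field_simps)
    next
      assume "v / u \<in> R"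
      hence "u * (v / u + 1) \<in> m" using that one ring by (intro m_mult) auto
      thus ?thesis using False by (simp add: field_simps)
    qed
  qed
  have m_diff: "u - v \<in> m" if "u \<in> m" "v \<in> m" for u v
    using m_add[OF that(1) m_mult[OF that(2), of "0 - 1"]] ring(2)[OF zero one] by simp
  have m_pow: "u ^ n \<in> m" if "u \<in> m" "n > 0" for u n
    using that mR pow m_mult by (cases n) auto
  show ?thesis
  proof (cases "var_x \<in> R")
    case True
    \<comment> \<open>\<open>y\<close> is integral over the ring generated by \<open>x\<close>: if
      \<open>inverse y\<close> lies in \<open>R\<close>, then so does
      \<open>y = y^q * (inverse y)^(q - 1)\<close>.\<close>
    have "y \<in> R"
    proof (cases "y \<in> R")
      case False
      hence iy: "inverse y \<in> R" using val[of y] A_sub_K A_y by blast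
      have "y = y ^ q * inverse y ^ (q - 1)"
      proof -
        have "y ^ q = y * y ^ (q - 1)" using q_pos by (metis Suc_diff_1 power_Suc)
        thus ?thesis using y_nonzero by (simp add: power_inverse)
      qed
      moreover have "y ^ q \<in> R" unfolding y_eq by (intro ring pow True cR)
      ultimately show ?thesis using pow[OF iy] ring by metis
    qed
    have AR: "A \<subseteq> R"
    proof
      fix u assume "u \<in> A"
      thus "u \<in> R" by (induction u rule: A_induct) (use True \<open>y \<in> R\<close> cR ring in auto)
    qed
    define M where "M = A \<inter> m"
    have Mp: "A_prime M"
      unfolding A_prime_def A_ideal_def
    proof (intro conjI ballI impI)
      show "u * v \<in> M" if "u \<in> M" "v \<in> A" for u v using that AR m_mult A_mult by (auto simp: M_def)
      show "u \<in> M \<or> v \<in> M" if "u \<in> A" "v \<in> A" "u * v \<in> M" for u v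
      proof (rule ccontr)
        assume "\<not> (u \<in> M \<or> v \<in> M)"
        hence uv: "inverse u \<in> R" "u \<noteq> 0" "inverse v \<in> R" "v \<noteq> 0" using that(1,2) AR by (auto simp: M_def m_iff)
        moreover have "u * v \<in> m" using that by (simp add: M_def)
        ultimately have "u * v * (inverse u * inverse v) \<in> m" using ring(3) m_mult by blast
        moreover have "u * v * (inverse u * inverse v) = 1" using uv by (simp add: field_simps)
        ultimately show False using m1 by simp
      qed
    qed (use m0 m1 m_add A_0 A_add in \<open>auto simp: M_def\<close>)
    \<comment> \<open>Otherwise every nonzero element of \<open>A\<close> would be a unit of
      \<open>R\<close>, and \<open>R\<close> would be all of \<open>K\<close>.\<close>
    have "\<exists>u0\<in>M. u0 \<noteq> 0"
    proof (rule ccontr)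
      assume "\<not> (\<exists>u0\<in>M. u0 \<noteq> 0)"
      hence "u \<notin> m" if "u \<in> A" "u \<noteq> 0" for u using that by (auto simp: M_def)
      hence "inverse u \<in> R" if "u \<in> A" for u using that AR zero by (cases "u = 0") (auto simp: m_iff)
      hence "u / w \<in> R" if "u \<in> A" "w \<in> A" for u w
        unfolding divide_inverse using that AR by (intro ring(3)) auto
      hence "K \<subseteq> R" unfolding K_eq by blast
      thus False using RK(1,2) by (metis subset_antisym)
    qed
    then obtain u0 where u0: "u0 \<in> M" "u0 \<noteq> 0" by blast
    obtain P where P: "P \<in> pts" "M = {u \<in> A. ev P u = 0}" by (rule prime_is_point[OF Mp u0])
    have "inverse w \<in> R" if "w \<in> A" "ev P w \<noteq> 0" for w
    proof -
      have "w \<notin> m" using that P(2) by (auto simp: M_def)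
      thus ?thesis using that AR by (auto simp: m_iff)
    qed
    hence "u / w \<in> R" if "u \<in> A" "w \<in> A" "ev P w \<noteq> 0" for u w
      unfolding divide_inverse using that AR by (intro ring(3)) auto
    hence sub: "loc P \<subseteq> R" unfolding loc_def by blast
    obtain t where "dvr K (loc P) t" using loc_dvr P by blast
    then interpret dvr K "loc P" t .
    have "R = loc P" by (rule maximal[OF sub RK ring(3)])
    thus ?thesis using P by blast
  next
    case False
    define s where "s = inverse (var_x :: 'k ambient)"
    have x0: "(var_x :: 'k ambient) \<noteq> 0" by (rule var_x_nonzero)
    have "s \<in> R" using val[of var_x] A_sub_K A_x False unfolding s_def by blast
    hence sm: "s \<in> m" using False x0 by (simp add: m_iff s_def)
    have unit: "inverse (const c + v) \<in> R" if "c \<noteq> 0" "v \<in> m" for c v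
    proof (rule ccontr)
      assume "inverse (const c + v) \<notin> R"
      hence "const c + v \<in> m" using that cR mR ring by (auto simp: m_iff)
      hence "(const c + v - v) * const (inverse c) \<in> m" using that cR by (intro m_mult m_diff)
      thus False using that m1 by (simp add: const.one flip: const.mult)
    qed
    \<comment> \<open>\<open>g\<close> is \<open>(x^p - x + a) / x^p\<close> written in
      \<open>s = 1/x\<close>, which lies in the maximal ideal; so \<open>g\<close> is 1 plus an
      element of that ideal, a unit.\<close>
    define g where "g = const 1 + (const a * s ^ p - s ^ (p - 1))"
    have "const a * s ^ p - s ^ (p - 1) \<in> m"
      using sm m_pow p_gt_1 p_pos m_mult[OF m_pow[OF sm p_pos] cR] by (intro m_diff) (auto simp: mult.commute)
    hence gR: "g \<in> R" "inverse g \<in> R" unfolding g_def using unit[of 1] cR mR ring by auto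
    have g: "y ^ q = g * var_x ^ p"
    proof -
      have "s ^ p * var_x ^ p = 1" using x0 by (simp add: s_def flip: power_mult_distrib)
      moreover have "s ^ (p - 1) * var_x ^ p = var_x"
      proof -
        have "var_x ^ p = var_x ^ (p - 1) * (var_x :: 'k ambient)" using p_pos by (metis Suc_diff_1 power_Suc2)
        thus ?thesis using x0 by (simp add: s_def power_inverse)
      qed
      ultimately show ?thesis unfolding y_eq g_def by (simp add: algebra_simps const.one)
    qed
    hence g0: "g \<noteq> 0" using y_nonzero by auto
    \<comment> \<open>Valuation rings are integrally closed: an excluded \<open>z\<close> would have
      \<open>inverse z\<close> in \<open>m\<close>, and then \<open>1 = (inverse z)^q * z^q\<close>
      would be in \<open>m\<close>. The second claim is dual.\<close>
    have root: "z \<in> R" "z ^ q \<in> m \<Longrightarrow> z \<in> m" if "z \<in> K" "z ^ q \<in> R" for z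
    proof -
      show "z \<in> R"
      proof (rule ccontr)
        assume "z \<notin> R"
        moreover from this have "inverse z \<in> R" using val that by blast
        ultimately have iz: "inverse z \<in> m" "z \<noteq> 0" using zero unfolding m_iff by auto
        hence "inverse z ^ q * z ^ q \<in> m" using that m_pow q_pos by (intro m_mult) auto
        thus False using iz m1 by (simp flip: power_mult_distrib)
      qed
      thus "z \<in> m" if "z ^ q \<in> m"
      proof (rule_tac ccontr)
        assume "z \<notin> m"
        hence iz: "inverse z \<in> R" "z \<noteq> 0" using \<open>z \<in> R\<close> by (auto simp: m_iff)
        hence "z ^ q * inverse z ^ q \<in> m" using that pow by (intro m_mult) auto
        thus False using iz m1 by (simp flip: power_mult_distrib)
      qed
    qed
    have mono: "var_x ^ i * y ^ j / (var_x ^ i' * y ^ j') \<in> R \<and>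
        (q * i + p * j < q * i' + p * j' \<longrightarrow> var_x ^ i * y ^ j / (var_x ^ i' * y ^ j') \<in> m)"
      if le: "q * i + p * j \<le> q * i' + p * j'" for i j i' j'
    proof -
      define z where "z = var_x ^ i * y ^ j / (var_x ^ i' * y ^ j')"
      define d where "d = (q * i' + p * j') - (q * i + p * j)"
      have e: "(var_x ^ i * y ^ j) ^ q = g ^ j * var_x ^ (q * i + p * j)" for i j
      proof -
        have "(var_x ^ i * y ^ j) ^ q = var_x ^ (q * i) * (y ^ q) ^ j"
          by (simp add: power_mult_distrib mult.commute flip: power_mult)
        thus ?thesis unfolding g by (simp add: power_mult_distrib power_add power_mult)
      qed
      have "z ^ q = g ^ j * inverse g ^ j' * (var_x ^ (q * i + p * j) / var_x ^ (q * i' + p * j'))"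
        unfolding z_def power_divide e by (simp add: divide_inverse power_inverse)
      also have "q * i' + p * j' = (q * i + p * j) + d" using le by (simp add: d_def)
      also have "var_x ^ (q * i + p * j) / var_x ^ \<dots> = s ^ d"
        using x0 by (simp add: power_add s_def power_inverse field_simps)
      finally have zq: "z ^ q = g ^ j * inverse g ^ j' * s ^ d" .
      have gg: "g ^ j * inverse g ^ j' \<in> R" by (intro ring(3) pow gR)
      have zK: "z \<in> K" unfolding z_def by (intro K_divide A_mult A_power A_x A_y)
      have zqR: "z ^ q \<in> R" unfolding zq by (intro ring(3) gg pow subsetD[OF mR sm])
      have "z \<in> R" by (rule root(1)[OF zK zqR])
      moreover have "z \<in> m" if "d > 0"
      proof -
        have "z ^ q \<in> m" unfolding zq using m_mult[OF m_pow[OF sm that] gg] by (simp add: mult.commute)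
        thus ?thesis by (rule root(2)[OF zK zqR])
      qed
      ultimately show ?thesis unfolding z_def[symmetric] by (auto simp: d_def)
    qed
    have monoc: "var_x ^ i * y ^ j / (var_x ^ i' * y ^ j') * const c \<in> R \<and>
        (q * i + p * j < q * i' + p * j' \<longrightarrow> var_x ^ i * y ^ j / (var_x ^ i' * y ^ j') * const c \<in> m)"
      if le: "q * i + p * j \<le> q * i' + p * j'" for i j i' j' c
      using mono[OF le] ring(3)[OF _ cR] m_mult[OF _ cR] by blast
    \<comment> \<open>Leading monomials are removed one pole order at a time, and each quotient of
      monomials is controlled by \<open>monoc\<close>.\<close>
    have claim: "u / (var_x ^ i * y ^ j) \<in> R \<and> (n < q * i + p * j \<longrightarrow> u / (var_x ^ i * y ^ j) \<in> m)"
      if "u \<in> A" "pole u \<le> n" "n \<le> q * i + p * j" for u n i j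
      using that
    proof (induction n arbitrary: u)
      case 0
      then obtain c where c: "u = const c" using pole_0_const by auto
      have e: "u / (var_x ^ i * y ^ j) = (var_x ^ 0 * y ^ 0 / (var_x ^ i * y ^ j)) * const c" by (simp add: c)
      have le: "q * 0 + p * 0 \<le> q * i + p * j" by simp
      from monoc[OF le, of c] show ?case unfolding e mult_0_right add_0_left by blast
    next
      case (Suc n)
      show ?case
      proof (cases "pole u \<le> n")
        case True
        thus ?thesis using Suc by auto
      next
        case False
        hence pu: "pole u = Suc n" using Suc.prems by simp
        hence "u \<noteq> 0" using pole_0 by auto
        then obtain i1 j1 where ij: "j1 < q" "pole u = q * i1 + p * j1" using pole_monomial Suc.prems(1) by blast
        define e where "e = var_x ^ i1 * y ^ j1"
        have e: "e \<in> A" "e \<noteq> 0" "pole e = Suc n"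
          using ij pu x0 y_nonzero by (auto simp: e_def A_mult A_power A_x A_y pole_def rep_monom degree_monom_eq)
        obtain c where c: "u - const c * e \<in> Fil n" using cancel_leading[OF Suc.prems(1) e(1,2) pu e(3)] by blast
        have "(u - const c * e) / (var_x ^ i * y ^ j) \<in> m"
          using Suc.IH[of "u - const c * e"] c Suc.prems by (auto simp: Fil_def)
        moreover have "e / (var_x ^ i * y ^ j) * const c \<in> R \<and> (Suc n < q * i + p * j \<longrightarrow> e / (var_x ^ i * y ^ j) * const c \<in> m)"
          using monoc[of i1 j1 i j c] Suc.prems(3) ij(2) pu unfolding e_def by simp
        moreover have "u / (var_x ^ i * y ^ j) = e / (var_x ^ i * y ^ j) * const c + (u - const c * e) / (var_x ^ i * y ^ j)"
          by (simp add: diff_divide_distrib mult.commute)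
        ultimately show ?thesis using ring(1) m_add subsetD[OF mR] by metis
      qed
    qed
    have "inf_ring \<subseteq> R"
    proof
      fix z assume "z \<in> inf_ring"
      then obtain u w where uw: "z = u / w" "u \<in> A" "w \<in> A" "w \<noteq> 0" "pole u \<le> pole w" by (auto simp: inf_ring_def)
      obtain i j where ij: "j < q" "pole w = q * i + p * j" using pole_monomial uw by blast
      define e where "e = var_x ^ i * y ^ j"
      have e: "e \<in> A" "e \<noteq> 0" "pole e = pole w"
        using ij x0 y_nonzero by (auto simp: e_def A_mult A_power A_x A_y pole_def rep_monom degree_monom_eq)
      \<comment> \<open>\<open>w / e\<close> is its leading coefficient plus an element of
        \<open>m\<close>, hence a unit. Pole order 0 is treated apart, since no filtration step lies
        below it.\<close>
      have "inverse (w / e) \<in> R"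
      proof (cases "pole w")
        case 0
        then obtain c c' where c: "w = const c" "e = const c'" using pole_0_const uw e by metis
        hence "inverse (w / e) = const (inverse c * c')" by (simp add: const.mult const_inverse divide_inverse mult.commute)
        thus ?thesis using cR by simp
      next
        case (Suc n)
        then obtain c where c: "w - const c * e \<in> Fil n" using cancel_leading[of w e n] uw e by auto
        have "c \<noteq> 0" using c Suc by (auto simp: Fil_def const.zero)
        moreover have "(w - const c * e) / e \<in> m" unfolding e_def using claim[of "w - const c * e" n i j] c Suc ij
          by (auto simp: Fil_def e_def)
        moreover have "w / e = const c + (w - const c * e) / e" using e(2) by (simp add: diff_divide_distrib)
        ultimately show ?thesis using unit by metis
      qed
      moreover have "u / e \<in> R" unfolding e_def using claim[of u "pole w" i j] uw ij by auto
      ultimately have "u / e * inverse (w / e) \<in> R" by (intro ring(3))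
      moreover have "u / e * inverse (w / e) = z" using uw(1) e(2) by simp
      ultimately show "z \<in> R" by (simp only:)
    qed
    moreover obtain t where "dvr K inf_ring t" using inf_dvr by blast
    then interpret dvr K inf_ring t .
    have "R = inf_ring" if "inf_ring \<subseteq> R" by (rule maximal[OF that RK ring(3)])
    ultimately show ?thesis by blast
  qed
qed

lemma loc_neq_inf: "P \<in> pts \<Longrightarrow> loc P \<noteq> inf_ring"
proof
  assume P: "P \<in> pts" "loc P = inf_ring"
  hence "var_x \<in> inf_ring" using A_sub_loc A_x by blast
  then obtain u w where uw: "var_x = u / w" "u \<in> A" "w \<in> A" "w \<noteq> 0" "pole u \<le> pole w" by (auto simp: inf_ring_def)
  hence e: "u = var_x * w" by (simp add: field_simps)
  hence "pole u = q + pole w" using pole_mult[OF A_x uw(3) var_x_nonzero uw(4)] pole_x by simp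
  thus False using uw q_pos by simp
qed

section \<open>Residue fields, conjugate points and degrees of places\<close>

definition res_field :: "'k alg_closure \<times> 'k alg_closure \<Rightarrow> 'k alg_closure set" where
  "res_field P = ev P ` A"

lemma res_field_fixed:
  assumes P: "P \<in> pts" "v \<in> res_field P"
  shows "v ^ p ^ curve.per P = v"
proof -
  obtain u where u: "u \<in> A" "v = ev P u" using P by (auto simp: res_field_def)
  have "ev ((frp ^^ curve.per P) P) u = ev P u ^ p ^ curve.per P" using ev_funpow_frp P u by blast
  thus ?thesis using u by (simp add: curve.funpow_per)
qed

lemma finite_res_field: "P \<in> pts \<Longrightarrow> finite (res_field P)"
  using res_field_fixed[of P] by (intro finite_subset[OF _ finite_frobenius_fixed[OF curve.per_pos[of P]]]) auto

lemma res_field_closed: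
  assumes P: "P \<in> pts"
  shows "0 \<in> res_field P" "1 \<in> res_field P" "u \<in> res_field P \<Longrightarrow> v \<in> res_field P \<Longrightarrow> u + v \<in> res_field P"
    "u \<in> res_field P \<Longrightarrow> v \<in> res_field P \<Longrightarrow> u - v \<in> res_field P" "u \<in> res_field P \<Longrightarrow> v \<in> res_field P \<Longrightarrow> u * v \<in> res_field P"
proof -
  show "0 \<in> res_field P" "1 \<in> res_field P" unfolding res_field_def using ev_0[OF P] ev_1[OF P] A_0 A_1 by (metis imageI)+
  assume "u \<in> res_field P" "v \<in> res_field P"
  then obtain u' v' where "u = ev P u'" "v = ev P v'" "u' \<in> A" "v' \<in> A" by (auto simp: res_field_def)
  thus "u + v \<in> res_field P" "u - v \<in> res_field P" "u * v \<in> res_field P"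
    unfolding res_field_def using ev_add[OF P] ev_diff[OF P] ev_mult[OF P] A_add A_diff A_mult by (metis imageI)+
qed

lemma one_minus_power_vanishes:
  assumes "P \<in> pts" "u \<in> A" "ev P u \<noteq> 0"
  shows "\<exists>n>0. ev P (1 - u ^ n) = 0"
proof -
  have "ev P u ^ p ^ curve.per P = ev P u" using assms by (intro res_field_fixed) (auto simp: res_field_def)
  hence "ev P u ^ (p ^ curve.per P - 1) = 1" using assms power_p_minus_1[of "ev P u"] by simp
  moreover have "p ^ curve.per P > 1" using p_gt_1 curve.per_pos by (intro one_less_power)
  ultimately show ?thesis using assms
    by (intro exI[of _ "p ^ curve.per P - 1"]) (auto simp: ev_diff ev_1 ev_power A_1 A_power)
qed

lemma loc_eq_kernel: "loc P = loc P'" if "{u \<in> A. ev P u = 0} = {u \<in> A. ev P' u = 0}"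
proof -
  have "ev P w = 0 \<longleftrightarrow> ev P' w = 0" if "w \<in> A" for w using that \<open>_ = _\<close> by blast
  thus ?thesis by (auto simp: loc_def)
qed

text \<open>Kernels cannot be properly nested: if \<open>u\<close> vanishes at \<open>P\<close> but
  not at \<open>P'\<close>, then some \<open>1 - u^k\<close> vanishes at \<open>P'\<close>, and its
  value at \<open>P\<close> is 1.\<close>

lemma separate_places:
  assumes P: "P \<in> pts" "P' \<in> pts" "loc P \<noteq> loc P'"
  shows "\<exists>u\<in>A. ev P u \<noteq> 0 \<and> ev P' u = 0"
proof (rule ccontr)
  assume n: "\<not> (\<exists>u\<in>A. ev P u \<noteq> 0 \<and> ev P' u = 0)"
  have "ev P' u = 0" if u: "u \<in> A" "ev P u = 0" for u
  proof (rule ccontr)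
    assume "ev P' u \<noteq> 0"
    then obtain k where k: "k > 0" "ev P' (1 - u ^ k) = 0" using one_minus_power_vanishes P u by blast
    hence "ev P (1 - u ^ k) = 0" using n u A_diff A_1 A_power by blast
    thus False using P u k by (simp add: ev_diff ev_1 ev_power A_1 A_power power_0_left)
  qed
  hence "loc P = loc P'" using n by (intro loc_eq_kernel) blast
  thus False using P by blast
qed

text \<open>The product of \<open>X - z\<close> over the Frobenius orbit of the value at
  \<open>P\<close> is invariant under Frobenius, so it descends to the base field and can be
  evaluated at \<open>u\<close>. The result vanishes at \<open>P\<close>, hence at
  \<open>P'\<close>, so the value at \<open>P'\<close> is one of the roots.\<close>

lemma conjugate_values:
  assumes P: "P \<in> pts" "P' \<in> pts" and ker: "\<And>u. u \<in> A \<Longrightarrow> ev P u = 0 \<Longrightarrow> ev P' u = 0" and u: "u \<in> A"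
  shows "\<exists>n. ev P' u = ev P u ^ p ^ n"
proof -
  define g where "g = ev P u"
  define m where "m = (\<Prod>z\<in>line.orb g. [:- z, 1:])"
  have frm: "fr (v + w) = fr v + fr w" "fr (v * w) = fr v * fr w" "fr 1 = 1" for v w
    using power_add_char[OF char_ac, of v w 1] by (auto simp: fr_def power_mult_distrib)
  interpret fr: ring_morphism fr by unfold_locales (rule frm)+
  have frn: "fr (- z) = - fr z" for z using fr.diff[of 0 z] by (simp add: fr.zero)
  have bij: "fr ` line.orb g = line.orb g"
  proof (rule card_subset_eq[OF line.finite_orb])
    show "fr ` line.orb g \<subseteq> line.orb g"
    proof (clarsimp simp: line.orb_def)
      fix n show "fr ((fr ^^ n) g) \<in> range (\<lambda>n. (fr ^^ n) g)" by (rule range_eqI[of _ _ "Suc n"]) simp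
    qed
    show "card (fr ` line.orb g) = card (line.orb g)"
      by (intro card_image inj_on_subset[OF inj_fr]) simp
  qed
  have mp: "map_poly fr (P * Q) = map_poly fr P * map_poly fr Q" for P Q
    by (intro poly_eqI) (simp add: coeff_map_poly fr.zero coeff_mult fr.sum fr.mult)
  have "map_poly fr (\<Prod>z\<in>Z. [:- z, 1:]) = (\<Prod>z\<in>Z. [:- fr z, 1:])" if "finite Z" for Z
    using that by (induction Z rule: finite_induct)
      (auto simp: mp map_poly_pCons fr.zero fr.one frn simp del: mult_pCons_left)
  hence "map_poly fr m = (\<Prod>z\<in>line.orb g. [:- fr z, 1:])" unfolding m_def using line.finite_orb by blast
  also have "\<dots> = (\<Prod>z\<in>fr ` line.orb g. [:- z, 1:])"
    by (subst prod.reindex[OF inj_on_subset[OF inj_fr]]) auto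
  finally have "map_poly fr m = m" by (simp add: bij m_def)
  hence "fr (poly.coeff m i) = poly.coeff m i" for i by (metis coeff_map_poly fr.zero)
  hence "poly.coeff m i ^ p = poly.coeff m i" for i by (simp add: fr_def)
  then obtain M where M: "m = map_poly to_ac M" by (rule descend_frobenius_invariant)
  interpret cu: ring_morphism "eval_hom const u" by (rule const.eval_hom_morphism)
  have evM: "eval_hom const u N \<in> A \<and> ev Q (eval_hom const u N) = poly (map_poly to_ac N) (ev Q u)" if "Q \<in> pts" for Q N
  proof (induction N)
    case 0 thus ?case using that by (simp add: const.eval_hom_0 A_0 ev_0)
  next
    case (pCons c N)
    thus ?case using that u by (simp add: const.eval_hom_pCons A_add A_mult A_const ev_add ev_mult ev_const map_poly_pCons)
  qed
  have "poly m g = 0" unfolding m_def using line.orb_self line.finite_orb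
    by (auto simp: poly_prod intro!: prod_zero)
  hence "ev P (eval_hom const u M) = 0" using evM[OF P(1)] M by (simp add: g_def)
  hence "poly m (ev P' u) = 0" using ker evM[OF P(2)] evM[OF P(1)] M by metis
  then obtain z where "z \<in> line.orb g" "ev P' u = z" unfolding m_def poly_prod using line.finite_orb by auto
  thus ?thesis by (auto simp: line.orb_def funpow_fr g_def)
qed

text \<open>
  Two points with the same kernel are conjugate: a generator of the cyclic group of units of the
  residue field takes conjugate values at both, and all coordinates are powers of it modulo the kernel.
\<close>

lemma loc_eq_iff:
  assumes P: "P \<in> pts" "P' \<in> pts"
  shows "loc P = loc P' \<longleftrightarrow> curve.orb P = curve.orb P'"
proof
  assume "curve.orb P = curve.orb P'"
  then obtain n where n: "P' = (frp ^^ n) P" using curve.orb_self[of P'] by (auto simp: curve.orb_def)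
  hence "ev P' u = 0 \<longleftrightarrow> ev P u = 0" if "u \<in> A" for u using ev_funpow_frp[OF P(1) that, of n] p_pos by simp
  thus "loc P = loc P'" by (intro loc_eq_kernel) auto
next
  assume eq: "loc P = loc P'"
  have ker: "ev P u = 0 \<longleftrightarrow> ev P' u = 0" if "u \<in> A" for u
    using in_max_ideal_loc[OF P(1) that] in_max_ideal_loc[OF P(2) that] eq by simp
  obtain g where g: "g \<in> res_field P" "\<And>v. v \<in> res_field P \<Longrightarrow> v \<noteq> 0 \<Longrightarrow> \<exists>i. v = g ^ i"
    using finite_field_cyclic[OF finite_res_field[OF P(1)] res_field_closed[OF P(1)]] by blast
  then obtain u where u: "u \<in> A" "g = ev P u" by (auto simp: res_field_def)
  obtain n where n: "ev P' u = g ^ p ^ n" using conjugate_values[OF P _ u(1)] ker u by auto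
  have *: "ev P' w = ev P w ^ p ^ n" if w: "w \<in> A" for w
  proof (cases "ev P w = 0")
    case True thus ?thesis using ker[OF w] p_pos by simp
  next
    case False
    then obtain i where i: "ev P w = g ^ i" using g(2)[of "ev P w"] w by (auto simp: res_field_def)
    hence "ev P (w - u ^ i) = 0" using P u w by (simp add: ev_diff ev_power A_power)
    hence "ev P' (w - u ^ i) = 0" using ker u w by (simp add: A_diff A_power)
    hence "ev P' w = (g ^ p ^ n) ^ i" using P u w n by (simp add: ev_diff ev_power A_power)
    thus ?thesis unfolding i by (simp add: mult.commute flip: power_mult)
  qed
  have "P' = (frp ^^ n) P"
    using *[OF A_x] *[OF A_y] P by (cases P, cases P') (simp add: ev_x ev_y funpow_frp)
  hence "P' \<in> curve.orb P" by (auto simp: curve.orb_def)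
  thus "curve.orb P = curve.orb P'" by (simp add: curve.orb_eqI)
qed

lemma place_degree_card:
  fixes r :: "'k ambient \<Rightarrow> 'x"
  assumes R: "\<And>u v. u \<in> R \<Longrightarrow> v \<in> R \<Longrightarrow> u + v \<in> R" "0 \<in> R" "\<And>c u. u \<in> R \<Longrightarrow> const c * u \<in> R"
    and m: "\<And>u v. u \<in> max_ideal R \<Longrightarrow> v \<in> max_ideal R \<Longrightarrow> u + v \<in> max_ideal R" "\<And>c u. u \<in> max_ideal R \<Longrightarrow> const c * u \<in> max_ideal R"
    and r: "\<And>u v. u \<in> R \<Longrightarrow> v \<in> R \<Longrightarrow> r u = r v \<longleftrightarrow> u - v \<in> max_ideal R" and fin: "finite (r ` R)"
  shows "p ^ place_degree R = card (r ` R)"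
proof -
  define m' where "m' = max_ideal R"
  have Rsum: "(\<Sum>b\<in>B. const (c b) * b) \<in> R" if "B \<subseteq> R" for B c
    using that R by (induction B rule: infinite_finite_induct) auto
  have m0: "0 \<in> m'" using R(2) by (simp add: m'_def max_ideal_def)
  have mneg: "- u \<in> m'" if "u \<in> m'" for u
  proof -
    have "const (- 1) * u \<in> m'" using m(2) that by (simp add: m'_def)
    moreover have "const (- 1) = (- 1 :: 'k ambient)" using const.diff[of 0 1] by (simp add: const.zero const.one)
    ultimately show ?thesis by simp
  qed
  have mdiff: "u - v \<in> m'" if "u \<in> m'" "v \<in> m'" for u v using m(1)[of u "- v"] mneg that by (simp add: m'_def)
  define spans where "spans B \<longleftrightarrow> B \<subseteq> R \<and> finite B \<and> (\<forall>z\<in>R. \<exists>c. z - (\<Sum>b\<in>B. const (c b) * b) \<in> m')" for B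
  define basis where "basis B \<longleftrightarrow> B \<subseteq> R \<and> finite B \<and> (\<forall>z\<in>R. \<exists>!c. c \<in> B \<rightarrow>\<^sub>E UNIV \<and> z - (\<Sum>b\<in>B. const (c b) * b) \<in> m')" for B
  have card_basis: "p ^ card B = card (r ` R)" if B: "basis B" for B
  proof -
    define h where "h c = r (\<Sum>b\<in>B. const (c b) * b)" for c
    have B': "B \<subseteq> R" "finite B" using B by (auto simp: basis_def)
    have "bij_betw h (B \<rightarrow>\<^sub>E UNIV) (r ` R)"
      unfolding bij_betw_def
    proof (intro conjI inj_onI equalityI subsetI)
      fix c d assume cd: "c \<in> B \<rightarrow>\<^sub>E UNIV" "d \<in> B \<rightarrow>\<^sub>E UNIV" "h c = h d"
      let ?z = "\<Sum>b\<in>B. const (c b) * b"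
      have "?z - (\<Sum>b\<in>B. const (d b) * b) \<in> m'" using cd(3) r Rsum[OF B'(1)] by (simp add: h_def m'_def)
      moreover have "?z - ?z \<in> m'" using m0 by simp
      ultimately show "c = d" using B Rsum[OF B'(1), of c] cd unfolding basis_def by blast
    next
      fix v assume "v \<in> r ` R"
      then obtain z where z: "z \<in> R" "v = r z" by blast
      then obtain c where "c \<in> B \<rightarrow>\<^sub>E UNIV" "z - (\<Sum>b\<in>B. const (c b) * b) \<in> m'" using B unfolding basis_def by blast
      thus "v \<in> h ` (B \<rightarrow>\<^sub>E UNIV)" using z r Rsum[OF B'(1)] by (auto simp: h_def m'_def intro!: image_eqI)
    qed (use Rsum[OF B'(1)] in \<open>auto simp: h_def\<close>)
    hence "card (B \<rightarrow>\<^sub>E (UNIV :: 'k set)) = card (r ` R)" by (rule bij_betw_same_card)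
    thus ?thesis using B' by (simp add: card_PiE card_k)
  qed
  define g where "g v = (SOME z. z \<in> R \<and> r z = v)" for v
  have g: "g v \<in> R \<and> r (g v) = v" if "v \<in> r ` R" for v
    unfolding g_def by (rule someI_ex) (use that in blast)
  have "spans (g ` r ` R)" unfolding spans_def
  proof (intro conjI ballI)
    fix z assume z: "z \<in> R"
    have "(\<Sum>b\<in>g ` r ` R. const (if b = g (r z) then 1 else 0) * b) = (\<Sum>b\<in>g ` r ` R. if b = g (r z) then g (r z) else 0)"
      by (intro sum.cong) (auto simp: const.one const.zero)
    also have "\<dots> = g (r z)" using fin z by simp
    finally show "\<exists>c. z - (\<Sum>b\<in>g ` r ` R. const (c b) * b) \<in> m'"
      using g[of "r z"] r[of z "g (r z)"] z by (intro exI[of _ "\<lambda>b. if b = g (r z) then 1 else 0"]) (auto simp: m'_def)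
  qed (use g fin in auto)
  \<comment> \<open>The set of one representative per class spans, so a least spanning set
    exists.\<close>
  then obtain B where B: "spans B" and min: "\<And>B'. spans B' \<Longrightarrow> card B \<le> card B'"
    using ex_has_least_nat[of spans _ card] by blast
  have BR: "B \<subseteq> R" "finite B" using B by (auto simp: spans_def)
  have "basis B" unfolding basis_def
  proof (intro conjI BR ballI)
    fix z assume z: "z \<in> R"
    obtain c where c: "z - (\<Sum>b\<in>B. const (c b) * b) \<in> m'" using B z by (auto simp: spans_def)
    show "\<exists>!c. c \<in> B \<rightarrow>\<^sub>E UNIV \<and> z - (\<Sum>b\<in>B. const (c b) * b) \<in> m'"
    proof (rule ex1I[of _ "restrict c B"])
      show "restrict c B \<in> B \<rightarrow>\<^sub>E UNIV \<and> z - (\<Sum>b\<in>B. const (restrict c B b) * b) \<in> m'" using c by auto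
      fix d assume d: "d \<in> B \<rightarrow>\<^sub>E UNIV \<and> z - (\<Sum>b\<in>B. const (d b) * b) \<in> m'"
      show "d = restrict c B"
      proof (rule ccontr)
        assume "d \<noteq> restrict c B"
        then obtain b0 where b0: "b0 \<in> B" "d b0 \<noteq> c b0" using d by (auto simp: fun_eq_iff PiE_def extensional_def restrict_def split: if_splits)
        define e where "e b = d b - c b" for b
        define i where "i = inverse (e b0)"
        have e0: "e b0 \<noteq> 0" using b0 by (simp add: e_def)
        have "(\<Sum>b\<in>B. const (e b) * b) \<in> m'"
          using mdiff[OF c conjunct2[OF d]] by (simp add: e_def const.diff left_diff_distrib sum_subtractf)
        hence "const i * (\<Sum>b\<in>B. const (e b) * b) \<in> m'" using m(2) by (simp add: m'_def)
        hence "(\<Sum>b\<in>B. const (i * e b) * b) \<in> m'" by (simp add: sum_distrib_left const.mult mult.assoc)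
        hence rel: "b0 + (\<Sum>b\<in>B - {b0}. const (i * e b) * b) \<in> m'"
          using BR b0 e0 by (simp add: sum.remove[of B b0] i_def const.one)
        \<comment> \<open>A second representation makes \<open>b0\<close> a combination of the
          others modulo \<open>m'\<close>, against minimality.\<close>
        have "spans (B - {b0})" unfolding spans_def
        proof (intro conjI ballI)
          fix w assume w: "w \<in> R"
          obtain f where f: "w - (\<Sum>b\<in>B. const (f b) * b) \<in> m'" using B w by (auto simp: spans_def)
          have "const (f b0) * (b0 + (\<Sum>b\<in>B - {b0}. const (i * e b) * b)) \<in> m'" using rel m(2) by (simp add: m'_def)
          hence "(w - (\<Sum>b\<in>B. const (f b) * b)) + const (f b0) * (b0 + (\<Sum>b\<in>B - {b0}. const (i * e b) * b)) \<in> m'"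
            using f m(1) by (simp add: m'_def)
          also have "(w - (\<Sum>b\<in>B. const (f b) * b)) + const (f b0) * (b0 + (\<Sum>b\<in>B - {b0}. const (i * e b) * b))
            = w - (\<Sum>b\<in>B - {b0}. const (f b - f b0 * (i * e b)) * b)"
            using BR b0 by (simp add: sum.remove[of B b0] distrib_left const.diff const.mult left_diff_distrib sum_subtractf sum_distrib_left mult.assoc)
          finally show "\<exists>c. w - (\<Sum>b\<in>B - {b0}. const (c b) * b) \<in> m'" by (intro exI[of _ "\<lambda>b. f b - f b0 * (i * e b)"])
        qed (use BR in auto)
        hence "card B \<le> card (B - {b0})" by (rule min)
        thus False using card_Diff1_less[OF BR(2) b0(1)] by simp
      qed
    qed
  qed
  have "place_degree R = card B" unfolding place_degree_def
  proof (rule the_equality)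
    show "\<exists>B'. B' \<subseteq> R \<and> finite B' \<and> card B' = card B \<and> (\<forall>z\<in>R. \<exists>!c. c \<in> B' \<rightarrow>\<^sub>E UNIV \<and> z - (\<Sum>b\<in>B'. const (c b) * b) \<in> max_ideal R)"
      using \<open>basis B\<close> unfolding basis_def m'_def by blast
    fix d assume "\<exists>B'. B' \<subseteq> R \<and> finite B' \<and> card B' = d \<and> (\<forall>z\<in>R. \<exists>!c. c \<in> B' \<rightarrow>\<^sub>E UNIV \<and> z - (\<Sum>b\<in>B'. const (c b) * b) \<in> max_ideal R)"
    then obtain B' where "basis B'" "card B' = d" unfolding basis_def m'_def by blast
    hence "p ^ d = p ^ card B" using card_basis \<open>basis B\<close> by metis
    thus "d = card B" using p_gt_1 by simp
  qed
  thus ?thesis using card_basis[OF \<open>basis B\<close>] by simp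
qed

lemma place_m_closed:
  assumes "R = inf_ring \<or> (\<exists>P\<in>pts. R = loc P)"
  shows "u \<in> max_ideal R \<Longrightarrow> v \<in> max_ideal R \<Longrightarrow> u + v \<in> max_ideal R"
    and "u \<in> max_ideal R \<Longrightarrow> v \<in> R \<Longrightarrow> v * u \<in> max_ideal R"
    and "u \<in> max_ideal R \<Longrightarrow> v \<in> max_ideal R \<Longrightarrow> u - v \<in> max_ideal R"
    and "1 \<notin> max_ideal R" and "0 \<in> max_ideal R"
proof -
  obtain t where "dvr K R t" using assms inf_dvr loc_dvr by blast
  then interpret dvr K R t .
  show "u \<in> max_ideal R \<Longrightarrow> v \<in> max_ideal R \<Longrightarrow> u + v \<in> max_ideal R"
    unfolding max_ideal_eq using add by (auto simp flip: distrib_left)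
  show "u \<in> max_ideal R \<Longrightarrow> v \<in> max_ideal R \<Longrightarrow> u - v \<in> max_ideal R"
    unfolding max_ideal_eq using diff by (auto simp flip: right_diff_distrib)
  show "u \<in> max_ideal R \<Longrightarrow> v \<in> R \<Longrightarrow> v * u \<in> max_ideal R"
    unfolding max_ideal_eq using mult by (auto simp: mult.left_commute)
  show "1 \<notin> max_ideal R" "0 \<in> max_ideal R" using one zero by (simp_all add: max_ideal_def)
qed

text \<open>The denominator is removed within the residue field: \<open>1 / w\<close> is congruent
  to \<open>w^(n - 1)\<close> when \<open>w^n\<close> has value 1.\<close>

lemma residue_rep:
  assumes P: "P \<in> pts" "z \<in> loc P"
  shows "\<exists>u\<in>A. z - u \<in> max_ideal (loc P)"
proof -
  obtain u w where uw: "z = u / w" "u \<in> A" "w \<in> A" "ev P w \<noteq> 0" using P by (auto simp: loc_def)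
  obtain n where n: "n > 0" "ev P (1 - w ^ n) = 0" using one_minus_power_vanishes P uw by blast
  have w0: "w \<noteq> 0" using uw(4) ev_0[OF P(1)] by auto
  have "w ^ n = w * w ^ (n - 1)" using n by (metis Suc_diff_1 power_Suc)
  hence "z - u * w ^ (n - 1) = (u / w) * (1 - w ^ n)" using w0 uw by (simp add: field_simps)
  moreover have "1 - w ^ n \<in> max_ideal (loc P)" using n P uw by (subst in_max_ideal_loc) (auto simp: A_diff A_1 A_power)
  ultimately have "z - u * w ^ (n - 1) \<in> max_ideal (loc P)"
    using place_m_closed(2)[of "loc P" "1 - w ^ n" "u / w"] P uw(1) by auto
  thus ?thesis using uw A_mult A_power by blast
qed

text \<open>Let \<open>s\<close> be the period of \<open>P\<close>. The residue field lies in the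
  field with \<open>p^s\<close> elements, so its degree \<open>d\<close> is at most
  \<open>s\<close>. Its elements are fixed by the \<open>d\<close>-th Frobenius power, and it
  contains both coordinates of \<open>P\<close>, so \<open>s\<close> divides
  \<open>d\<close>.\<close>

lemma card_residue_loc:
  assumes P: "P \<in> pts"
  shows "card ((\<lambda>z. {w \<in> loc P. w - z \<in> max_ideal (loc P)}) ` loc P) = p ^ curve.per P"
    and "place_degree (loc P) = curve.per P"
proof -
  define m where "m = max_ideal (loc P)"
  note mc = place_m_closed[of "loc P", folded m_def]
  have ex: "\<exists>P'\<in>pts. loc P = loc P'" using P by blast
  have LR: "u + v \<in> loc P" "u - v \<in> loc P" "u * v \<in> loc P" if "u \<in> loc P" "v \<in> loc P" for u v
    using loc_ring[OF P] that by auto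
  define r where "r z = ev P (SOME u. u \<in> A \<and> z - u \<in> m)" for z
  have r: "\<exists>u\<in>A. z - u \<in> m \<and> r z = ev P u" if "z \<in> loc P" for z
  proof -
    have "\<exists>u. u \<in> A \<and> z - u \<in> m" using residue_rep[OF P that] by (auto simp: m_def)
    from someI_ex[OF this] show ?thesis unfolding r_def by blast
  qed
  have r_eq: "r z = r z' \<longleftrightarrow> z - z' \<in> m" if z: "z \<in> loc P" "z' \<in> loc P" for z z'
  proof -
    obtain u u' where u: "u \<in> A" "z - u \<in> m" "r z = ev P u" "u' \<in> A" "z' - u' \<in> m" "r z' = ev P u'" using r z by metis
    have "r z = r z' \<longleftrightarrow> u - u' \<in> m" using u P in_max_ideal_loc[OF P A_diff[OF u(1,4)]] by (simp add: ev_diff m_def)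
    also have "\<dots> \<longleftrightarrow> z - z' \<in> m"
    proof
      assume "u - u' \<in> m"
      hence "(u - u') + (z - u) - (z' - u') \<in> m" using u mc(1,3) ex by blast
      thus "z - z' \<in> m" by simp
    next
      assume "z - z' \<in> m"
      hence "(z - z') - (z - u) + (z' - u') \<in> m" using u mc(1,3) ex by blast
      thus "u - u' \<in> m" by simp
    qed
    finally show ?thesis .
  qed
  have rA: "r u = ev P u" if u: "u \<in> A" for u
  proof -
    obtain v where v: "v \<in> A" "u - v \<in> m" "r u = ev P v" using r A_sub_loc[OF P] u by blast
    thus ?thesis using in_max_ideal_loc[OF P A_diff[OF u v(1)]] P u by (simp add: ev_diff m_def)
  qed
  have img: "r ` loc P = res_field P"
    unfolding res_field_def using r rA A_sub_loc[OF P] by (force simp: image_iff)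
  have c: "p ^ place_degree (loc P) = card (res_field P)"
    unfolding img[symmetric]
  proof (rule place_degree_card)
    show "0 \<in> loc P" using A_sub_loc[OF P] A_0 by blast
    show "const c * u \<in> loc P" if "u \<in> loc P" for c u
      using LR(3)[OF _ that, of "const c"] A_sub_loc[OF P] A_const[of c] by auto
    show "const c * u \<in> max_ideal (loc P)" if "u \<in> max_ideal (loc P)" for c u
      using mc(2)[of u "const c"] that A_sub_loc[OF P] A_const ex by (auto simp: m_def)
  qed (use LR mc r_eq ex img finite_res_field[OF P] in \<open>auto simp: m_def\<close>)
  define d where "d = place_degree (loc P)"
  let ?s = "curve.per P"
  have "res_field P \<subseteq> {z. z ^ p ^ ?s = z}" using res_field_fixed[OF P] by blast
  hence "p ^ d \<le> p ^ ?s" unfolding d_def c using card_mono[OF finite_frobenius_fixed[OF curve.per_pos]] card_frobenius_fixed[OF curve.per_pos] by metis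
  hence ds: "d \<le> ?s" using p_gt_1 by simp
  \<comment> \<open>Multiplication by \<open>v\<close> permutes the \<open>p^d - 1\<close> nonzero
    elements; comparing products gives \<open>v^(p^d - 1) = 1\<close>.\<close>
  have fixed: "v ^ p ^ d = v" if v: "v \<in> res_field P" for v
  proof (cases "v = 0")
    case True thus ?thesis using p_pos by simp
  next
    case False
    define V where "V = res_field P - {0}"
    have fin: "finite V" using finite_res_field[OF P] by (simp add: V_def)
    have "(\<lambda>w. v * w) ` V = V"
    proof (rule card_subset_eq[OF fin])
      show "(\<lambda>w. v * w) ` V \<subseteq> V" using res_field_closed(5)[OF P v] False by (auto simp: V_def)
      show "card ((\<lambda>w. v * w) ` V) = card V" using False by (intro card_image) (auto simp: inj_on_def)
    qed
    hence "(\<Prod>w\<in>V. w) = (\<Prod>w\<in>(\<lambda>w. v * w) ` V. w)" by simp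
    also have "\<dots> = (\<Prod>w\<in>V. v * w)" using False by (subst prod.reindex) (auto simp: inj_on_def)
    also have "\<dots> = v ^ card V * (\<Prod>w\<in>V. w)" by (simp add: prod.distrib)
    finally have "v ^ card V = 1" using fin by (auto simp: V_def)
    moreover have "card V = p ^ d - 1" using finite_res_field[OF P] res_field_closed(1)[OF P] c by (simp add: V_def d_def)
    ultimately show ?thesis using power_p_minus_1[of v d] by simp
  qed
  have "fst P \<in> res_field P" "snd P \<in> res_field P"
    unfolding res_field_def using ev_x[OF P] ev_y[OF P] A_x A_y by (metis imageI)+
  hence "?s dvd d" using fixed curve_per_dvd[of "fst P" "snd P" d] by simp
  moreover have "d \<noteq> 0"
  proof
    assume "d = 0"
    hence "card (res_field P) = 1" using c by (simp add: d_def)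
    thus False using res_field_closed(1,2)[OF P] by (metis card_1_singletonE singletonD zero_neq_one)
  qed
  ultimately have "d = ?s" using ds by (meson dvd_imp_le le_antisym not_gr_zero)
  thus deg: "place_degree (loc P) = ?s" by (simp add: d_def)
  have "card ((\<lambda>z. {w \<in> loc P. w - z \<in> m}) ` loc P) = card (r ` loc P)"
  proof (rule bij_betw_same_card[of "\<lambda>C. r (SOME w. w \<in> C)"])
    have cls: "r (SOME w. w \<in> {w \<in> loc P. w - z \<in> m}) = r z" if z: "z \<in> loc P" for z
    proof -
      have "z \<in> {w \<in> loc P. w - z \<in> m}" using z mc(5) ex by simp
      hence "(SOME w. w \<in> {w \<in> loc P. w - z \<in> m}) \<in> {w \<in> loc P. w - z \<in> m}" by (rule someI)
      thus ?thesis using r_eq z by blast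
    qed
    have eq: "{w \<in> loc P. w - z \<in> m} = {w \<in> loc P. r w = r z}" if "z \<in> loc P" for z using r_eq that by auto
    show "bij_betw (\<lambda>C. r (SOME w. w \<in> C)) ((\<lambda>z. {w \<in> loc P. w - z \<in> m}) ` loc P) (r ` loc P)"
      unfolding bij_betw_def
    proof (intro conjI inj_onI)
      fix C D assume "C \<in> (\<lambda>z. {w \<in> loc P. w - z \<in> m}) ` loc P" "D \<in> (\<lambda>z. {w \<in> loc P. w - z \<in> m}) ` loc P"
        "r (SOME w. w \<in> C) = r (SOME w. w \<in> D)"
      then obtain z z' where "z \<in> loc P" "z' \<in> loc P" "C = {w \<in> loc P. w - z \<in> m}" "D = {w \<in> loc P. w - z' \<in> m}" "r z = r z'"
        using cls by auto
      thus "C = D" using eq by simp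
    qed (use cls in \<open>force simp: image_image\<close>)
  qed
  thus "card ((\<lambda>z. {w \<in> loc P. w - z \<in> max_ideal (loc P)}) ` loc P) = p ^ curve.per P"
    using img c deg by (simp add: m_def)
qed

text \<open>Modulo the maximal ideal, a quotient of functions of equal pole order is the quotient of
  their leading coefficients, a constant.\<close>

lemma place_degree_inf: "place_degree inf_ring = 1"
proof -
  define m where "m = max_ideal inf_ring"
  note mc = place_m_closed[of inf_ring, folded m_def, OF disjI1[OF refl]]
  have cR: "const c \<in> inf_ring" for c using const_in_R[OF inf_place] .
  have ex: "\<exists>c. z - const c \<in> m" if z: "z \<in> inf_ring" for z
  proof -
    obtain u w where uw: "z = u / w" "u \<in> A" "w \<in> A" "w \<noteq> 0" "pole u \<le> pole w" using z by (auto simp: inf_ring_def)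
    have small: "v / w \<in> m" if v: "v \<in> A" "v = 0 \<or> pole v < pole w" for v
    proof (cases "v = 0")
      case True thus ?thesis using mc(5) by simp
    next
      case False
      obtain t where t: "dvr K inf_ring t" and val: "\<And>u w. u \<in> A \<Longrightarrow> w \<in> A \<Longrightarrow> u \<noteq> 0 \<Longrightarrow> w \<noteq> 0 \<Longrightarrow> place_val inf_ring (u / w) = int (pole w) - int (pole u)"
        using inf_dvr by blast
      interpret dvr K inf_ring t by (rule t)
      show ?thesis using in_max_ideal_iff[of "v / w"] K_divide[of v w] uw v False val[of v w] by (simp add: m_def)
    qed
    show ?thesis
    proof (cases "pole u = pole w")
      case False
      thus ?thesis using small[of u] uw by (intro exI[of _ 0]) (simp add: const.zero)
    next
      case True
      show ?thesis
      proof (cases "pole w")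
        case 0
        then obtain c c' where c: "u = const c" "w = const c'" using pole_0_const uw True by metis
        hence "z - const (c * inverse c') = 0" using uw by (simp add: const.mult const_inverse divide_inverse)
        thus ?thesis using mc(5) by metis
      next
        case (Suc n)
        then obtain c where c: "u - const c * w \<in> Fil n" using cancel_leading[of u w n] uw True by auto
        have "(u - const c * w) / w \<in> m" using c Suc by (intro small) (auto simp: Fil_def)
        moreover have "z - const c = (u - const c * w) / w" using uw by (simp add: diff_divide_distrib)
        ultimately show ?thesis by metis
      qed
    qed
  qed
  have m_const: "c = 0" if "const c \<in> m" for c
  proof (rule ccontr)
    assume "c \<noteq> 0"
    hence "const (inverse c) * const c \<in> m" using mc(2) that cR by blast
    thus False using \<open>c \<noteq> 0\<close> mc(4) by (simp add: const.one flip: const.mult)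
  qed
  define r where "r z = (SOME c. z - const c \<in> m)" for z
  have r: "z - const (r z) \<in> m" if "z \<in> inf_ring" for z unfolding r_def by (rule someI_ex[OF ex[OF that]])
  have r_eq: "r z = r z' \<longleftrightarrow> z - z' \<in> m" if z: "z \<in> inf_ring" "z' \<in> inf_ring" for z z'
  proof
    assume "r z = r z'"
    thus "z - z' \<in> m" using mc(3)[OF r[OF z(1)] r[OF z(2)]] by simp
  next
    assume "z - z' \<in> m"
    hence "(z - z') - (z - const (r z)) + (z' - const (r z')) \<in> m" using mc(1,3) r z by blast
    hence "const (r z - r z') \<in> m" by (simp add: const.diff)
    thus "r z = r z'" using m_const by fastforce
  qed
  have rc: "r (const c) = c" for c
  proof -
    have "const (c - r (const c)) \<in> m" using r[OF cR] by (simp add: const.diff)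
    thus ?thesis using m_const by fastforce
  qed
  hence img: "r ` inf_ring = UNIV" using cR by (metis UNIV_eq_I image_eqI)
  have "p ^ place_degree inf_ring = card (r ` inf_ring)"
    by (rule place_degree_card) (use inf_ring_ring cR mc r_eq in \<open>auto simp: m_def const.zero[symmetric]\<close>)
  also have "\<dots> = p ^ 1" using img card_k by simp
  finally show ?thesis using power_inject_exp[OF p_gt_1] by blast
qed

lemma maximal_ideal_exists:
  assumes I: "A_ideal I" "1 \<notin> I"
  shows "\<exists>M. A_prime M \<and> I \<subseteq> M"
proof -
  define F where "F = {M. A_ideal M \<and> 1 \<notin> M \<and> I \<subseteq> M}"
  have "\<exists>M\<in>F. \<forall>J\<in>F. M \<subseteq> J \<longrightarrow> J = M"
  proof (rule subset_Zorn_nonempty)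
    show "F \<noteq> {}" using I by (auto simp: F_def)
    fix C assume C: "C \<noteq> {}" "subset.chain F C"
    hence CF: "C \<subseteq> F" and tot: "\<And>J J'. J \<in> C \<Longrightarrow> J' \<in> C \<Longrightarrow> J \<subseteq> J' \<or> J' \<subseteq> J" by (auto simp: subset.chain_def)
    have "u + v \<in> \<Union> C" if "u \<in> \<Union> C" "v \<in> \<Union> C" for u v
    proof -
      obtain J J' where "J \<in> C" "J' \<in> C" "u \<in> J" "v \<in> J'" using \<open>u \<in> \<Union> C\<close> \<open>v \<in> \<Union> C\<close> by blast
      then obtain L where "L \<in> C" "u \<in> L" "v \<in> L" using tot by blast
      moreover from this have "u + v \<in> L" using CF by (auto simp: F_def A_ideal_def)
      ultimately show ?thesis by blast
    qed
    moreover have "u * v \<in> \<Union> C" if "u \<in> \<Union> C" "v \<in> A" for u v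
    proof -
      obtain J where "J \<in> C" "u \<in> J" using \<open>u \<in> \<Union> C\<close> by blast
      moreover from this have "u * v \<in> J" using CF \<open>v \<in> A\<close> by (auto simp: F_def A_ideal_def)
      ultimately show ?thesis by blast
    qed
    moreover have "0 \<in> \<Union> C" "\<Union> C \<subseteq> A" "1 \<notin> \<Union> C" "I \<subseteq> \<Union> C" using C CF by (auto simp: F_def A_ideal_def)
    ultimately show "\<Union> C \<in> F" by (simp add: F_def A_ideal_def)
  qed
  then obtain M where M: "A_ideal M" "1 \<notin> M" "I \<subseteq> M" and max: "\<And>J. J \<in> F \<Longrightarrow> M \<subseteq> J \<Longrightarrow> J = M" by (auto simp: F_def)
  have "A_prime M" unfolding A_prime_def
  proof (intro conjI M ballI impI)
    fix u v assume uv: "u \<in> A" "v \<in> A" "u * v \<in> M"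
    show "u \<in> M \<or> v \<in> M"
    proof (rule ccontr)
      assume n: "\<not> (u \<in> M \<or> v \<in> M)"
      define J where "J = {m + u * b |m b. m \<in> M \<and> b \<in> A}"
      have MA: "M \<subseteq> A" using M by (simp add: A_ideal_def)
      have MJ: "M \<subseteq> J" unfolding J_def using A_0 by force
      have "u \<in> J" unfolding J_def using M(1) A_1 by (force simp: A_ideal_def)
      have "A_ideal J" unfolding A_ideal_def
      proof (intro conjI ballI)
        show "J \<subseteq> A" using MA uv A_add A_mult by (auto simp: J_def)
        show "0 \<in> J" using MJ M(1) by (auto simp: A_ideal_def)
        fix w assume "w \<in> J"
        then obtain m b where w: "w = m + u * b" "m \<in> M" "b \<in> A" by (auto simp: J_def)
        show "w + w' \<in> J" if "w' \<in> J" for w'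
        proof -
          obtain m' b' where w': "w' = m' + u * b'" "m' \<in> M" "b' \<in> A" using \<open>w' \<in> J\<close> by (auto simp: J_def)
          have "w + w' = (m + m') + u * (b + b')" by (simp add: w w' algebra_simps)
          moreover have "m + m' \<in> M" "b + b' \<in> A" using w w' M(1) A_add by (auto simp: A_ideal_def)
          ultimately show ?thesis unfolding J_def by blast
        qed
        show "w * c \<in> J" if "c \<in> A" for c
        proof -
          have "w * c = m * c + u * (b * c)" by (simp add: w algebra_simps)
          moreover have "m * c \<in> M" "b * c \<in> A" using w that M(1) A_mult by (auto simp: A_ideal_def)
          ultimately show ?thesis unfolding J_def by blast
        qed
      qed
      moreover have "J \<noteq> M" using \<open>u \<in> J\<close> n by blast
      ultimately have "1 \<in> J" using max[of J] MJ M(3) by (auto simp: F_def)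
      then obtain m b where mb: "1 = m + u * b" "m \<in> M" "b \<in> A" by (auto simp: J_def)
      have "v = (m + u * b) * v" using mb(1) by simp
      hence "v = m * v + (u * v) * b" by (simp add: algebra_simps)
      moreover have "m * v \<in> M" "(u * v) * b \<in> M" using mb uv M(1) by (auto simp: A_ideal_def)
      ultimately have "v \<in> M" using M(1) unfolding A_ideal_def by metis
      thus False using n by blast
    qed
  qed
  thus ?thesis using M by blast
qed

text \<open>The denominators of \<open>z\<close> form a nonzero ideal. If it were proper, a maximal
  ideal above it would be the kernel of a point \<open>P\<close>, but at \<open>P\<close> some
  denominator does not vanish.\<close>

lemma A_eq_Inter_loc:
  assumes z: "z \<in> K" and loc: "\<And>P. P \<in> pts \<Longrightarrow> z \<in> loc P"
  shows "z \<in> A"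
proof -
  define I where "I = {b \<in> A. b * z \<in> A}"
  obtain u w where uw: "z = u / w" "u \<in> A" "w \<in> A" "w \<noteq> 0" using z by (auto simp: K_eq)
  have wI: "w \<in> I" using uw by (simp add: I_def)
  have I: "A_ideal I" unfolding A_ideal_def
  proof (intro conjI ballI)
    show "b * c \<in> I" if "b \<in> I" "c \<in> A" for b c
    proof -
      have "b * c * z = b * z * c" by simp
      moreover have "b * z * c \<in> A" "b * c \<in> A" using that A_mult by (auto simp: I_def)
      ultimately show ?thesis unfolding I_def by (metis (mono_tags, lifting) mem_Collect_eq)
    qed
  qed (auto simp: I_def A_0 A_add distrib_right)
  have "1 \<in> I"
  proof (rule ccontr)
    assume "1 \<notin> I"
    then obtain M where M: "A_prime M" "I \<subseteq> M" using maximal_ideal_exists[OF I] by blast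
    then obtain P where P: "P \<in> pts" "M = {u \<in> A. ev P u = 0}" using prime_is_point[OF M(1), of w] wI uw(4) by blast
    obtain b c where bc: "z = b / c" "b \<in> A" "c \<in> A" "ev P c \<noteq> 0" using loc[OF P(1)] by (auto simp: loc_def)
    have "c \<noteq> 0" using bc ev_0[OF P(1)] by auto
    hence "c \<in> I" using bc by (simp add: I_def)
    thus False using M P bc by blast
  qed
  thus ?thesis by (simp add: I_def)
qed

end

section \<open>Counting functions with prescribed zeros\<close>

context dvr
begin

text \<open>Multiplication by \<open>t powi (- n)\<close> reduces the bound to closure of
  \<open>R\<close> under addition.\<close>

lemma val_add:
  assumes "z \<in> K" "w \<in> K" "z = 0 \<or> n \<le> val z" "w = 0 \<or> n \<le> val w" "z + w \<noteq> 0"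
  shows "n \<le> val (z + w)"
proof -
  have tn: "t powi (- n) \<in> K" "t powi (- n) \<noteq> 0" "val (t powi (- n)) = - n"
  proof -
    have "x ^ i \<in> K" if "x \<in> K" for x i using K that by (induction i) (auto simp: is_subfield_def)
    thus "t powi (- n) \<in> K" using K R_sub t(1) by (auto simp: power_int_def is_subfield_def)
    show "t powi (- n) \<noteq> 0" using t(2) by simp
    show "val (t powi (- n)) = - n" using val_eq[OF unit_1, of "- n"] by simp
  qed
  have in_R: "x * t powi (- n) \<in> R" if "x \<in> K" "x = 0 \<or> n \<le> val x" for x
  proof (cases "x = 0")
    case False
    have "x * t powi (- n) \<in> K" using K that tn by (simp add: is_subfield_def)
    thus ?thesis using in_R_iff[of "x * t powi (- n)"] that tn False val_mult[of x "t powi (- n)"] by simp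
  qed (simp add: zero)
  have zwK: "z + w \<in> K" using K assms by (simp add: is_subfield_def)
  have "(z + w) * t powi (- n) \<in> R" using add[OF in_R in_R] assms by (simp add: distrib_right)
  moreover have "(z + w) * t powi (- n) \<in> K" using K zwK tn by (simp add: is_subfield_def)
  ultimately have "0 \<le> val ((z + w) * t powi (- n))" using in_R_iff assms(5) tn(2) by (metis mult_eq_0_iff)
  thus ?thesis using val_mult[OF zwK tn(1) assms(5) tn(2)] tn(3) by simp
qed

end

lemma card_eq_fibres:
  assumes "finite S" "\<And>u. u \<in> S \<Longrightarrow> card {v \<in> S. f v = f u} = h"
  shows "card S = card (f ` S) * h"
proof -
  have "card S = (\<Sum>c\<in>f ` S. card {v \<in> S. f v = c})"
    using sum.image_gen[OF assms(1), of "\<lambda>_. 1 :: nat" f] by simp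
  also have "\<dots> = (\<Sum>c\<in>f ` S. h)" using assms(2) by (intro sum.cong) auto
  finally show ?thesis by simp
qed

context superelliptic
begin

section \<open>Valuations at the places, and cardinalities of the filtration\<close>

lemma place_dvr: "R \<in> places K \<Longrightarrow> \<exists>t. dvr K R t"
  using place_classification inf_dvr loc_dvr by blast

lemma pv_mult: "R \<in> places K \<Longrightarrow> z \<in> K \<Longrightarrow> w \<in> K \<Longrightarrow> z \<noteq> 0 \<Longrightarrow> w \<noteq> 0 \<Longrightarrow> place_val R (z * w) = place_val R z + place_val R w"
  using place_dvr dvr.val_mult by metis

lemma K_inverse: "z \<in> K \<Longrightarrow> inverse z \<in> K"
  using K_field by (auto simp: is_subfield_def)

lemma pv_divide: "R \<in> places K \<Longrightarrow> z \<in> K \<Longrightarrow> w \<in> K \<Longrightarrow> z \<noteq> 0 \<Longrightarrow> w \<noteq> 0 \<Longrightarrow> place_val R (z / w) = place_val R z - place_val R w"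
  using pv_mult[of R z "inverse w"] place_dvr[of R] dvr.val_inverse[of K R _ w] K_inverse by (auto simp: divide_inverse)

lemma pv_power: "R \<in> places K \<Longrightarrow> z \<in> K \<Longrightarrow> z \<noteq> 0 \<Longrightarrow> place_val R (z ^ n) = int n * place_val R z"
  using place_dvr dvr.val_power by metis

lemma pv_const: "R \<in> places K \<Longrightarrow> c \<noteq> 0 \<Longrightarrow> place_val R (const c) = 0"
proof -
  assume R: "R \<in> places K" and c: "c \<noteq> 0"
  then obtain t where "dvr K R t" using place_dvr by blast
  then interpret dvr K R t .
  have "const c \<in> R" "inverse (const c) \<in> R" "const c \<noteq> 0"
    using const_in_R[OF R] c by (auto simp: const_eq_0_iff simp flip: const_inverse)
  hence "unit (const c)" by (simp add: unit_def)
  thus ?thesis using val_eq[of "const c" 0] by simp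
qed

definition Aff :: "'k ambient set set" where "Aff = loc ` pts"

lemma places_eq: "places K = insert inf_ring Aff"
  using place_classification loc_place inf_place by (auto simp: Aff_def)

lemma Aff_places: "R \<in> Aff \<Longrightarrow> R \<in> places K" and inf_not_Aff: "inf_ring \<notin> Aff"
  using loc_place loc_neq_inf unfolding Aff_def by (blast, metis imageE)

lemma AffE:
  assumes "R \<in> Aff" obtains P t where "P \<in> pts" "R = loc P" "t \<in> A" "dvr K R t"
  using assms loc_dvr unfolding Aff_def by blast

lemma pv_nonneg: "R \<in> Aff \<Longrightarrow> u \<in> A \<Longrightarrow> u \<noteq> 0 \<Longrightarrow> place_val R u \<ge> 0"
proof -
  assume R: "R \<in> Aff" and u: "u \<in> A" "u \<noteq> 0"
  obtain P t where P: "P \<in> pts" "R = loc P" "dvr K R t" using R by (rule AffE)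
  interpret dvr K R t by (rule P)
  show ?thesis using in_R_iff[of u] u A_sub_K A_sub_loc[OF P(1)] P(2) by auto
qed

lemma pv_pos_iff:
  assumes P: "P \<in> pts" and u: "u \<in> A" "u \<noteq> 0"
  shows "place_val (loc P) u \<ge> 1 \<longleftrightarrow> ev P u = 0"
proof -
  obtain t where "dvr K (loc P) t" using loc_dvr[OF P] by blast
  then interpret dvr K "loc P" t .
  show ?thesis using in_max_ideal_iff[of u] in_max_ideal_loc[OF P u(1)] u A_sub_K by auto
qed

lemma pv_inf: "u \<in> A \<Longrightarrow> u \<noteq> 0 \<Longrightarrow> place_val inf_ring u = - int (pole u)"
proof -
  assume u: "u \<in> A" "u \<noteq> 0"
  obtain t where "\<forall>u\<in>A. \<forall>w\<in>A. u \<noteq> 0 \<longrightarrow> w \<noteq> 0 \<longrightarrow> place_val inf_ring (u / w) = int (pole w) - int (pole u)"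
    using inf_dvr by blast
  hence "place_val inf_ring (u / 1) = int (pole 1) - int (pole u)" using u A_1 by (metis one_neq_zero)
  thus ?thesis using pole_const[of 1] by (simp add: const.one)
qed

text \<open>\<open>u\<close> divides some \<open>x^i - x^j\<close> and some
  \<open>y^i' - y^j'\<close>, so only finitely many values remain for each coordinate of a
  zero.\<close>

lemma finite_zeros:
  assumes u: "u \<in> A" "u \<noteq> 0"
  shows "finite {R \<in> Aff. place_val R u \<noteq> 0}"
proof -
  obtain i j v where x: "i < j" "v \<in> A" "var_x ^ i - var_x ^ j = u * v" using power_diff_in_principal[OF u A_x] by blast
  obtain i' j' v' where y: "i' < j'" "v' \<in> A" "y ^ i' - y ^ j' = u * v'" using power_diff_in_principal[OF u A_y] by blast
  have fin: "finite {z :: 'k alg_closure. z ^ i - z ^ j = 0}" if "i < j" for i j :: nat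
  proof -
    have ne: "Polynomial.monom 1 i - Polynomial.monom 1 j \<noteq> (0 :: 'k alg_closure poly)"
      using that by (metis degree_monom_eq eq_iff_diff_eq_0 nat_neq_iff one_neq_zero)
    have "{z :: 'k alg_closure. z ^ i - z ^ j = 0} = {z. poly (Polynomial.monom 1 i - Polynomial.monom 1 j) z = 0}"
      by (simp add: poly_monom)
    thus ?thesis using poly_roots_finite[OF ne] by simp
  qed
  have "{R \<in> Aff. place_val R u \<noteq> 0} \<subseteq> loc ` ({z. z ^ i - z ^ j = 0} \<times> {z. z ^ i' - z ^ j' = 0})"
  proof
    fix R assume "R \<in> {R \<in> Aff. place_val R u \<noteq> 0}"
    then obtain P where P: "P \<in> pts" "R = loc P" "place_val R u \<noteq> 0" by (auto simp: Aff_def)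
    hence ev: "ev P u = 0" using pv_pos_iff[OF P(1) u] pv_nonneg[of R u] u by (auto simp: Aff_def)
    have "ev P (var_x ^ i - var_x ^ j) = 0" "ev P (y ^ i' - y ^ j') = 0"
      unfolding x(3) y(3) using ev_mult[OF P(1) u(1)] x(2) y(2) ev by auto
    hence "fst P ^ i - fst P ^ j = 0" "snd P ^ i' - snd P ^ j' = 0"
      using P(1) by (simp_all add: ev_diff ev_power ev_x ev_y A_power A_x A_y)
    thus "R \<in> loc ` ({z. z ^ i - z ^ j = 0} \<times> {z. z ^ i' - z ^ j' = 0})" using P(2) by (cases P) auto
  qed
  moreover have "finite (loc ` ({z. z ^ i - z ^ j = 0} \<times> {z. z ^ i' - z ^ j' = 0}))"
    by (intro finite_imageI finite_cartesian_product fin x(1) y(1))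
  ultimately show ?thesis by (rule finite_subset)
qed

lemma Fil_0: "Fil 0 = range const"
  using pole_0_const by (auto simp: Fil_def A_const pole_const)

lemma zero_Fil: "0 \<in> Fil n"
  by (simp add: Fil_def A_0 pole_0)

lemma Fil_mono: "m \<le> n \<Longrightarrow> Fil m \<subseteq> Fil n"
  by (auto simp: Fil_def)

lemma Fil_Suc:
  assumes e: "e \<in> A" "e \<noteq> 0" "pole e = Suc n"
  shows "bij_betw (\<lambda>(c, v). const c * e + v) (UNIV \<times> Fil n) (Fil (Suc n))"
  unfolding bij_betw_def
proof (intro conjI equalityI subsetI)
  show "inj_on (\<lambda>(c, v). const c * e + v) (UNIV \<times> Fil n)"
  proof (rule inj_onI, clarsimp)
    fix c v d w assume v: "v \<in> Fil n" "w \<in> Fil n" and eq: "const c * e + v = const d * e + w"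
    hence "const (c - d) * e = w - v" by (simp add: const.diff algebra_simps)
    hence *: "const (c - d) * e \<in> Fil n" using v Fil_diff by simp
    have "c = d"
    proof (rule ccontr)
      assume "c \<noteq> d"
      hence "pole (const (c - d) * e) = Suc n" using e by (simp add: pole_mult A_const const_eq_0_iff pole_const)
      thus False using * by (simp add: Fil_def)
    qed
    thus "c = d \<and> v = w" using eq by simp
  qed
  fix u assume "u \<in> (\<lambda>(c, v). const c * e + v) ` (UNIV \<times> Fil n)"
  then obtain c v where "u = const c * e + v" "v \<in> Fil n" by auto
  moreover have "e \<in> Fil (Suc n)" using e by (simp add: Fil_def)
  ultimately show "u \<in> Fil (Suc n)" using Fil_add Fil_const_mult Fil_mono[of n "Suc n"] by auto
next
  fix u assume u: "u \<in> Fil (Suc n)"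
  show "u \<in> (\<lambda>(c, v). const c * e + v) ` (UNIV \<times> Fil n)"
  proof (cases "pole u = Suc n")
    case True
    then obtain c where "u - const c * e \<in> Fil n" using cancel_leading[OF _ e(1,2) _ e(3)] u by (auto simp: Fil_def)
    thus ?thesis by (intro image_eqI[of _ _ "(c, u - const c * e)"]) auto
  next
    case False
    hence "u \<in> Fil n" using u by (auto simp: Fil_def)
    thus ?thesis by (intro image_eqI[of _ _ "(0, u)"]) (auto simp: const.zero)
  qed
qed

text \<open>The exponent is positive because of the constants; this later guarantees nonzero
  functions. That the size is a power of \<open>p\<close> makes it prime to
  \<open>q\<close>.\<close>

lemma finite_card_Fil: "finite (Fil n) \<and> (\<exists>e>0. card (Fil n) = p ^ e)"
proof (induction n)
  case 0
  have "inj (const :: 'k \<Rightarrow> _)" by (rule injI) (metis const.diff const_eq_0_iff eq_iff_diff_eq_0)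
  thus ?case by (simp add: Fil_0 card_image card_k) (metis power_one_right zero_less_one)
next
  case (Suc n)
  show ?case
  proof (cases "\<exists>e\<in>A. e \<noteq> 0 \<and> pole e = Suc n")
    case True
    then obtain e where bij: "bij_betw (\<lambda>(c, v). const c * e + v) (UNIV \<times> Fil n) (Fil (Suc n))" using Fil_Suc by blast
    have fin: "finite ((UNIV :: 'k set) \<times> Fil n)" using Suc by simp
    obtain e' where "e' > 0" "card (Fil n) = p ^ e'" using Suc by blast
    hence "card (Fil (Suc n)) = p ^ Suc e'" using bij_betw_same_card[OF bij] by (simp add: card_cartesian_product card_k)
    thus ?thesis using bij_betw_finite[OF bij] fin by blast
  next
    case False
    have "Fil (Suc n) = Fil n"
    proof (intro equalityI Fil_mono[of n "Suc n"] subsetI)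
      fix u assume "u \<in> Fil (Suc n)"
      moreover from this have "pole u \<noteq> Suc n" using False pole_0 by (auto simp: Fil_def)
      ultimately show "u \<in> Fil n" by (auto simp: Fil_def)
    qed simp
    thus ?thesis using Suc by simp
  qed
qed

lemma finite_Fil: "finite (Fil n)" and card_Fil_pos: "card (Fil n) > 0"
  using finite_card_Fil[of n] p_pos by auto

text \<open>From \<open>p * q\<close> on, every integer is a pole order, so each further filtration
  step multiplies the cardinality by exactly \<open>p\<close>.\<close>

definition c0 :: nat where "c0 = p * q"

lemma card_Fil: "card (Fil (c0 + n)) = card (Fil c0) * p ^ n"
proof (induction n)
  case (Suc n)
  obtain e where "e \<in> A" "e \<noteq> 0" "pole e = Suc (c0 + n)" using pole_surj[of "Suc (c0 + n)"] by (auto simp: c0_def)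
  hence "card (Fil (Suc (c0 + n))) = p * card (Fil (c0 + n))"
    using bij_betw_same_card[OF Fil_Suc] by (metis card_cartesian_product card_k)
  thus ?case using Suc by simp
qed simp

section \<open>Effective divisors supported at affine places\<close>

definition eff :: "('k ambient set \<Rightarrow> nat) \<Rightarrow> bool" where
  "eff D \<longleftrightarrow> finite {R. D R \<noteq> 0} \<and> (\<forall>R. R \<notin> Aff \<longrightarrow> D R = 0)"

definition deg :: "('k ambient set \<Rightarrow> nat) \<Rightarrow> nat" where
  "deg D = (\<Sum>R | D R \<noteq> 0. D R * place_degree R)"

lemma deg_superset: "finite S \<Longrightarrow> {R. D R \<noteq> 0} \<subseteq> S \<Longrightarrow> deg D = (\<Sum>R\<in>S. D R * place_degree R)"
  unfolding deg_def by (intro sum.mono_neutral_left) auto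

lemma deg_add:
  assumes "eff D" "eff E" shows "eff (\<lambda>R. D R + E R)" "deg (\<lambda>R. D R + E R) = deg D + deg E"
proof -
  let ?S = "{R. D R \<noteq> 0} \<union> {R. E R \<noteq> 0}"
  have fin: "finite ?S" using assms by (simp add: eff_def)
  have s: "{R. D R + E R \<noteq> 0} = ?S" by auto
  thus "eff (\<lambda>R. D R + E R)" using assms fin unfolding eff_def by simp
  show "deg (\<lambda>R. D R + E R) = deg D + deg E"
  proof -
    have "deg (\<lambda>R. D R + E R) = (\<Sum>R\<in>?S. (D R + E R) * place_degree R)" using fin s by (intro deg_superset) auto
    also have "\<dots> = (\<Sum>R\<in>?S. D R * place_degree R) + (\<Sum>R\<in>?S. E R * place_degree R)"
      by (simp only: distrib_right sum.distrib)
    finally show ?thesis using deg_superset[OF fin, of D] deg_superset[OF fin, of E] by simp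
  qed
qed

lemma eff_single: "R \<in> Aff \<Longrightarrow> eff (\<lambda>R'. if R' = R then 1 else 0)"
  and deg_single: "deg (\<lambda>R'. if R' = R then 1 else 0) = place_degree R"
  by (auto simp: eff_def deg_def)

lemma eff_induct [consumes 1, case_names zero add]:
  assumes "eff D" "Q (\<lambda>_. 0)" "\<And>D R. eff D \<Longrightarrow> R \<in> Aff \<Longrightarrow> Q D \<Longrightarrow> Q (\<lambda>R'. D R' + (if R' = R then 1 else 0))"
  shows "Q D"
  using assms(1)
proof (induction "\<Sum>R | D R \<noteq> 0. D R" arbitrary: D)
  case 0
  hence "D = (\<lambda>_. 0)" by (auto simp: eff_def fun_eq_iff)
  thus ?case using assms(2) by simp
next
  case (Suc n)
  have fin: "finite {R. D R \<noteq> 0}" using Suc.prems by (simp add: eff_def)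
  obtain R where R: "D R \<noteq> 0" using Suc.hyps(2) by (metis (mono_tags, lifting) Zero_not_Suc sum.neutral)
  define D' where "D' = D(R := D R - 1)"
  have sub: "{R. D' R \<noteq> 0} \<subseteq> {R. D R \<noteq> 0}" by (auto simp: D'_def)
  have "finite {R. D' R \<noteq> 0}" by (rule finite_subset[OF sub fin])
  hence eff': "eff D'" using Suc.prems unfolding eff_def D'_def by auto
  have "(\<Sum>R | D' R \<noteq> 0. D' R) = (\<Sum>R | D R \<noteq> 0. D' R)" using sub fin by (intro sum.mono_neutral_left) auto
  moreover have "(\<Sum>R' | D R' \<noteq> 0. D R') = D R + (\<Sum>R'\<in>{R'. D R' \<noteq> 0} - {R}. D R')"
    using fin R by (intro sum.remove) auto
  moreover have "(\<Sum>R' | D R' \<noteq> 0. D' R') = D' R + (\<Sum>R'\<in>{R'. D R' \<noteq> 0} - {R}. D' R')"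
    using fin R by (intro sum.remove) auto
  moreover have "(\<Sum>R'\<in>{R'. D R' \<noteq> 0} - {R}. D' R') = (\<Sum>R'\<in>{R'. D R' \<noteq> 0} - {R}. D R')"
    by (intro sum.cong) (auto simp: D'_def)
  ultimately have "n = (\<Sum>R | D' R \<noteq> 0. D' R)" using Suc.hyps(2) R by (simp add: D'_def)
  hence "Q D'" using Suc.hyps(1) eff' by blast
  moreover have "R \<in> Aff" using R Suc.prems by (auto simp: eff_def)
  moreover have "D = (\<lambda>R'. D' R' + (if R' = R then 1 else 0))" using R by (auto simp: D'_def)
  ultimately show ?case using assms(3)[of D' R] eff' by metis
qed

text \<open>The ideal of functions vanishing along \<open>D\<close>. Its intersection with
  \<open>Fil n\<close> is the Riemann-Roch space of \<open>n\<close> times infinity minus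
  \<open>D\<close>.\<close>

definition LL :: "('k ambient set \<Rightarrow> nat) \<Rightarrow> 'k ambient set" where
  "LL D = {u \<in> A. u = 0 \<or> (\<forall>R\<in>Aff. place_val R u \<ge> int (D R))}"

lemma LL_0: "0 \<in> LL D" and LL_A: "LL D \<subseteq> A"
  by (auto simp: LL_def A_0)

lemma LL_zero: "LL (\<lambda>_. 0) = A"
  using pv_nonneg by (auto simp: LL_def)

lemma LL_add: "u \<in> LL D \<Longrightarrow> v \<in> LL D \<Longrightarrow> u + v \<in> LL D"
proof -
  assume uv: "u \<in> LL D" "v \<in> LL D"
  have "int (D R) \<le> place_val R (u + v)" if R: "R \<in> Aff" and nz: "u + v \<noteq> 0" for R
  proof -
    obtain t where "dvr K R t" using AffE[OF R] by metis
    then interpret dvr K R t .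
    show ?thesis by (rule val_add) (use uv R nz A_sub_K in \<open>auto simp: LL_def\<close>)
  qed
  thus ?thesis using uv by (auto simp: LL_def A_add)
qed

lemma LL_mult: "u \<in> LL D \<Longrightarrow> v \<in> A \<Longrightarrow> u * v \<in> LL D"
proof -
  assume u: "u \<in> LL D" and v: "v \<in> A"
  have "int (D R) \<le> place_val R (u * v)" if R: "R \<in> Aff" and nz: "u * v \<noteq> 0" for R
  proof -
    have "place_val R (u * v) = place_val R u + place_val R v"
      using nz u v A_sub_K Aff_places[OF R] by (intro pv_mult) (auto simp: LL_def)
    moreover have "place_val R v \<ge> 0" using pv_nonneg R v nz by auto
    moreover have "place_val R u \<ge> int (D R)" using u R nz by (auto simp: LL_def)
    ultimately show ?thesis by linarith
  qed
  thus ?thesis using u v by (auto simp: LL_def A_mult)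
qed

lemma LL_diff: "u \<in> LL D \<Longrightarrow> v \<in> LL D \<Longrightarrow> u - v \<in> LL D"
proof -
  assume "u \<in> LL D" "v \<in> LL D"
  hence "u + v * const (- 1) \<in> LL D" using LL_add LL_mult A_const by blast
  moreover have "const (- 1) = (- 1 :: 'k ambient)" using const.diff[of 0 1] by (simp add: const.zero const.one)
  ultimately show ?thesis by simp
qed

lemma pv_prod:
  "R \<in> places K \<Longrightarrow> (\<And>i. i \<in> I \<Longrightarrow> g i \<in> A \<and> g i \<noteq> 0) \<Longrightarrow>
   place_val R (\<Prod>i\<in>I. g i) = (\<Sum>i\<in>I. place_val R (g i))"
proof (induction I rule: infinite_finite_induct)
  case (insert i I)
  have "(\<Prod>i\<in>I. g i) \<in> A" using insert.prems by (intro A_prod) auto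
  moreover have "(\<Prod>i\<in>I. g i) \<noteq> 0" using insert by simp
  ultimately show ?case using insert A_sub_K by (simp add: pv_mult subset_iff)
qed (use pv_const[of R 1] in \<open>simp_all add: const.one\<close>)

text \<open>A power of the uniformizer at \<open>R0\<close> is multiplied by powers of functions
  that vanish at the other places of the support but not at \<open>R0\<close>. Extra zeros elsewhere
  do no harm, since \<open>LL D\<close> asks only for lower bounds.\<close>

lemma exact_element:
  assumes D: "eff D" and R0: "R0 \<in> Aff"
  shows "\<exists>w\<in>LL D. w \<noteq> 0 \<and> place_val R0 w = int (D R0)"
proof -
  obtain P0 t where P0: "P0 \<in> pts" "R0 = loc P0" "t \<in> A" "dvr K R0 t" using R0 by (rule AffE)
  have t: "t \<noteq> 0" "place_val R0 t = 1" using P0(4) dvr.t(2) dvr.val_t by metis+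
  have "\<exists>g\<in>A. g \<noteq> 0 \<and> place_val R g \<ge> 1 \<and> place_val R0 g = 0" if R: "R \<in> Aff" "R \<noteq> R0" for R
  proof -
    obtain P where P: "P \<in> pts" "R = loc P" using R by (auto simp: Aff_def)
    obtain u where u: "u \<in> A" "ev P0 u \<noteq> 0" "ev P u = 0" using separate_places[OF P0(1) P(1)] R P P0 by blast
    have "u \<noteq> 0" using u ev_0[OF P0(1)] by auto
    thus ?thesis using u pv_pos_iff[OF P(1) u(1)] pv_pos_iff[OF P0(1) u(1)] pv_nonneg[OF R0 u(1)] P P0
      by (intro bexI[of _ u]) auto
  qed
  then obtain g where g: "\<And>R. R \<in> Aff \<Longrightarrow> R \<noteq> R0 \<Longrightarrow> g R \<in> A \<and> g R \<noteq> 0 \<and> place_val R (g R) \<ge> 1 \<and> place_val R0 (g R) = 0"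
    by metis
  define S where "S = {R. D R \<noteq> 0} - {R0}"
  have S: "finite S" "\<And>R. R \<in> S \<Longrightarrow> R \<in> Aff \<and> R \<noteq> R0" using D by (auto simp: S_def eff_def)
  define v where "v = (\<Prod>R\<in>S. g R ^ D R)"
  define w where "w = t ^ D R0 * v"
  have gA: "g R ^ D R \<in> A \<and> g R ^ D R \<noteq> 0" if "R \<in> S" for R using g S that by (auto simp: A_power)
  have v: "v \<in> A" "v \<noteq> 0" unfolding v_def using gA S by (auto intro!: A_prod)
  have wA: "w \<in> A" "w \<noteq> 0" using v t P0 by (auto simp: w_def A_mult A_power)
  have pv: "place_val R w = int (D R0) * place_val R t + (\<Sum>R'\<in>S. int (D R') * place_val R (g R'))" if R: "R \<in> Aff" for R
  proof -
    have "place_val R w = place_val R (t ^ D R0) + place_val R v" unfolding w_def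
      using v t P0 A_sub_K A_power by (intro pv_mult Aff_places R) auto
    also have "place_val R (t ^ D R0) = int (D R0) * place_val R t" using t P0 A_sub_K by (intro pv_power Aff_places R) auto
    also have "place_val R v = (\<Sum>R'\<in>S. place_val R (g R' ^ D R'))" unfolding v_def
      using gA by (intro pv_prod Aff_places R) auto
    also have "\<dots> = (\<Sum>R'\<in>S. int (D R') * place_val R (g R'))"
      using g S A_sub_K by (intro sum.cong refl pv_power Aff_places R) auto
    finally show ?thesis .
  qed
  have "place_val R0 w = int (D R0)" using pv[OF R0] t g S by simp
  moreover have "place_val R w \<ge> int (D R)" if R: "R \<in> Aff" for R
  proof (cases "R = R0")
    case True thus ?thesis using \<open>place_val R0 w = int (D R0)\<close> by simp
  next
    case False
    have nn: "int (D R') * place_val R (g R') \<ge> 0" if "R' \<in> S" for R' using pv_nonneg[OF R] g S that by simp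
    have t0: "int (D R0) * place_val R t \<ge> 0" using pv_nonneg[OF R P0(3)] t by simp
    show ?thesis
    proof (cases "D R = 0")
      case True
      have "0 \<le> (\<Sum>R'\<in>S. int (D R') * place_val R (g R'))" by (intro sum_nonneg nn)
      thus ?thesis using True pv[OF R] t0 by simp
    next
      case False
      hence RS: "R \<in> S" using \<open>R \<noteq> R0\<close> by (simp add: S_def)
      have "int (D R) * 1 \<le> int (D R) * place_val R (g R)" using g[of R] R \<open>R \<noteq> R0\<close> by (intro mult_left_mono) auto
      also have "\<dots> \<le> (\<Sum>R'\<in>S. int (D R') * place_val R (g R'))" using S RS nn by (intro member_le_sum) auto
      finally show ?thesis using pv[OF R] t0 by simp
    qed
  qed
  ultimately show ?thesis using wA by (intro bexI[of _ w]) (auto simp: LL_def)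
qed

text \<open>
  Dividing by a fixed element of exact order at \<open>R0\<close> maps \<open>LL D\<close> onto the residue field of \<open>R0\<close>,
  with kernel \<open>LL D'\<close>.
\<close>

lemma card_LL_step:
  assumes D: "eff D" and R0: "R0 \<in> Aff"
  defines "D' \<equiv> \<lambda>R. D R + (if R = R0 then 1 else 0)"
  shows "card (LL D \<inter> Fil n) \<le> p ^ place_degree R0 * card (LL D' \<inter> Fil n)"
    and "\<exists>n0. \<forall>n\<ge>n0. card (LL D \<inter> Fil n) = p ^ place_degree R0 * card (LL D' \<inter> Fil n)"
proof -
  obtain P t where P: "P \<in> pts" "R0 = loc P" "dvr K R0 t" using R0 by (rule AffE)
  interpret dvr K R0 t by (rule P)
  obtain w where w: "w \<in> LL D" "w \<noteq> 0" "place_val R0 w = int (D R0)" using exact_element[OF D R0] by blast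
  have wA: "w \<in> A" using w LL_A by blast
  define m where "m = max_ideal R0"
  have ex: "R0 = inf_ring \<or> (\<exists>P\<in>pts. R0 = loc P)" using P by blast
  note mc = place_m_closed[OF ex, folded m_def]
  define cls where "cls z = {x \<in> R0. x - z \<in> m}" for z
  have cls_eq: "cls z = cls z' \<longleftrightarrow> z - z' \<in> m" if z: "z \<in> R0" "z' \<in> R0" for z z'
  proof
    assume "cls z = cls z'"
    moreover have "z \<in> cls z" using z mc(5) by (simp add: cls_def)
    ultimately show "z - z' \<in> m" by (simp add: cls_def)
  next
    assume *: "z - z' \<in> m"
    have "x - z \<in> m \<longleftrightarrow> x - z' \<in> m" for x
      using mc(1)[of "x - z" "z - z'"] mc(3)[of "x - z'" "z - z'"] * by (auto simp: algebra_simps)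
    thus "cls z = cls z'" by (simp add: cls_def)
  qed
  have card_cls: "card (cls ` R0) = p ^ place_degree R0"
    using card_residue_loc[OF P(1)] by (simp add: P(2) cls_def m_def)
  hence fin_cls: "finite (cls ` R0)" using p_pos by (metis card.infinite not_gr_zero zero_less_power)
  define psi where "psi u = cls (u / w)" for u
  have uw: "u / w \<in> R0" if u: "u \<in> LL D" for u
  proof (cases "u = 0")
    case False
    have uA: "u \<in> A" using u LL_A by blast
    hence "place_val R0 (u / w) = place_val R0 u - place_val R0 w"
      using w wA A_sub_K False by (intro pv_divide Aff_places R0) auto
    hence "place_val R0 (u / w) \<ge> 0" using u w R0 False by (auto simp: LL_def)
    thus ?thesis using in_R_iff[of "u / w"] K_divide[OF uA wA] False w by simp
  qed (simp add: zero)
  have D'_iff: "u \<in> LL D' \<longleftrightarrow> u / w \<in> m" if u: "u \<in> LL D" for u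
  proof (cases "u = 0")
    case True thus ?thesis using mc(5) LL_0 by simp
  next
    case False
    have uA: "u \<in> A" using u LL_A by blast
    hence v: "place_val R0 (u / w) = place_val R0 u - place_val R0 w"
      using w wA A_sub_K False by (intro pv_divide Aff_places R0) auto
    have "u \<in> LL D' \<longleftrightarrow> place_val R0 u \<ge> int (D R0) + 1"
      using u False R0 by (auto simp: LL_def D'_def)
    also have "\<dots> \<longleftrightarrow> u / w \<in> m" using in_max_ideal_iff[of "u / w"] K_divide[OF uA wA] False w v by (auto simp: m_def)
    finally show ?thesis .
  qed
  have psi_eq: "psi u = psi v \<longleftrightarrow> u - v \<in> LL D'" if "u \<in> LL D" "v \<in> LL D" for u v
    using cls_eq[OF uw uw] D'_iff[OF LL_diff] that by (simp add: psi_def diff_divide_distrib)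
  have D'_sub: "LL D' \<subseteq> LL D" by (force simp: LL_def D'_def)
  have main: "card (LL D \<inter> Fil n) = card (psi ` (LL D \<inter> Fil n)) * card (LL D' \<inter> Fil n)" for n
  proof (rule card_eq_fibres)
    show "finite (LL D \<inter> Fil n)" using finite_Fil by simp
    fix u assume u: "u \<in> LL D \<inter> Fil n"
    have "{v \<in> LL D \<inter> Fil n. psi v = psi u} = (\<lambda>h. u + h) ` (LL D' \<inter> Fil n)"
    proof (intro equalityI subsetI)
      fix v assume "v \<in> {v \<in> LL D \<inter> Fil n. psi v = psi u}"
      hence "v - u \<in> LL D' \<inter> Fil n" using psi_eq u Fil_diff by auto
      thus "v \<in> (\<lambda>h. u + h) ` (LL D' \<inter> Fil n)" by (intro image_eqI[of _ _ "v - u"]) auto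
    next
      fix v assume "v \<in> (\<lambda>h. u + h) ` (LL D' \<inter> Fil n)"
      then obtain h where h: "v = u + h" "h \<in> LL D'" "h \<in> Fil n" by blast
      hence "v \<in> LL D \<inter> Fil n" using u D'_sub LL_add Fil_add by blast
      moreover from this have "psi v = psi u" using psi_eq[of v u] u h by auto
      ultimately show "v \<in> {v \<in> LL D \<inter> Fil n. psi v = psi u}" by blast
    qed
    thus "card {v \<in> LL D \<inter> Fil n. psi v = psi u} = card (LL D' \<inter> Fil n)" by (simp add: card_image)
  qed
  have sub: "psi ` (LL D \<inter> Fil n) \<subseteq> cls ` R0" for n using uw by (auto simp: psi_def)
  show "card (LL D \<inter> Fil n) \<le> p ^ place_degree R0 * card (LL D' \<inter> Fil n)"
    unfolding main[of n] card_cls[symmetric] using card_mono[OF fin_cls sub] by simp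
  have "\<exists>u. u \<in> LL D \<and> psi u = c" if c: "c \<in> cls ` R0" for c
  proof -
    obtain z where z: "z \<in> R0" "c = cls z" using c by blast
    obtain v where v: "v \<in> A" "z - v \<in> m" using residue_rep[OF P(1)] z P(2) by (auto simp: m_def)
    have "v \<in> R0" using v A_sub_loc[OF P(1)] P(2) by blast
    hence "cls z = cls v" using cls_eq z v by blast
    moreover have "psi (w * v) = cls v" using w by (simp add: psi_def)
    moreover have "w * v \<in> LL D" using LL_mult w v by blast
    ultimately show ?thesis using z by metis
  qed
  then obtain g where g: "\<And>c. c \<in> cls ` R0 \<Longrightarrow> g c \<in> LL D \<and> psi (g c) = c" by metis
  \<comment> \<open>There are finitely many residue classes; beyond the largest pole order of the
    chosen preimages, all of them are attained within \<open>Fil n\<close>.\<close>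
  define n0 where "n0 = Max (pole ` g ` cls ` R0)"
  have "card (LL D \<inter> Fil n) = p ^ place_degree R0 * card (LL D' \<inter> Fil n)" if n: "n \<ge> n0" for n
  proof -
    have "g c \<in> Fil n" if c: "c \<in> cls ` R0" for c
    proof -
      have "pole (g c) \<le> n0" unfolding n0_def using fin_cls c by (intro Max_ge) auto
      thus ?thesis using g[OF c] LL_A n by (auto simp: Fil_def)
    qed
    hence "cls ` R0 \<subseteq> psi ` (LL D \<inter> Fil n)" using g by (metis IntI image_eqI subsetI)
    hence "psi ` (LL D \<inter> Fil n) = cls ` R0" using sub by blast
    thus ?thesis using main[of n] card_cls by simp
  qed
  thus "\<exists>n0. \<forall>n\<ge>n0. card (LL D \<inter> Fil n) = p ^ place_degree R0 * card (LL D' \<inter> Fil n)" by blast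
qed

text \<open>The index of \<open>LL D\<close> in \<open>A\<close> is \<open>p ^ deg D\<close>, seen
  through the filtration. The inequality, valid for every \<open>n\<close>, supplies nonzero
  functions; the equality for large \<open>n\<close> gives exact counts.\<close>

lemma card_LL:
  assumes "eff D"
  shows "(\<forall>n. card (Fil n) \<le> p ^ deg D * card (LL D \<inter> Fil n)) \<and>
    (\<exists>n0. \<forall>n\<ge>n0. card (Fil n) = p ^ deg D * card (LL D \<inter> Fil n))"
  using assms
proof (induction D rule: eff_induct)
  case zero
  have "LL (\<lambda>_. 0) \<inter> Fil n = Fil n" for n unfolding LL_zero by (auto simp: Fil_def)
  thus ?case by (simp add: deg_def)
next
  case (add D R)
  let ?D = "\<lambda>R'. D R' + (if R' = R then 1 else 0)"
  have deg: "deg ?D = deg D + place_degree R"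
    using deg_add(2)[OF add(1) eff_single[OF add(2)]] deg_single by simp
  have "card (Fil n) \<le> p ^ deg ?D * card (LL ?D \<inter> Fil n)" for n
  proof -
    have "card (Fil n) \<le> p ^ deg D * card (LL D \<inter> Fil n)" using add by blast
    also have "\<dots> \<le> p ^ deg D * (p ^ place_degree R * card (LL ?D \<inter> Fil n))"
      by (intro mult_left_mono card_LL_step(1)[OF add(1,2)]) simp
    finally show ?thesis by (simp add: deg power_add mult.assoc)
  qed
  moreover obtain n0 n1 where "\<And>n. n \<ge> n0 \<Longrightarrow> card (Fil n) = p ^ deg D * card (LL D \<inter> Fil n)"
    "\<And>n. n \<ge> n1 \<Longrightarrow> card (LL D \<inter> Fil n) = p ^ place_degree R * card (LL ?D \<inter> Fil n)"
    using add card_LL_step(2)[OF add(1,2)] by blast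
  hence "card (Fil n) = p ^ deg ?D * card (LL ?D \<inter> Fil n)" if "n \<ge> max n0 n1" for n
    using that by (simp add: deg power_add mult.assoc)
  ultimately show ?case by blast
qed

text \<open>The affine part of a principal divisor. Functions in \<open>A\<close> have no affine
  poles, so \<open>nat\<close> loses nothing for them.\<close>

definition dv :: "'k ambient \<Rightarrow> 'k ambient set \<Rightarrow> nat" where
  "dv u R = (if R \<in> Aff then nat (place_val R u) else 0)"

lemma eff_dv: "u \<in> A \<Longrightarrow> u \<noteq> 0 \<Longrightarrow> eff (dv u)"
proof -
  assume u: "u \<in> A" "u \<noteq> 0"
  have "{R. dv u R \<noteq> 0} \<subseteq> {R \<in> Aff. place_val R u \<noteq> 0}" by (auto simp: dv_def)
  hence "finite {R. dv u R \<noteq> 0}" using finite_zeros[OF u] by (rule finite_subset)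
  thus ?thesis unfolding eff_def by (simp add: dv_def)
qed

lemma in_A_iff:
  assumes z: "z \<in> K" "z \<noteq> 0" shows "z \<in> A \<longleftrightarrow> (\<forall>R\<in>Aff. place_val R z \<ge> 0)"
proof
  assume *: "\<forall>R\<in>Aff. place_val R z \<ge> 0"
  show "z \<in> A"
  proof (rule A_eq_Inter_loc[OF z(1)])
    fix P assume P: "P \<in> pts"
    obtain t where "dvr K (loc P) t" using loc_dvr[OF P] by blast
    then interpret dvr K "loc P" t .
    show "z \<in> loc P" using in_R_iff[OF z] * P by (auto simp: Aff_def)
  qed
qed (use pv_nonneg z in blast)

lemma LL_dv: "u \<in> A \<Longrightarrow> u \<noteq> 0 \<Longrightarrow> LL (dv u) = (\<lambda>v. u * v) ` A"
proof (intro equalityI subsetI)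
  fix w assume u: "u \<in> A" "u \<noteq> 0" and w: "w \<in> LL (dv u)"
  show "w \<in> (\<lambda>v. u * v) ` A"
  proof (cases "w = 0")
    case True thus ?thesis using A_0 by auto
  next
    case False
    have "w / u \<in> A"
    proof (subst in_A_iff)
      show "\<forall>R\<in>Aff. 0 \<le> place_val R (w / u)"
      proof
        fix R assume R: "R \<in> Aff"
        have "place_val R (w / u) = place_val R w - place_val R u"
          using w u False A_sub_K LL_A by (intro pv_divide Aff_places R) auto
        thus "0 \<le> place_val R (w / u)" using w False R pv_nonneg[OF R u] by (auto simp: LL_def dv_def)
      qed
    qed (use w u False LL_A K_divide in auto)
    thus ?thesis using u by (intro image_eqI[of _ _ "w / u"]) auto
  qed
next
  fix w assume u: "u \<in> A" "u \<noteq> 0" and w: "w \<in> (\<lambda>v. u * v) ` A"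
  have "u \<in> LL (dv u)" using u pv_nonneg by (auto simp: LL_def dv_def)
  thus "w \<in> LL (dv u)" using w LL_mult by blast
qed

text \<open>The product formula, by comparing the growth of \<open>LL (dv u) = u A\<close> with that of \<open>A\<close>.\<close>

theorem deg_dv:
  assumes u: "u \<in> A" "u \<noteq> 0"
  shows "deg (dv u) = pole u"
proof -
  obtain n0 where n0: "\<And>n. n \<ge> n0 \<Longrightarrow> card (Fil n) = p ^ deg (dv u) * card (LL (dv u) \<inter> Fil n)"
    using card_LL[OF eff_dv[OF u]] by blast
  define n where "n = n0 + c0"
  have "LL (dv u) \<inter> Fil (n + pole u) = (\<lambda>v. u * v) ` Fil n"
  proof -
    have "u * v \<in> Fil (n + pole u) \<longleftrightarrow> v \<in> Fil n" if "v \<in> A" for v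
      using that u by (cases "v = 0") (auto simp: Fil_def A_mult pole_mult A_0 pole_0)
    thus ?thesis unfolding LL_dv[OF u] by (auto simp: Fil_def)
  qed
  hence "card (LL (dv u) \<inter> Fil (n + pole u)) = card (Fil n)" using u by (simp add: card_image inj_on_def)
  hence "card (Fil (n + pole u)) = p ^ deg (dv u) * card (Fil n)" using n0[of "n + pole u"] by (simp add: n_def)
  hence "card (Fil (c0 + (n0 + pole u))) = p ^ deg (dv u) * card (Fil (c0 + n0))" by (simp add: n_def add_ac)
  hence "card (Fil c0) * p ^ (n0 + pole u) = p ^ deg (dv u) * (card (Fil c0) * p ^ n0)" by (simp only: card_Fil)
  hence "card (Fil c0) * p ^ n0 * p ^ pole u = card (Fil c0) * p ^ n0 * p ^ deg (dv u)" by (simp only: power_add mult_ac)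
  hence "p ^ pole u = p ^ deg (dv u)" using card_Fil_pos[of c0] p_pos by simp
  thus ?thesis using p_gt_1 by simp
qed

end

section \<open>The class number\<close>

lemma exists_order_prime_iff:
  assumes G: "group G" "finite (carrier G)" and q: "prime (q :: nat)"
  shows "(\<exists>c\<in>carrier G. c \<noteq> \<one>\<^bsub>G\<^esub> \<and> c [^]\<^bsub>G\<^esub> q = \<one>\<^bsub>G\<^esub>) \<longleftrightarrow> q dvd Coset.order G"
proof -
  interpret group G by (rule G)
  show ?thesis
  proof
    assume "\<exists>c\<in>carrier G. c \<noteq> \<one>\<^bsub>G\<^esub> \<and> c [^]\<^bsub>G\<^esub> q = \<one>\<^bsub>G\<^esub>"
    then obtain c where c: "c \<in> carrier G" "c \<noteq> \<one>\<^bsub>G\<^esub>" "c [^]\<^bsub>G\<^esub> q = \<one>\<^bsub>G\<^esub>" by blast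
    have "ord c dvd q" using c pow_eq_id by simp
    moreover have "ord c \<noteq> 1" using c ord_eq_1 by simp
    ultimately have "ord c = q" using q by (metis prime_nat_iff)
    thus "q dvd Coset.order G" using ord_dvd_group_order[OF c(1)] by simp
  next
    assume "q dvd Coset.order G"
    \<comment> \<open>Sylow's theorem at the first power of \<open>q\<close>, where \<open>m\<close>
      may still be divisible by \<open>q\<close>.\<close>
    then obtain m where "Coset.order G = q ^ 1 * m" by auto
    then obtain H where H: "subgroup H G" "card H = q ^ 1" using sylow_thm[OF q G(1) _ G(2), of 1 m] by blast
    have "card H > 1" using H q prime_gt_1_nat by simp
    hence "\<not> H \<subseteq> {\<one>\<^bsub>G\<^esub>}" by (metis card.empty card_mono finite.emptyI finite.insertI is_singletonI is_singleton_altdef not_less)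
    then obtain c where c: "c \<in> H" "c \<noteq> \<one>\<^bsub>G\<^esub>" by blast
    interpret H: group "G\<lparr>carrier := H\<rparr>" using H subgroup_imp_group by blast
    have "c [^]\<^bsub>G\<lparr>carrier := H\<rparr>\<^esub> Coset.order (G\<lparr>carrier := H\<rparr>) = \<one>\<^bsub>G\<^esub>" using H.pow_order_eq_1[of c] c by simp
    hence "c [^]\<^bsub>G\<^esub> q = \<one>\<^bsub>G\<^esub>" using H nat_pow_consistent[of c q H] by (simp add: Coset.order_def)
    thus "\<exists>c\<in>carrier G. c \<noteq> \<one>\<^bsub>G\<^esub> \<and> c [^]\<^bsub>G\<^esub> q = \<one>\<^bsub>G\<^esub>"
      using c subgroup.mem_carrier[OF H(1) c(1)] by (intro bexI[of _ c]) auto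
  qed
qed

lemma div_degree_superset:
  "finite S \<Longrightarrow> Poly_Mapping.keys D \<subseteq> S \<Longrightarrow> div_degree D = (\<Sum>R\<in>S. Poly_Mapping.lookup D R * int (place_degree R))"
  unfolding div_degree_def by (intro sum.mono_neutral_left) (auto simp: in_keys_iff)

lemma div_degree_add: "div_degree (D + E) = div_degree D + div_degree E"
proof -
  let ?S = "Poly_Mapping.keys D \<union> Poly_Mapping.keys E"
  have "Poly_Mapping.keys (D + E) \<subseteq> ?S" by (rule Poly_Mapping.keys_add)
  thus ?thesis using div_degree_superset[of ?S "D + E"] div_degree_superset[of ?S D] div_degree_superset[of ?S E]
    by (simp add: lookup_add sum.distrib distrib_right)
qed

lemma div_degree_0: "div_degree 0 = 0"
  by (simp add: div_degree_def)

lemma div_degree_uminus: "div_degree (- D) = - div_degree D"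
  using div_degree_add[of D "- D"] by (simp add: div_degree_0)

context superelliptic
begin

abbreviation lk where "lk \<equiv> Poly_Mapping.lookup"

definition Div0 :: "('k ambient set \<Rightarrow>\<^sub>0 int) set" where
  "Div0 = {D. Poly_Mapping.keys D \<subseteq> places K \<and> div_degree D = 0}"

definition Prin :: "('k ambient set \<Rightarrow>\<^sub>0 int) set" where
  "Prin = {D. Poly_Mapping.keys D \<subseteq> places K \<and> (\<exists>f\<in>K - {0}. \<forall>R\<in>places K. lk D R = place_val R f)}"

lemma div_degree_split:
  assumes "Poly_Mapping.keys D \<subseteq> places K"
  shows "div_degree D = lk D inf_ring + (\<Sum>R\<in>Poly_Mapping.keys D \<inter> Aff. lk D R * int (place_degree R))"
proof -
  have fin: "finite (Poly_Mapping.keys D \<inter> Aff)" by simp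
  have "div_degree D = (\<Sum>R\<in>insert inf_ring (Poly_Mapping.keys D \<inter> Aff). lk D R * int (place_degree R))"
    using assms by (intro div_degree_superset) (auto simp: places_eq)
  thus ?thesis using inf_not_Aff place_degree_inf by (subst (asm) sum.insert) auto
qed

lemma lookup_outside: "Poly_Mapping.keys D \<subseteq> places K \<Longrightarrow> R \<notin> places K \<Longrightarrow> lk D R = 0"
  by (metis in_keys_iff subsetD)

text \<open>Infinity has degree 1, so its coefficient is minus the degree of the affine
  part.\<close>

lemma degree_0_eqI:
  assumes "D \<in> Div0" "E \<in> Div0" "\<And>R. R \<in> Aff \<Longrightarrow> lk D R = lk E R"
  shows "D = E"
proof -
  have "Poly_Mapping.keys D \<inter> Aff = Poly_Mapping.keys E \<inter> Aff" using assms(3) by (auto simp: in_keys_iff)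
  hence "(\<Sum>R\<in>Poly_Mapping.keys D \<inter> Aff. lk D R * int (place_degree R)) = (\<Sum>R\<in>Poly_Mapping.keys E \<inter> Aff. lk E R * int (place_degree R))"
    using assms(3) by (intro sum.cong) auto
  hence inf: "lk D inf_ring = lk E inf_ring" using div_degree_split[of D] div_degree_split[of E] assms by (auto simp: Div0_def)
  show ?thesis
  proof (rule poly_mapping_eqI)
    fix R show "lk D R = lk E R"
    proof (cases "R \<in> places K")
      case True thus ?thesis using assms(3) inf by (auto simp: places_eq)
    next
      case False thus ?thesis using assms(1,2) lookup_outside[of D R] lookup_outside[of E R] by (auto simp: Div0_def)
    qed
  qed
qed

text \<open>The divisor \<open>D\<close> minus \<open>deg D\<close> times infinity, of degree zero.
  For \<open>dv u\<close> this is the full principal divisor of \<open>u\<close>, by the product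
  formula.\<close>

definition emb :: "('k ambient set \<Rightarrow> nat) \<Rightarrow> 'k ambient set \<Rightarrow>\<^sub>0 int" where
  "emb D = Abs_poly_mapping (\<lambda>R. if R = inf_ring then - int (deg D) else int (D R))"

lemma lookup_emb: "eff D \<Longrightarrow> lk (emb D) R = (if R = inf_ring then - int (deg D) else int (D R))"
proof -
  assume D: "eff D"
  have "{R. (if R = inf_ring then - int (deg D) else int (D R)) \<noteq> 0} \<subseteq> insert inf_ring {R. D R \<noteq> 0}" by auto
  moreover have "finite (insert inf_ring {R. D R \<noteq> 0})" using D by (simp add: eff_def)
  ultimately have "finite {R. (if R = inf_ring then - int (deg D) else int (D R)) \<noteq> 0}" by (rule finite_subset)
  thus ?thesis unfolding emb_def by (subst lookup_Abs_poly_mapping) auto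
qed

lemma emb_Div0: "eff D \<Longrightarrow> emb D \<in> Div0"
proof -
  assume D: "eff D"
  have keys: "Poly_Mapping.keys (emb D) \<subseteq> places K"
  proof
    fix R assume "R \<in> Poly_Mapping.keys (emb D)"
    hence "lk (emb D) R \<noteq> 0" by (simp add: in_keys_iff)
    hence "R = inf_ring \<or> D R \<noteq> 0" unfolding lookup_emb[OF D] by (metis of_nat_0)
    thus "R \<in> places K" using D by (auto simp: places_eq eff_def)
  qed
  have "Poly_Mapping.keys (emb D) \<inter> Aff = {R. D R \<noteq> 0}"
  proof (intro equalityI subsetI)
    fix R assume R: "R \<in> Poly_Mapping.keys (emb D) \<inter> Aff"
    hence "R \<noteq> inf_ring" using inf_not_Aff by blast
    thus "R \<in> {R. D R \<noteq> 0}" using R by (simp add: in_keys_iff lookup_emb[OF D])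
  next
    fix R assume "R \<in> {R. D R \<noteq> 0}"
    moreover from this have "R \<in> Aff" using D by (auto simp: eff_def)
    moreover from this have "R \<noteq> inf_ring" using inf_not_Aff by blast
    ultimately show "R \<in> Poly_Mapping.keys (emb D) \<inter> Aff" by (simp add: in_keys_iff lookup_emb[OF D])
  qed
  moreover have "(\<Sum>R | D R \<noteq> 0. lk (emb D) R * int (place_degree R)) = (\<Sum>R | D R \<noteq> 0. int (D R * place_degree R))"
    using lookup_emb[OF D] D inf_not_Aff by (intro sum.cong) (auto simp: eff_def)
  ultimately have "div_degree (emb D) = 0"
    using div_degree_split[OF keys] lookup_emb[OF D] by (simp add: deg_def)
  thus ?thesis using keys by (simp add: Div0_def)
qed

lemma Div0_add: "D \<in> Div0 \<Longrightarrow> E \<in> Div0 \<Longrightarrow> D + E \<in> Div0"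
  and Div0_uminus: "D \<in> Div0 \<Longrightarrow> - D \<in> Div0" and Div0_0: "0 \<in> Div0"
  using Poly_Mapping.keys_add[of D E] by (auto simp: Div0_def div_degree_add div_degree_uminus div_degree_0)

lemma Div0_diff: "D \<in> Div0 \<Longrightarrow> E \<in> Div0 \<Longrightarrow> D - E \<in> Div0"
  using Div0_add[of D "- E"] Div0_uminus[of E] by simp

lemma emb_dv:
  assumes u: "u \<in> A" "u \<noteq> 0" and R: "R \<in> places K"
  shows "lk (emb (dv u)) R = place_val R u"
  using R lookup_emb[OF eff_dv[OF u]] deg_dv[OF u] pv_inf[OF u] pv_nonneg[OF _ u] inf_not_Aff
  by (auto simp: places_eq dv_def)

lemma Prin_iff: "D \<in> Prin \<longleftrightarrow> (\<exists>u w. u \<in> A \<and> w \<in> A \<and> u \<noteq> 0 \<and> w \<noteq> 0 \<and> D = emb (dv u) - emb (dv w))"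
proof
  assume "D \<in> Prin"
  then obtain f where f: "Poly_Mapping.keys D \<subseteq> places K" "f \<in> K" "f \<noteq> 0" "\<And>R. R \<in> places K \<Longrightarrow> lk D R = place_val R f"
    by (auto simp: Prin_def)
  then obtain u w where uw: "f = u / w" "u \<in> A" "w \<in> A" "w \<noteq> 0" "u \<noteq> 0" by (auto simp: K_eq)
  have "D = emb (dv u) - emb (dv w)"
  proof (rule poly_mapping_eqI)
    fix R show "lk D R = lk (emb (dv u) - emb (dv w)) R"
    proof (cases "R \<in> places K")
      case True
      thus ?thesis using f(4)[OF True] uw emb_dv A_sub_K by (simp add: lookup_minus pv_divide subset_iff)
    next
      case False
      moreover have "emb (dv u) - emb (dv w) \<in> Div0" by (intro Div0_diff emb_Div0 eff_dv uw)
      ultimately show ?thesis using f(1) lookup_outside by (metis (mono_tags, lifting) Div0_def mem_Collect_eq)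
    qed
  qed
  thus "\<exists>u w. u \<in> A \<and> w \<in> A \<and> u \<noteq> 0 \<and> w \<noteq> 0 \<and> D = emb (dv u) - emb (dv w)" using uw by blast
next
  assume "\<exists>u w. u \<in> A \<and> w \<in> A \<and> u \<noteq> 0 \<and> w \<noteq> 0 \<and> D = emb (dv u) - emb (dv w)"
  then obtain u w where uw: "u \<in> A" "w \<in> A" "u \<noteq> 0" "w \<noteq> 0" "D = emb (dv u) - emb (dv w)" by blast
  have "D \<in> Div0" unfolding uw(5) by (intro Div0_diff emb_Div0 eff_dv uw)
  moreover have "lk D R = place_val R (u / w)" if "R \<in> places K" for R
    using uw emb_dv that A_sub_K by (simp add: lookup_minus pv_divide subset_iff)
  moreover have "u / w \<in> K - {0}" using uw K_divide by auto
  ultimately show "D \<in> Prin" by (auto simp: Prin_def Div0_def)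
qed

lemma Prin_sub_Div0: "Prin \<subseteq> Div0"
  unfolding subset_iff Prin_iff by (auto intro!: Div0_diff emb_Div0 eff_dv)

lemma emb_dv_mult:
  assumes "u \<in> A" "w \<in> A" "u \<noteq> 0" "w \<noteq> 0"
  shows "emb (dv (u * w)) = emb (dv u) + emb (dv w)"
proof (rule degree_0_eqI)
  show "emb (dv (u * w)) \<in> Div0" "emb (dv u) + emb (dv w) \<in> Div0"
    using assms by (auto intro!: Div0_add emb_Div0 eff_dv A_mult)
  fix R assume "R \<in> Aff"
  thus "lk (emb (dv (u * w))) R = lk (emb (dv u) + emb (dv w)) R"
    using assms A_sub_K A_mult Aff_places by (simp add: emb_dv lookup_add pv_mult subset_iff)
qed

lemma Prin_dv: "u \<in> A \<Longrightarrow> u \<noteq> 0 \<Longrightarrow> emb (dv u) \<in> Prin"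
proof -
  assume u: "u \<in> A" "u \<noteq> 0"
  have "emb (dv 1) + emb (dv 1) = emb (dv (1 * 1))" using emb_dv_mult[OF A_1 A_1] by simp
  hence "emb (dv 1) = 0" by simp
  thus ?thesis unfolding Prin_iff using u A_1 by (intro exI[of _ u] exI[of _ 1]) auto
qed

lemma Prin_diff: "D \<in> Prin \<Longrightarrow> E \<in> Prin \<Longrightarrow> D - E \<in> Prin"
proof -
  assume "D \<in> Prin" "E \<in> Prin"
  then obtain a b c d where *: "D = emb (dv a) - emb (dv b)" "E = emb (dv c) - emb (dv d)"
    "a \<in> A" "b \<in> A" "c \<in> A" "d \<in> A" "a \<noteq> 0" "b \<noteq> 0" "c \<noteq> 0" "d \<noteq> 0" unfolding Prin_iff by blast
  have "D - E = emb (dv (a * d)) - emb (dv (b * c))" using * by (simp add: emb_dv_mult)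
  moreover have "a * d \<in> A" "b * c \<in> A" "a * d \<noteq> 0" "b * c \<noteq> 0" using * A_mult by auto
  ultimately show ?thesis unfolding Prin_iff by blast
qed

lemma Prin_0: "0 \<in> Prin"
  using Prin_diff[OF Prin_dv[OF A_1 one_neq_zero] Prin_dv[OF A_1 one_neq_zero]] by simp

lemma Prin_uminus: "D \<in> Prin \<Longrightarrow> - D \<in> Prin" and Prin_add: "D \<in> Prin \<Longrightarrow> E \<in> Prin \<Longrightarrow> D + E \<in> Prin"
  using Prin_diff[OF Prin_0, of D] Prin_diff[of D "- E"] Prin_diff[OF Prin_0, of E] by simp_all

text \<open>A function without affine poles lies in the coordinate ring.\<close>

lemma Prin_effective:
  assumes D: "eff D" and P: "emb D \<in> Prin"
  shows "\<exists>f\<in>A. f \<noteq> 0 \<and> dv f = D"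
proof -
  obtain f where f: "f \<in> K" "f \<noteq> 0" "\<And>R. R \<in> places K \<Longrightarrow> lk (emb D) R = place_val R f" using P by (auto simp: Prin_def)
  have v: "place_val R f = int (D R)" if "R \<in> Aff" for R
    using f(3)[OF Aff_places[OF that]] lookup_emb[OF D, of R] inf_not_Aff that by metis
  hence "f \<in> A" using in_A_iff[OF f(1,2)] by simp
  moreover have "dv f = D" using v D by (auto simp: dv_def eff_def fun_eq_iff)
  ultimately show ?thesis using f by blast
qed

section \<open>Divisor classes and the effective divisors that they contain\<close>

definition Cl :: "('k ambient set \<Rightarrow>\<^sub>0 int) \<Rightarrow> ('k ambient set \<Rightarrow>\<^sub>0 int) set" where
  "Cl D = {E. E - D \<in> Prin}"

lemma Cl_eq_iff: "Cl D = Cl E \<longleftrightarrow> D - E \<in> Prin"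
proof
  assume "Cl D = Cl E"
  moreover have "D \<in> Cl D" by (simp add: Cl_def Prin_0)
  ultimately show "D - E \<in> Prin" by (simp add: Cl_def)
next
  assume *: "D - E \<in> Prin"
  have "F - D \<in> Prin \<longleftrightarrow> F - E \<in> Prin" for F
    using Prin_add[of "F - D" "D - E"] Prin_diff[of "F - E" "D - E"] * by auto
  thus "Cl D = Cl E" by (simp add: Cl_def)
qed

lemma jacobian_group:
  defines "J \<equiv> jacobian_points (curve_field y)"
  shows "group J" and "carrier J = Cl ` Div0"
proof -
  define G where "G = div_group0 K"
  have G: "carrier G = Div0" "\<And>D E. D \<otimes>\<^bsub>G\<^esub> E = D + E" "\<one>\<^bsub>G\<^esub> = 0"
    by (auto simp: G_def div_group0_def div_group_def Div0_def free_Abelian_group_def)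
  have cg: "comm_group G"
  proof (rule comm_groupI)
    show "\<exists>E\<in>carrier G. E \<otimes>\<^bsub>G\<^esub> D = \<one>\<^bsub>G\<^esub>" if "D \<in> carrier G" for D
      using that Div0_uminus by (intro bexI[of _ "- D"]) (auto simp: G)
  qed (auto simp: G Div0_add Div0_0 add_ac)
  interpret comm_group G by (rule cg)
  have inv: "inv\<^bsub>G\<^esub> D = - D" if "D \<in> Div0" for D
    using that Div0_uminus by (intro inv_equality) (auto simp: G)
  have PD: "principal_divisors K = Prin"
    unfolding principal_divisors_def Prin_def div_group_def free_Abelian_group_def by auto
  have sub: "subgroup Prin G"
  proof (rule subgroupI)
    show "Prin \<subseteq> carrier G" using Prin_sub_Div0 G by simp
    show "Prin \<noteq> {}" using Prin_0 by blast
    show "inv\<^bsub>G\<^esub> D \<in> Prin" if "D \<in> Prin" for D using that inv Prin_sub_Div0 Prin_uminus by auto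
  qed (auto simp: G Prin_add)
  have norm: "Prin \<lhd> G" using subgroup_imp_normal[OF sub] .
  have J: "J = G Mod Prin"
    unfolding J_def jacobian_points_def K_def[symmetric] G_def PD ..
  show "group J" unfolding J using norm by (rule normal.factorgroup_is_group)
  have "Prin #>\<^bsub>G\<^esub> D = Cl D" for D
  proof -
    have "E \<in> Prin #>\<^bsub>G\<^esub> D \<longleftrightarrow> E - D \<in> Prin" for E
    proof
      assume "E \<in> Prin #>\<^bsub>G\<^esub> D"
      thus "E - D \<in> Prin" by (auto simp: r_coset_def G)
    next
      assume "E - D \<in> Prin"
      moreover have "E = (E - D) + D" by simp
      ultimately show "E \<in> Prin #>\<^bsub>G\<^esub> D" unfolding r_coset_def G by blast
    qed
    thus ?thesis by (auto simp: Cl_def)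
  qed
  thus "carrier J = Cl ` Div0" unfolding J carrier_FactGroup G by simp
qed

text \<open>A nonzero function \<open>u\<close> vanishing along the positive part of
  \<open>E\<close> makes \<open>dv u - E\<close> effective on the affine places; this is
  \<open>B\<close>. Classes in the form of the negative of an effective divisor turn the search for
  effective members into a search for functions in \<open>LL B\<close>.\<close>

lemma class_negative_rep:
  assumes E: "E \<in> Div0"
  shows "\<exists>B. eff B \<and> Cl E = Cl (- emb B)"
proof -
  define Ep where "Ep R = (if R \<in> Aff then nat (lk E R) else 0)" for R
  have "{R. Ep R \<noteq> 0} \<subseteq> Poly_Mapping.keys E" by (auto simp: Ep_def in_keys_iff)
  hence "finite {R. Ep R \<noteq> 0}" using finite_keys by (rule finite_subset)
  hence Ep: "eff Ep" unfolding eff_def by (simp add: Ep_def)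
  \<comment> \<open>By the inequality in \<open>card_LL\<close>, this makes \<open>LL Ep\<close>
    contain more than the zero function.\<close>
  obtain n where n: "card (Fil n) > p ^ deg Ep"
  proof
    have "p ^ deg Ep < p ^ Suc (deg Ep)" using p_gt_1 by (rule power_strict_increasing[OF lessI])
    also have "\<dots> \<le> card (Fil c0) * p ^ Suc (deg Ep)" using card_Fil_pos[of c0] by simp
    also have "\<dots> = card (Fil (c0 + Suc (deg Ep)))" by (simp only: card_Fil)
    finally show "p ^ deg Ep < card (Fil (c0 + Suc (deg Ep)))" .
  qed
  have "card (LL Ep \<inter> Fil n) > 1"
  proof (rule ccontr)
    assume "\<not> card (LL Ep \<inter> Fil n) > 1"
    hence "p ^ deg Ep * card (LL Ep \<inter> Fil n) \<le> p ^ deg Ep" by simp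
    moreover have "card (Fil n) \<le> p ^ deg Ep * card (LL Ep \<inter> Fil n)" using card_LL[OF Ep] by blast
    ultimately show False using n by linarith
  qed
  hence "\<not> LL Ep \<inter> Fil n \<subseteq> {0}" using card_mono[of "{0}" "LL Ep \<inter> Fil n"] by auto
  then obtain u where u: "u \<in> LL Ep" "u \<noteq> 0" by blast
  have uA: "u \<in> A" using u LL_A by blast
  define B where "B R = (if R \<in> Aff then nat (place_val R u - lk E R) else 0)" for R
  have ge: "lk E R \<le> place_val R u" if "R \<in> Aff" for R
    using u that by (fastforce simp: LL_def Ep_def split: if_splits)
  have "{R. B R \<noteq> 0} \<subseteq> {R. dv u R \<noteq> 0} \<union> Poly_Mapping.keys E"
    by (auto simp: B_def dv_def in_keys_iff)
  moreover have "finite ({R. dv u R \<noteq> 0} \<union> Poly_Mapping.keys E)" using eff_dv[OF uA u(2)] by (simp add: eff_def)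
  ultimately have "finite {R. B R \<noteq> 0}" by (rule finite_subset)
  hence B: "eff B" unfolding eff_def by (simp add: B_def)
  have "emb (dv u) - E = emb B"
  proof (rule degree_0_eqI)
    show "emb (dv u) - E \<in> Div0" "emb B \<in> Div0" using uA u B E by (auto intro!: Div0_diff emb_Div0 eff_dv)
    fix R assume R: "R \<in> Aff"
    thus "lk (emb (dv u) - E) R = lk (emb B) R"
      using emb_dv[OF uA u(2) Aff_places[OF R]] lookup_emb[OF B] ge[OF R] inf_not_Aff by (auto simp: lookup_minus B_def)
  qed
  hence "E - (- emb B) = emb (dv u)" by (simp add: algebra_simps)
  hence "Cl E = Cl (- emb B)" unfolding Cl_eq_iff using Prin_dv[OF uA u(2)] by simp
  thus ?thesis using B by blast
qed

lemma emb_add: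
  assumes "eff D" "eff B" shows "emb (\<lambda>R. D R + B R) = emb D + emb B"
proof (rule degree_0_eqI)
  show "emb (\<lambda>R. D R + B R) \<in> Div0" "emb D + emb B \<in> Div0" using assms deg_add(1) by (auto intro!: Div0_add emb_Div0)
  fix R assume "R \<in> Aff"
  thus "lk (emb (\<lambda>R. D R + B R)) R = lk (emb D + emb B) R"
    using lookup_emb[OF deg_add(1)[OF assms]] lookup_emb[OF assms(1)] lookup_emb[OF assms(2)] inf_not_Aff
    by (auto simp: lookup_add)
qed

text \<open>\<open>D\<close> lies in the class of minus \<open>B\<close> exactly when
  \<open>D + B\<close> is principal, and being effective it is then the divisor of a function in
  \<open>A\<close>.\<close>

lemma class_effective_iff:
  assumes D: "eff D" and B: "eff B"
  shows "Cl (emb D) = Cl (- emb B) \<longleftrightarrow> (\<exists>f\<in>A. f \<noteq> 0 \<and> dv f = (\<lambda>R. D R + B R))"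
proof -
  have "Cl (emb D) = Cl (- emb B) \<longleftrightarrow> emb (\<lambda>R. D R + B R) \<in> Prin"
    unfolding Cl_eq_iff by (simp add: emb_add[OF D B])
  also have "\<dots> \<longleftrightarrow> (\<exists>f\<in>A. f \<noteq> 0 \<and> dv f = (\<lambda>R. D R + B R))"
  proof
    assume "\<exists>f\<in>A. f \<noteq> 0 \<and> dv f = (\<lambda>R. D R + B R)"
    then obtain f where f: "f \<in> A" "f \<noteq> 0" "dv f = (\<lambda>R. D R + B R)" by blast
    show "emb (\<lambda>R. D R + B R) \<in> Prin" using Prin_dv[OF f(1,2)] unfolding f(3) .
  qed (rule Prin_effective[OF deg_add(1)[OF D B]])
  finally show ?thesis .
qed

definition Eff :: "nat \<Rightarrow> ('k ambient set \<Rightarrow> nat) set" where "Eff n = {D. eff D \<and> deg D = n}"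

lemma LL_iff_dv: "f \<in> A \<Longrightarrow> f \<noteq> 0 \<Longrightarrow> eff B \<Longrightarrow> f \<in> LL B \<longleftrightarrow> (\<forall>R. B R \<le> dv f R)"
proof -
  assume f: "f \<in> A" "f \<noteq> 0" and B: "eff B"
  have "B R \<le> dv f R \<longleftrightarrow> (R \<in> Aff \<longrightarrow> int (B R) \<le> place_val R f)" for R
    using pv_nonneg[of R f] f B by (cases "R \<in> Aff") (auto simp: dv_def eff_def)
  thus ?thesis using f by (auto simp: LL_def)
qed

lemma sub_eff:
  assumes "eff E" "eff B" "\<forall>R. B R \<le> E R"
  shows "eff (\<lambda>R. E R - B R)" "deg E = deg (\<lambda>R. E R - B R) + deg B"
proof -
  have "{R. E R - B R \<noteq> 0} \<subseteq> {R. E R \<noteq> 0}" by auto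
  moreover have "finite {R. E R \<noteq> 0}" using assms(1) by (simp add: eff_def)
  ultimately have "finite {R. E R - B R \<noteq> 0}" by (rule finite_subset)
  thus e: "eff (\<lambda>R. E R - B R)" using assms(1) unfolding eff_def by simp
  have "(\<lambda>R. (E R - B R) + B R) = E" using assms(3) by auto
  thus "deg E = deg (\<lambda>R. E R - B R) + deg B" using deg_add(2)[OF e assms(2)] by simp
qed

text \<open>The quotient has neither affine zeros nor affine poles, so it lies in \<open>A\<close>,
  and by the product formula its pole order is 0; such functions are constant.\<close>

lemma dv_eq_iff:
  assumes "f \<in> A" "f \<noteq> 0" "g \<in> A" "g \<noteq> 0"
  shows "dv f = dv g \<longleftrightarrow> (\<exists>c. c \<noteq> 0 \<and> f = const c * g)"
proof
  assume eq: "dv f = dv g"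
  have v: "place_val R f = place_val R g" if R: "R \<in> Aff" for R
    using fun_cong[OF eq, of R] pv_nonneg[OF R assms(1,2)] pv_nonneg[OF R assms(3,4)] R by (simp add: dv_def)
  have "f / g \<in> A"
    using assms K_divide A_sub_K v by (subst in_A_iff) (auto simp: pv_divide Aff_places subset_iff)
  moreover have "pole f = pole g" using deg_dv assms eq by metis
  hence "pole (f / g) = 0" using pole_mult[of "f / g" g] \<open>f / g \<in> A\<close> assms by simp
  ultimately obtain c where c: "f / g = const c" using pole_0_const by blast
  hence "f = const c * g" using assms by (simp add: field_simps)
  thus "\<exists>c. c \<noteq> 0 \<and> f = const c * g" using assms const.zero by (intro exI[of _ c]) auto
next
  assume "\<exists>c. c \<noteq> 0 \<and> f = const c * g"
  then obtain c where "c \<noteq> 0" "f = const c * g" by blast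
  thus "dv f = dv g"
    using assms A_sub_K A_const by (auto simp: dv_def fun_eq_iff pv_mult pv_const Aff_places const_eq_0_iff subset_iff)
qed

text \<open>Affine places correspond to Frobenius orbits of points, with the degree as orbit size. A
  place in the support of a divisor of degree \<open>n\<close> has degree at most \<open>n\<close>,
  and so has the orbit below it, so the truncated set of orbits suffices.\<close>

lemma finite_Eff: "finite (Eff n)" and card_Eff: "int (card (Eff n)) = fps_nth (\<Prod>O'\<in>curve_orbs n. geo 1 (card O')) n"
proof -
  define F where "F = loc ` {P \<in> pts. line.per (fst P) \<le> n}"
  define g where "g O' = loc (SOME P. P \<in> O')" for O'
  have gl: "g (curve.orb P) = loc P" if P: "P \<in> pts" for P
  proof -
    have "(SOME P'. P' \<in> curve.orb P) \<in> curve.orb P" using curve.orb_self by (rule someI)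
    moreover from this have "(SOME P'. P' \<in> curve.orb P) \<in> pts" using curve.orb_subset[OF frp_pts P] by blast
    ultimately show ?thesis unfolding g_def using loc_eq_iff[OF _ P] curve.orb_eqI by metis
  qed
  have bij: "bij_betw g (curve_orbs n) F"
    unfolding bij_betw_def
  proof
    show "inj_on g (curve_orbs n)"
      by (rule inj_onI) (auto simp: curve_orbs_def gl loc_eq_iff)
    show "g ` curve_orbs n = F" unfolding curve_orbs_def F_def image_image by (intro image_cong) (auto simp: gl)
  qed
  have dg: "place_degree (g O') = card O'" if "O' \<in> curve_orbs n" for O'
  proof -
    obtain P where "P \<in> pts" "O' = curve.orb P" using \<open>O' \<in> curve_orbs n\<close> by (auto simp: curve_orbs_def)
    thus ?thesis using gl card_residue_loc(2) curve.card_orb by simp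
  qed
  have finC: "finite (curve_orbs n)"
  proof -
    have "{P \<in> pts. line.per (fst P) \<le> n} = fibre {z. line.per z \<le> n}" by (auto simp: fibre_def)
    thus ?thesis using finite_fibre[OF finite_per_le] by (simp add: curve_orbs_def)
  qed
  hence finF: "finite F" using bij bij_betw_finite by blast
  have FA: "F \<subseteq> Aff" by (auto simp: F_def Aff_def)
  have dpos: "place_degree R > 0" if R: "R \<in> Aff" for R
    using R card_residue_loc(2) curve.per_pos by (auto simp: Aff_def)
  have "Eff n = weighted F place_degree n"
  proof (intro equalityI subsetI)
    fix D assume D: "D \<in> Eff n"
    have "R \<in> F" if R: "D R \<noteq> 0" for R
    proof -
      have RA: "R \<in> Aff" using D R by (auto simp: Eff_def eff_def)
      then obtain P where P: "P \<in> pts" "R = loc P" by (auto simp: Aff_def)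
      have fin: "finite {R. D R \<noteq> 0}" using D by (simp add: Eff_def eff_def)
      have "D R * place_degree R \<le> deg D" unfolding deg_def using R fin by (intro member_le_sum) auto
      moreover have "place_degree R \<le> D R * place_degree R" using R by simp
      ultimately have "place_degree R \<le> deg D" by (rule order_trans[rotated])
      hence "curve.per P \<le> n" using D card_residue_loc(2)[OF P(1)] P by (simp add: Eff_def)
      moreover have "line.per (fst P) dvd curve.per P"
        using curve_per_dvd[of "fst P" "snd P" "curve.per P"] line_per_dvd[of "fst P" "curve.per P"] by simp
      hence "line.per (fst P) \<le> curve.per P" using curve.per_pos dvd_imp_le by blast
      ultimately show ?thesis using P by (auto simp: F_def)
    qed
    moreover from this have "deg D = (\<Sum>R\<in>F. D R * place_degree R)" by (intro deg_superset finF) auto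
    ultimately show "D \<in> weighted F place_degree n" using D by (auto simp: weighted_def Eff_def)
  next
    fix D assume D: "D \<in> weighted F place_degree n"
    hence sub: "{R. D R \<noteq> 0} \<subseteq> F" by (auto simp: weighted_def)
    hence "eff D" using finF FA finite_subset by (auto simp: eff_def)
    moreover have "deg D = n" using deg_superset[OF finF sub] D by (simp add: weighted_def)
    ultimately show "D \<in> Eff n" by (simp add: Eff_def)
  qed
  moreover have "finite (weighted F place_degree n) \<and> int (card (weighted F place_degree n)) = fps_nth (\<Prod>R\<in>F. geo 1 (place_degree R)) n"
    using finF FA dpos by (intro weighted_finite_card) auto
  moreover have "(\<Prod>R\<in>F. geo 1 (place_degree R)) = (\<Prod>O'\<in>curve_orbs n. geo 1 (card O'))"
    using dg by (subst prod.reindex_bij_betw[OF bij, symmetric]) (auto intro: prod.cong)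
  ultimately show "finite (Eff n)" "int (card (Eff n)) = fps_nth (\<Prod>O'\<in>curve_orbs n. geo 1 (card O')) n" by auto
qed

text \<open>With the class written as minus \<open>B\<close> and \<open>b = deg B\<close>, its
  members \<open>D\<close> correspond to the functions in \<open>LL B\<close> of pole order exactly
  \<open>deg D + b\<close>, up to nonzero scalars. Their number is the difference of two consecutive
  filtration sizes, divided by \<open>p^b\<close> and by \<open>p - 1\<close>.\<close>

lemma card_class_fibre:
  assumes E: "E \<in> Div0"
  shows "\<exists>n0. \<forall>n\<ge>n0. card {D \<in> Eff (Suc c0 + n). Cl (emb D) = Cl E} = card (Fil c0) * p ^ n"
proof -
  obtain B where B: "eff B" "Cl E = Cl (- emb B)" using class_negative_rep[OF E] by blast
  define b where "b = deg B"
  obtain n0 where n0: "\<And>n. n \<ge> n0 \<Longrightarrow> card (Fil n) = p ^ b * card (LL B \<inter> Fil n)" using card_LL[OF B(1)] b_def by blast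
  have "card {D \<in> Eff (Suc c0 + n). Cl (emb D) = Cl E} = card (Fil c0) * p ^ n" if n: "n \<ge> n0" for n
  proof -
    \<comment> \<open>\<open>Suc m\<close> is the sum of the degree \<open>Suc c0 + n\<close> and of
      \<open>b\<close>. Starting at \<open>Suc c0\<close> keeps both \<open>m\<close> and
      \<open>Suc m\<close> in the range where \<open>card_Fil\<close> applies.\<close>
    define m where "m = c0 + n + b"
    define S where "S = LL B \<inter> Fil (Suc m) - LL B \<inter> Fil m"
    \<comment> \<open>On \<open>S\<close> the subtraction is never truncated, since membership in
      \<open>LL B\<close> means that \<open>B\<close> is bounded by \<open>dv f\<close>.\<close>
    define h where "h f = (\<lambda>R. dv f R - B R)" for f
    have S_iff: "f \<in> S \<longleftrightarrow> f \<in> A \<and> f \<noteq> 0 \<and> pole f = Suc m \<and> f \<in> LL B" for f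
      using LL_A LL_0 zero_Fil by (auto simp: S_def Fil_def pole_0)
    have img: "h ` S = {D \<in> Eff (Suc c0 + n). Cl (emb D) = Cl E}"
    proof (intro equalityI subsetI)
      fix D assume "D \<in> h ` S"
      then obtain f where f: "D = h f" "f \<in> A" "f \<noteq> 0" "pole f = Suc m" "f \<in> LL B" using S_iff by auto
      have le: "\<forall>R. B R \<le> dv f R" using LL_iff_dv f B by blast
      note se = sub_eff[OF eff_dv[OF f(2,3)] B(1) le]
      have D: "eff D" "Suc m = deg D + b" using se f deg_dv by (auto simp: h_def b_def)
      have "dv f = (\<lambda>R. D R + B R)" using le by (auto simp: f(1) h_def)
      hence "Cl (emb D) = Cl E" using class_effective_iff[OF D(1) B(1)] B f by auto
      thus "D \<in> {D \<in> Eff (Suc c0 + n). Cl (emb D) = Cl E}" using D by (simp add: Eff_def m_def)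
    next
      fix D assume "D \<in> {D \<in> Eff (Suc c0 + n). Cl (emb D) = Cl E}"
      hence D: "eff D" "deg D = Suc c0 + n" "Cl (emb D) = Cl (- emb B)" using B by (auto simp: Eff_def)
      then obtain f where f: "f \<in> A" "f \<noteq> 0" "dv f = (\<lambda>R. D R + B R)" using class_effective_iff[OF D(1) B(1)] by blast
      have "pole f = Suc m" using deg_dv[OF f(1,2)] f(3) deg_add(2)[OF D(1) B(1)] D by (simp add: m_def b_def)
      moreover have "f \<in> LL B" using LL_iff_dv[OF f(1,2) B(1)] f(3) by simp
      moreover have "D = h f" using f by (simp add: h_def)
      ultimately show "D \<in> h ` S" using S_iff f by blast
    qed
    \<comment> \<open>Functions with the same divisor differ by one of the \<open>p - 1\<close>
      nonzero constants.\<close>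
    have "card S = card (h ` S) * (p - 1)"
    proof (rule card_eq_fibres)
      show "finite S" using finite_Fil by (simp add: S_def)
      fix f assume "f \<in> S"
      hence f: "f \<in> A" "f \<noteq> 0" "pole f = Suc m" "f \<in> LL B" using S_iff by auto
      have "{g \<in> S. h g = h f} = (\<lambda>c. const c * f) ` (UNIV - {0})"
      proof (intro equalityI subsetI)
        fix g assume "g \<in> {g \<in> S. h g = h f}"
        hence g: "g \<in> A" "g \<noteq> 0" "g \<in> LL B" "h g = h f" using S_iff by auto
        have "dv g R = dv f R" for R
        proof -
          have "B R \<le> dv g R" "B R \<le> dv f R" using LL_iff_dv[OF g(1,2) B(1)] LL_iff_dv[OF f(1,2) B(1)] f g by auto
          thus ?thesis using fun_cong[OF g(4), of R] by (simp add: h_def)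
        qed
        hence "dv g = dv f" by blast
        thus "g \<in> (\<lambda>c. const c * f) ` (UNIV - {0})" using dv_eq_iff[OF g(1,2) f(1,2)] by blast
      next
        fix g assume "g \<in> (\<lambda>c. const c * f) ` (UNIV - {0})"
        then obtain c where c: "c \<noteq> 0" "g = const c * f" by blast
        have g: "g \<in> A" "g \<noteq> 0" using c f A_mult A_const const_eq_0_iff by auto
        have eq: "dv g = dv f" using dv_eq_iff[OF g f(1,2)] c by blast
        have "pole g = Suc m" using deg_dv g f eq by metis
        moreover have "g \<in> LL B" using LL_iff_dv[OF g B(1)] LL_iff_dv[OF f(1,2) B(1)] f eq by simp
        ultimately show "g \<in> {g \<in> S. h g = h f}" using S_iff g eq by (simp add: h_def)
      qed
      moreover have "inj_on (\<lambda>c. const c * f) (UNIV - {0})"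
      proof (rule inj_onI)
        fix c d assume "const c * f = const d * f"
        hence "const (c - d) = 0" using f by (simp add: const.diff)
        thus "c = d" by (simp add: const_eq_0_iff)
      qed
      ultimately show "card {g \<in> S. h g = h f} = p - 1" by (simp add: card_image card_k card_Diff_singleton)
    qed
    moreover have "card S = card (LL B \<inter> Fil (Suc m)) - card (LL B \<inter> Fil m)"
      unfolding S_def using finite_Fil Fil_mono[of m "Suc m"] by (intro card_Diff_subset) auto
    ultimately have "p ^ b * (card (h ` S) * (p - 1)) = p ^ b * (card (LL B \<inter> Fil (Suc m)) - card (LL B \<inter> Fil m))"
      by simp
    also have "\<dots> = card (Fil (Suc m)) - card (Fil m)"
      unfolding diff_mult_distrib2 using n0[of m] n0[of "Suc m"] n by (simp add: m_def)
    also have "card (Fil m) = card (Fil c0) * p ^ (n + b)" using card_Fil[of "n + b"] by (simp add: m_def add.assoc)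
    also have "card (Fil (Suc m)) = card (Fil c0) * p ^ (n + b) * p" using card_Fil[of "Suc (n + b)"] by (simp add: m_def add.assoc)
    also have "card (Fil c0) * p ^ (n + b) * p - card (Fil c0) * p ^ (n + b) = p ^ b * (card (Fil c0) * p ^ n * (p - 1))"
      unfolding power_add diff_mult_distrib2 mult_1_right by (simp only: mult_ac)
    finally have "card (h ` S) * (p - 1) = card (Fil c0) * p ^ n * (p - 1)" using p_pos by simp
    moreover have "p - 1 > 0" using p_gt_1 by simp
    ultimately have "card (h ` S) = card (Fil c0) * p ^ n" by simp
    thus ?thesis using img by simp
  qed
  thus ?thesis by blast
qed

text \<open>By the inequality in \<open>card_LL\<close>, passing from pole order \<open>c0\<close>
  to \<open>c0 + b\<close> makes up for the \<open>b\<close> conditions imposed by \<open>B\<close>,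
  so \<open>LL B\<close> contains a nonzero function of pole order at most \<open>c0 + b\<close>. It
  leaves an effective divisor of degree at most \<open>c0\<close>, and there are finitely many of
  these, hence finitely many classes.\<close>

lemma class_small_rep:
  assumes E: "E \<in> Div0"
  shows "\<exists>n\<le>c0. \<exists>D\<in>Eff n. Cl (emb D) = Cl E"
proof -
  obtain B where B: "eff B" "Cl E = Cl (- emb B)" using class_negative_rep[OF E] by blast
  define b where "b = deg B"
  have "card (Fil c0) * p ^ b \<le> p ^ b * card (LL B \<inter> Fil (c0 + b))"
    using card_LL[OF B(1)] card_Fil[of b] b_def by metis
  hence "card (Fil c0) \<le> card (LL B \<inter> Fil (c0 + b))" using p_pos by (simp add: mult.commute)
  moreover obtain e where "e > 0" "card (Fil c0) = p ^ e" using finite_card_Fil by blast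
  hence "card (Fil c0) > 1" using p_gt_1 by (metis one_less_power)
  ultimately have "card (LL B \<inter> Fil (c0 + b)) > 1" by linarith
  hence "\<not> LL B \<inter> Fil (c0 + b) \<subseteq> {0}" using card_mono[of "{0}" "LL B \<inter> Fil (c0 + b)"] by auto
  then obtain f where f: "f \<in> LL B" "f \<in> Fil (c0 + b)" "f \<noteq> 0" by blast
  have fA: "f \<in> A" using f LL_A by blast
  define D where "D R = dv f R - B R" for R
  have le: "\<forall>R. B R \<le> dv f R" using LL_iff_dv f fA B by blast
  note se = sub_eff[OF eff_dv[OF fA f(3)] B(1) le]
  have D: "eff D" "pole f = deg D + b" using se f fA deg_dv by (auto simp: D_def[abs_def] b_def)
  have "dv f = (\<lambda>R. D R + B R)" using le by (auto simp: D_def)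
  hence "Cl (emb D) = Cl E" using class_effective_iff[OF D(1) B(1)] B f fA by auto
  moreover have "deg D \<le> c0" using D(2) f(2) by (simp add: Fil_def)
  ultimately show ?thesis using D(1) by (auto simp: Eff_def)
qed

text \<open>Each class has its own threshold for the exact count; as there are finitely many
  classes, the largest threshold serves all of them at once.\<close>

theorem class_number:
  defines "J \<equiv> jacobian_points (curve_field y)"
  shows "finite (carrier J)"
    and "\<exists>n0. \<forall>n\<ge>n0. card (Eff (Suc c0 + n)) = Coset.order J * (card (Fil c0) * p ^ n)"
proof -
  have J: "carrier J = Cl ` Div0" unfolding J_def by (rule jacobian_group)
  have "carrier J \<subseteq> (\<lambda>D. Cl (emb D)) ` (\<Union>n\<le>c0. Eff n)"
  proof
    fix c assume "c \<in> carrier J"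
    then obtain E where "E \<in> Div0" "c = Cl E" using J by blast
    thus "c \<in> (\<lambda>D. Cl (emb D)) ` (\<Union>n\<le>c0. Eff n)" using class_small_rep[of E] by auto
  qed
  thus fin: "finite (carrier J)" using finite_Eff finite_subset by (metis finite_UN finite_atMost finite_imageI)
  have "\<forall>c\<in>carrier J. \<exists>n0. \<forall>n\<ge>n0. card {D \<in> Eff (Suc c0 + n). Cl (emb D) = c} = card (Fil c0) * p ^ n"
    using card_class_fibre J by auto
  from bchoice[OF this] obtain N where "\<forall>c\<in>carrier J. \<forall>n\<ge>N c. card {D \<in> Eff (Suc c0 + n). Cl (emb D) = c} = card (Fil c0) * p ^ n"
    by blast
  hence N: "\<And>c n. c \<in> carrier J \<Longrightarrow> n \<ge> N c \<Longrightarrow> card {D \<in> Eff (Suc c0 + n). Cl (emb D) = c} = card (Fil c0) * p ^ n"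
    by blast
  have "card (Eff (Suc c0 + n)) = Coset.order J * (card (Fil c0) * p ^ n)" if n: "n \<ge> Max (N ` carrier J)" for n
  proof -
    have Nn: "n \<ge> N c" if "c \<in> carrier J" for c using n fin that by (meson Max_ge finite_imageI image_eqI order_trans)
    have "Eff (Suc c0 + n) = (\<Union>c\<in>carrier J. {D \<in> Eff (Suc c0 + n). Cl (emb D) = c})"
      using J emb_Div0 by (auto simp: Eff_def)
    hence "card (Eff (Suc c0 + n)) = card (\<Union>c\<in>carrier J. {D \<in> Eff (Suc c0 + n). Cl (emb D) = c})" by simp
    also have "\<dots> = (\<Sum>c\<in>carrier J. card {D \<in> Eff (Suc c0 + n). Cl (emb D) = c})"
      using fin finite_Eff by (intro card_UN_disjoint) auto
    also have "\<dots> = (\<Sum>c\<in>carrier J. card (Fil c0) * p ^ n)" using N Nn by (intro sum.cong) auto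
    finally show ?thesis by (simp add: Coset.order_def)
  qed
  thus "\<exists>n0. \<forall>n\<ge>n0. card (Eff (Suc c0 + n)) = Coset.order J * (card (Fil c0) * p ^ n)" by blast
qed

theorem q_dvd_class_number_iff:
  "q dvd Coset.order (jacobian_points (curve_field y)) \<longleftrightarrow> p dvd k"
proof -
  define h where "h = Coset.order (jacobian_points (curve_field y))"
  obtain n0 where n0: "\<And>n. n \<ge> n0 \<Longrightarrow> card (Eff (Suc c0 + n)) = h * (card (Fil c0) * p ^ n)"
    unfolding h_def using class_number(2) by blast
  obtain n1 where n1: "\<And>n. n \<ge> n1 \<Longrightarrow> int q dvd fps_nth (\<Prod>O'\<in>curve_orbs n. geo 1 (card O')) n \<longleftrightarrow> p dvd k"
    using curve_orbs_zeta by blast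
  define n where "n = n0 + n1"
  obtain e where "card (Fil c0) = p ^ e" using finite_card_Fil by blast
  hence "card (Eff (Suc c0 + n)) = h * p ^ (e + n)" using n0[of n] by (simp add: n_def power_add)
  hence "q dvd card (Eff (Suc c0 + n)) \<longleftrightarrow> q dvd h"
    using coprime_qp by (simp add: coprime_dvd_mult_left_iff)
  moreover have "int q dvd int (card (Eff (Suc c0 + n))) \<longleftrightarrow> p dvd k"
    unfolding card_Eff by (rule n1) (simp add: n_def)
  ultimately show ?thesis by (simp add: h_def)
qed

end

theorem theorem8:
  fixes p q :: nat and a :: "'k :: {field, finite}" and y :: "'k ambient"
  assumes "prime p" and "prime q" and "p \<noteq> q"
    and "CARD('k) = p"
    and "a \<noteq> 0"
    and "y ^ q = var_x ^ p - var_x + const a"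
  defines "J \<equiv> jacobian_points (curve_field y)"
  shows "\<not> (\<exists>c \<in> carrier J. c \<noteq> \<one>\<^bsub>J\<^esub> \<and> c [^]\<^bsub>J\<^esub> q = \<one>\<^bsub>J\<^esub>) \<longleftrightarrow> \<not> p dvd ord q p"
proof -
  interpret superelliptic p "TYPE('k)" q a y
    by unfold_locales (use assms in auto)
  have "group J" "finite (carrier J)" unfolding J_def by (rule jacobian_group class_number)+
  thus ?thesis
    using exists_order_prime_iff[OF _ _ assms(2), of J] q_dvd_class_number_iff unfolding J_def k_def by simp
qed

end
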